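(* Let $({\bf M},F)$ be a Landsberg space with averaged Chern connection $\langle\nabla^{ch}\rangle$. Suppose that $\langle\nabla^{ch}\rangle$ does not leave invariant any compact submanifold of codimension zero of ${\bf T}_x{\bf M}$ of the form $\bigcup_{t\in[0,1]}{\bf I}_x(t)$; that is, for every $x\in{\bf M}$ and every Riemannian metric $h$ on ${\bf M}$ such that $\bigcup_{t\in[0,1]}{\bf I}_x(t)$ is a compact submanifold (possibly with boundary) of codimension zero of ${\bf T}_x{\bf M}$, this set is not invariant under the holonomy group of $\langle\nabla^{ch}\rangle$ at $x$, where $${\bf I}_x(t)=\{y\in{\bf T}_x{\bf M}: F_t(x,y)=1\},\qquad F_t(x,y)=(1-t)F(x,y)+t\sqrt{h_{ij}(x)y^iy^j}.$$ Then $({\bf M},F)$ is a pure Landsberg space.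
   Context: ${\bf M}$ is an $n$-dimensional smooth manifold, ${\bf N}={\bf TM}\setminus\{0\}$ is the slit tangent bundle, $\pi:{\bf N}\to{\bf M}$ the projection, $(x^i,y^i)$ natural coordinates on ${\bf TM}$. A Finsler structure on ${\bf M}$ is a function $F:{\bf TM}\to[0,\infty)$, smooth on ${\bf N}$, with $F(x,\lambda y)=\lambda F(x,y)$ for $\lambda>0$, and such that $g_{ij}(x,y)=\frac12\frac{\partial^2F^2}{\partial y^i\partial y^j}$ is positive definite on ${\bf N}$. Put $A_{ijk}=\frac F2\frac{\partial g_{ij}}{\partial y^k}$, $A^i_{jk}=g^{il}A_{ljk}$, $\gamma^i_{jk}=\frac12g^{is}\left(\frac{\partial g_{sj}}{\partial x^k}-\frac{\partial g_{jk}}{\partial x^s}+\frac{\partial g_{sk}}{\partial x^j}\right)$, $N^i_j=\gamma^i_{jk}y^k-A^i_{jk}\gamma^k_{rs}\frac{y^ry^s}{F}$, $\delta y^i=dy^i+N^i_jdx^j$, and $\frac{\delta}{\delta x^j}=\frac{\partial}{\partial x^j}-N^i_j\frac{\partial}{\partial y^i}$. The horizontal lift of $X=X^i\partial_i\in{\bf T}_x{\bf M}$ to $u\in\pi^{-1}(x)$ is $\iota_u(X)=X^i\frac{\delta}{\delta x^i}|_u$. $\pi^*{\bf TM}\to{\bf N}$ is the pull-back bundle, with canonical isomorphism $\pi_2|_u$ from its fibre over $u\in\pi^{-1}(x)$ to ${\bf T}_x{\bf M}$. The Chern connection $\nabla^{ch}$ is the unique linear connection on $\pi^*{\bf TM}$,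 $\nabla^{ch}(\pi^*\partial_j)=\omega^i_j\pi^*\partial_i$, with $dx^j\wedge\omega^i_j=0$ and $dg_{ij}-g_{kj}\omega^k_i-g_{ik}\omega^k_j=2A_{ijk}\frac{\delta y^k}{F}$; then $\omega^i_j=\Gamma^i_{jk}(x,y)dx^k$. The indicatrix at $x$ is ${\bf I}_x=\{y\in{\bf T}_x{\bf M}:F(x,y)=1\}$. The averaged connection is the affine connection on ${\bf M}$ given by $$\langle\nabla^{ch}\rangle_XY=\frac1{\mathrm{vol}({\bf I}_x)}\int_{{\bf I}_x}\pi_2|_u\,\nabla^{ch}_{\iota_u(X)}\pi^*Y\;dvol(u),\quad X\in{\bf T}_x{\bf M},$$ where $dvol$ is the volume form induced on ${\bf I}_x$ by the Riemannian metric $g_{ij}(x,y)dy^i\otimes dy^j$ on ${\bf T}_x{\bf M}\setminus\{0\}$. The $hv$-curvature of the Chern connection is $P_j{}^i{}_{kl}=-F\frac{\partial\Gamma^i_{jk}}{\partial y^l}$, $P_{jikl}=g_{im}P_j{}^m{}_{kl}$, and $\dot A_{ikl}=-\frac{y^j}{F}P_{jikl}$. $({\bf M},F)$ is a Landsberg space if $\dot A_{ikl}=0$. It is Berwald if the coefficients $\Gamma^i_{jk}$ in natural coordinates depend only on $x$, and locally Minkowski if around each point there are coordinates in which $F$ depends only on $y$. A pure Landsberg space is a Landsberg space which is neither Berwald nor locally Minkowski. *)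

theory Defs
  imports "HOL-Analysis.Analysis"
begin

section \<open>Smooth maps and smooth manifolds\<close>

text \<open>Meant for open sets \<open>S\<close> of Euclidean spaces, where quantifying over the direction \<open>v\<close>
  amounts to taking all partial derivatives.\<close>

primrec C_on :: "nat \<Rightarrow> 'a::real_normed_vector set \<Rightarrow> ('a \<Rightarrow> 'b::real_normed_vector) \<Rightarrow> bool" where
  "C_on 0 S f \<longleftrightarrow> continuous_on S f"
| "C_on (Suc k) S f \<longleftrightarrow> (\<forall>x\<in>S. f differentiable (at x)) \<and>
     (\<forall>v. C_on k S (\<lambda>x. frechet_derivative f (at x) v))"

definition smooth_on :: "'a::real_normed_vector set \<Rightarrow> ('a \<Rightarrow> 'b::real_normed_vector) \<Rightarrow> bool" where
  "smooth_on S f \<longleftrightarrow> (\<forall>k. C_on k S f)"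

text \<open>A chart is a pair of its domain and its coordinate map; the values of the coordinate map
  outside the domain are irrelevant.\<close>

type_synonym ('m, 'n) chart = "'m set \<times> ('m \<Rightarrow> real^'n)"

definition is_chart :: "('m::topological_space, 'n::finite) chart \<Rightarrow> bool" where
  "is_chart \<kappa> \<longleftrightarrow> open (fst \<kappa>) \<and> open (snd \<kappa> ` fst \<kappa>) \<and>
     (\<exists>\<psi>. homeomorphism (fst \<kappa>) (snd \<kappa> ` fst \<kappa>) (snd \<kappa>) \<psi>)"

definition chart_inv :: "('m, 'n::finite) chart \<Rightarrow> real^'n \<Rightarrow> 'm" where
  "chart_inv \<kappa> = inv_into (fst \<kappa>) (snd \<kappa>)"

definition transition :: "('m, 'n::finite) chart \<Rightarrow> ('m, 'n) chart \<Rightarrow> real^'n \<Rightarrow> real^'n" where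
  "transition \<kappa> \<kappa>' = snd \<kappa>' \<circ> chart_inv \<kappa>"

definition compatible_charts :: "('m, 'n::finite) chart \<Rightarrow> ('m, 'n) chart \<Rightarrow> bool" where
  "compatible_charts \<kappa> \<kappa>' \<longleftrightarrow>
     smooth_on (snd \<kappa> ` (fst \<kappa> \<inter> fst \<kappa>')) (transition \<kappa> \<kappa>') \<and>
     smooth_on (snd \<kappa>' ` (fst \<kappa> \<inter> fst \<kappa>')) (transition \<kappa>' \<kappa>)"

definition points :: "('m, 'n::finite) chart set \<Rightarrow> 'm set" where
  "points \<A> = (\<Union>\<kappa>\<in>\<A>. fst \<kappa>)"

text \<open>A manifold is given by its maximal smooth atlas \<open>\<A>\<close>; its underlying space is the open
  subset \<open>points \<A>\<close> of a Hausdorff second countable space, and its dimension is \<open>CARD('n)\<close>.\<close>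

definition smooth_manifold ::
    "('m::{t2_space, second_countable_topology}, 'n::finite) chart set \<Rightarrow> bool" where
  "smooth_manifold \<A> \<longleftrightarrow>
     (\<forall>\<kappa>\<in>\<A>. is_chart \<kappa>) \<and>
     (\<forall>\<kappa>\<in>\<A>. \<forall>\<kappa>'\<in>\<A>. compatible_charts \<kappa> \<kappa>') \<and>
     (\<forall>\<kappa>. is_chart \<kappa> \<and> fst \<kappa> \<subseteq> points \<A> \<and> (\<forall>\<kappa>'\<in>\<A>. compatible_charts \<kappa> \<kappa>') \<longrightarrow> \<kappa> \<in> \<A>)"

definition charts_at :: "('m, 'n::finite) chart set \<Rightarrow> 'm \<Rightarrow> ('m, 'n) chart set" where
  "charts_at \<A> x = {\<kappa>\<in>\<A>. x \<in> fst \<kappa>}"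


section \<open>Tangent vectors\<close>

text \<open>A tangent vector at \<open>x\<close> is the family \<open>v\<close> of its component vectors \<open>v \<kappa>\<close> in all charts
  \<open>\<kappa>\<close> around \<open>x\<close>, related by the Jacobians of the coordinate changes
  (and normalised to \<open>0\<close> on the other charts).\<close>

type_synonym ('m, 'n) tvec = "('m, 'n) chart \<Rightarrow> real^'n"

definition tangent_space :: "('m, 'n::finite) chart set \<Rightarrow> 'm \<Rightarrow> ('m, 'n) tvec set" where
  "tangent_space \<A> x = {v.
     (\<forall>\<kappa>\<in>charts_at \<A> x. \<forall>\<kappa>'\<in>charts_at \<A> x.
        v \<kappa>' = frechet_derivative (transition \<kappa> \<kappa>') (at (snd \<kappa> x)) (v \<kappa>)) \<and>
     (\<forall>\<kappa>. \<kappa> \<notin> charts_at \<A> x \<longrightarrow> v \<kappa> = 0)}"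

text \<open>The tangent vector at \<open>x\<close> with components \<open>y\<close> in the chart \<open>\<kappa>\<close>.\<close>

definition tvec_of :: "('m, 'n::finite) chart set \<Rightarrow> ('m, 'n) chart \<Rightarrow> 'm \<Rightarrow> real^'n \<Rightarrow> ('m, 'n) tvec" where
  "tvec_of \<A> \<kappa> x y = (\<lambda>\<kappa>'. if \<kappa>' \<in> charts_at \<A> x
     then frechet_derivative (transition \<kappa> \<kappa>') (at (snd \<kappa> x)) y else 0)"

text \<open>A function on the tangent bundle in the natural coordinates \<open>(x\<^sup>i, y\<^sup>i)\<close> of a chart.\<close>

definition local_rep ::
    "('m, 'n::finite) chart set \<Rightarrow> ('m \<Rightarrow> ('m, 'n) tvec \<Rightarrow> real) \<Rightarrow> ('m, 'n) chart
     \<Rightarrow> (real^'n) \<times> (real^'n) \<Rightarrow> real" where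
  "local_rep \<A> F \<kappa> = (\<lambda>(p, y). F (chart_inv \<kappa> p) (tvec_of \<A> \<kappa> (chart_inv \<kappa> p) y))"


section \<open>Finsler geometry in natural coordinates\<close>

text \<open>Below, \<open>L\<close> is the Finsler function in natural coordinates and \<open>z = (x, y)\<close> a point of the
  slit tangent bundle in these coordinates.\<close>

definition d_x :: "'n \<Rightarrow> ((real^'n) \<times> (real^'n) \<Rightarrow> real) \<Rightarrow> (real^'n) \<times> (real^'n) \<Rightarrow> real" where
  "d_x k G z = frechet_derivative G (at z) (axis k 1, 0)"

definition d_y :: "'n \<Rightarrow> ((real^'n) \<times> (real^'n) \<Rightarrow> real) \<Rightarrow> (real^'n) \<times> (real^'n) \<Rightarrow> real" where
  "d_y k G z = frechet_derivative G (at z) (0, axis k 1)"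

context
  fixes L :: "(real^'n::finite) \<times> (real^'n) \<Rightarrow> real"
begin

definition g_low :: "'n \<Rightarrow> 'n \<Rightarrow> (real^'n) \<times> (real^'n) \<Rightarrow> real" where
  "g_low i j z = 1 / 2 * d_y i (d_y j (\<lambda>w. (L w)\<^sup>2)) z"

definition g_up :: "'n \<Rightarrow> 'n \<Rightarrow> (real^'n) \<times> (real^'n) \<Rightarrow> real" where
  "g_up i j z = matrix_inv (\<chi> a b. g_low a b z) $ i $ j"

definition g_inner :: "(real^'n) \<times> (real^'n) \<Rightarrow> real^'n \<Rightarrow> real^'n \<Rightarrow> real" where
  "g_inner z v w = (\<Sum>i\<in>UNIV. \<Sum>j\<in>UNIV. g_low i j z * v $ i * w $ j)"

definition A_low :: "'n \<Rightarrow> 'n \<Rightarrow> 'n \<Rightarrow> (real^'n) \<times> (real^'n) \<Rightarrow> real" where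
  "A_low i j k z = L z / 2 * d_y k (g_low i j) z"

definition A_up :: "'n \<Rightarrow> 'n \<Rightarrow> 'n \<Rightarrow> (real^'n) \<times> (real^'n) \<Rightarrow> real" where
  "A_up i j k z = (\<Sum>l\<in>UNIV. g_up i l z * A_low l j k z)"

definition formal_christoffel :: "'n \<Rightarrow> 'n \<Rightarrow> 'n \<Rightarrow> (real^'n) \<times> (real^'n) \<Rightarrow> real" where
  "formal_christoffel i j k z = 1 / 2 * (\<Sum>s\<in>UNIV. g_up i s z *
     (d_x k (g_low s j) z - d_x s (g_low j k) z + d_x j (g_low s k) z))"

definition nonlinear_conn :: "'n \<Rightarrow> 'n \<Rightarrow> (real^'n) \<times> (real^'n) \<Rightarrow> real" where
  "nonlinear_conn i j z =
     (\<Sum>k\<in>UNIV. formal_christoffel i j k z * snd z $ k) -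
     (\<Sum>k\<in>UNIV. \<Sum>r\<in>UNIV. \<Sum>s\<in>UNIV.
        A_up i j k z * formal_christoffel k r s z * (snd z $ r * snd z $ s / L z))"

text \<open>Tangent vectors \<open>u\<close> of the slit tangent bundle are written in the frame
  \<open>\<partial>/\<partial>x\<^sup>i, \<partial>/\<partial>y\<^sup>i\<close>; the value of \<open>dx\<^sup>i\<close> on \<open>u\<close> is \<open>fst u $ i\<close>, the value of \<open>dy\<^sup>i\<close> is
  \<open>snd u $ i\<close>.\<close>

definition delta_y :: "(real^'n) \<times> (real^'n) \<Rightarrow> 'n \<Rightarrow> (real^'n) \<times> (real^'n) \<Rightarrow> real" where
  "delta_y z i u = snd u $ i + (\<Sum>j\<in>UNIV. nonlinear_conn i j z * fst u $ j)"

definition horizontal_lift :: "(real^'n) \<times> (real^'n) \<Rightarrow> real^'n \<Rightarrow> (real^'n) \<times> (real^'n)" where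
  "horizontal_lift z X = (X, - (\<chi> i. \<Sum>j\<in>UNIV. nonlinear_conn i j z * X $ j))"

text \<open>The Chern connection forms \<open>\<omega>\<^sup>i\<^sub>j\<close> (written \<open>\<omega> i j\<close>) at the point \<open>z\<close>. The second
  condition is \<open>dx\<^sup>j \<and> \<omega>\<^sup>i\<^sub>j = 0\<close> evaluated on a pair \<open>u, w\<close> of tangent vectors.\<close>

definition chern_equations ::
    "(real^'n) \<times> (real^'n) \<Rightarrow> ('n \<Rightarrow> 'n \<Rightarrow> (real^'n) \<times> (real^'n) \<Rightarrow> real) \<Rightarrow> bool" where
  "chern_equations z \<omega> \<longleftrightarrow>
     (\<forall>i j. linear (\<omega> i j)) \<and>
     (\<forall>i u w. (\<Sum>j\<in>UNIV. fst u $ j * \<omega> i j w - fst w $ j * \<omega> i j u) = 0) \<and>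
     (\<forall>i j u. frechet_derivative (g_low i j) (at z) u
         - (\<Sum>k\<in>UNIV. g_low k j z * \<omega> k i u) - (\<Sum>k\<in>UNIV. g_low i k z * \<omega> k j u)
       = 2 * (\<Sum>k\<in>UNIV. A_low i j k z * delta_y z k u / L z))"

definition chern_form :: "(real^'n) \<times> (real^'n) \<Rightarrow> 'n \<Rightarrow> 'n \<Rightarrow> (real^'n) \<times> (real^'n) \<Rightarrow> real" where
  "chern_form z = (THE \<omega>. chern_equations z \<omega>)"

definition chern_coeff :: "'n \<Rightarrow> 'n \<Rightarrow> 'n \<Rightarrow> (real^'n) \<times> (real^'n) \<Rightarrow> real" where
  "chern_coeff i j k z = chern_form z i j (axis k 1, 0)"

text \<open>Chern covariant derivative at \<open>z\<close>, in the direction \<open>u\<close>, of the section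
  \<open>\<xi>\<^sup>i \<pi>\<^sup>*\<partial>\<^sub>i\<close> of the pull-back bundle.\<close>

definition chern_deriv ::
    "(real^'n) \<times> (real^'n) \<Rightarrow> (real^'n) \<times> (real^'n) \<Rightarrow> ((real^'n) \<times> (real^'n) \<Rightarrow> real^'n) \<Rightarrow> real^'n" where
  "chern_deriv z u \<xi> = frechet_derivative \<xi> (at z) u
     + (\<chi> i. \<Sum>j\<in>UNIV. \<xi> z $ j * chern_form z i j u)"

definition P_up :: "'n \<Rightarrow> 'n \<Rightarrow> 'n \<Rightarrow> 'n \<Rightarrow> (real^'n) \<times> (real^'n) \<Rightarrow> real" where
  "P_up j i k l z = - L z * d_y l (chern_coeff i j k) z"

definition P_low :: "'n \<Rightarrow> 'n \<Rightarrow> 'n \<Rightarrow> 'n \<Rightarrow> (real^'n) \<times> (real^'n) \<Rightarrow> real" where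
  "P_low j i k l z = (\<Sum>m\<in>UNIV. g_low i m z * P_up j m k l z)"

definition A_dot :: "'n \<Rightarrow> 'n \<Rightarrow> 'n \<Rightarrow> (real^'n) \<times> (real^'n) \<Rightarrow> real" where
  "A_dot i k l z = - (\<Sum>j\<in>UNIV. snd z $ j / L z * P_low j i k l z)"


subsection \<open>Integration over the indicatrix and the averaged connection\<close>

text \<open>The Riemannian volume on the indicatrix at \<open>p\<close> is computed in the \<open>2n\<close> parametrisations
  obtained by projecting the faces \<open>{w. w\<^sub>m = s, \<bar>w\<^sub>a\<bar> < 1 for a \<noteq> m}\<close> (\<open>s = \<plusminus>1\<close>) of the unit cube
  radially to the indicatrix: their images are disjoint and cover the indicatrix up to a null set.
  A face is parametrised by the coordinates \<open>w\<^sub>a\<close>, \<open>a \<noteq> m\<close>, and the volume density is the square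
  root of the Gram determinant of the corresponding coordinate vector fields with respect to
  \<open>g\<^sub>i\<^sub>j dy\<^sup>i \<otimes> dy\<^sup>j\<close>; that \<open>(n-1) \<times> (n-1)\<close> determinant is written as the determinant of an
  \<open>n \<times> n\<close> matrix whose row and column \<open>m\<close> are those of the identity matrix.\<close>

definition radial :: "real^'n \<Rightarrow> real^'n \<Rightarrow> real^'n" where
  "radial p w = (1 / L (p, w)) *\<^sub>R w"

definition face_point :: "'n \<Rightarrow> real \<Rightarrow> ('n \<Rightarrow> real) \<Rightarrow> real^'n" where
  "face_point m s \<zeta> = (\<chi> a. if a = m then s else \<zeta> a)"

definition volume_density :: "real^'n \<Rightarrow> 'n \<Rightarrow> real^'n \<Rightarrow> real" where
  "volume_density p m w = sqrt (det (\<chi> a b.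
     if a = m \<or> b = m then (if a = b then 1 else 0)
     else g_inner (p, radial p w)
            (frechet_derivative (radial p) (at w) (axis a 1))
            (frechet_derivative (radial p) (at w) (axis b 1))))"

definition indicatrix_integral ::
    "real^'n \<Rightarrow> (real^'n \<Rightarrow> 'b::{banach, second_countable_topology}) \<Rightarrow> 'b" where
  "indicatrix_integral p f =
     (\<Sum>m\<in>UNIV. \<Sum>s\<in>{-1, 1}.
        set_lebesgue_integral (\<Pi>\<^sub>M a\<in>UNIV - {m}. lborel) (\<Pi>\<^sub>E a\<in>UNIV - {m}. {-1<..<1})
          (\<lambda>\<zeta>. volume_density p m (face_point m s \<zeta>) *\<^sub>R f (radial p (face_point m s \<zeta>))))"

definition indicatrix_volume :: "real^'n \<Rightarrow> real" where
  "indicatrix_volume p = indicatrix_integral p (\<lambda>y. 1)"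

text \<open>The averaged covariant derivative, at \<open>p\<close>, of the vector field \<open>Y\<close> in the direction \<open>X\<close>;
  the function \<open>\<lambda>z. Y (fst z)\<close> is the pull-back of \<open>Y\<close>.\<close>

definition averaged_deriv :: "real^'n \<Rightarrow> real^'n \<Rightarrow> (real^'n \<Rightarrow> real^'n) \<Rightarrow> real^'n" where
  "averaged_deriv p X Y = (1 / indicatrix_volume p) *\<^sub>R
     indicatrix_integral p (\<lambda>y. chern_deriv (p, y) (horizontal_lift (p, y) X) (\<lambda>z. Y (fst z)))"

definition averaged_coeff :: "'n \<Rightarrow> 'n \<Rightarrow> 'n \<Rightarrow> real^'n \<Rightarrow> real" where
  "averaged_coeff i j k p = averaged_deriv p (axis k 1) (\<lambda>_. axis j 1) $ i"

end


section \<open>Classes of Finsler spaces\<close>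

definition finsler_structure ::
    "('m, 'n::finite) chart set \<Rightarrow> ('m \<Rightarrow> ('m, 'n) tvec \<Rightarrow> real) \<Rightarrow> bool" where
  "finsler_structure \<A> F \<longleftrightarrow>
     (\<forall>x\<in>points \<A>. \<forall>v\<in>tangent_space \<A> x. 0 \<le> F x v) \<and>
     (\<forall>x\<in>points \<A>. \<forall>v\<in>tangent_space \<A> x. \<forall>c>0. F x (\<lambda>\<kappa>. c *\<^sub>R v \<kappa>) = c * F x v) \<and>
     (\<forall>\<kappa>\<in>\<A>. smooth_on ((snd \<kappa> ` fst \<kappa>) \<times> (- {0})) (local_rep \<A> F \<kappa>)) \<and>
     (\<forall>\<kappa>\<in>\<A>. \<forall>p\<in>snd \<kappa> ` fst \<kappa>. \<forall>y. y \<noteq> 0 \<longrightarrow>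
        (\<forall>v. v \<noteq> 0 \<longrightarrow> 0 < g_inner (local_rep \<A> F \<kappa>) (p, y) v v))"

definition landsberg_space ::
    "('m, 'n::finite) chart set \<Rightarrow> ('m \<Rightarrow> ('m, 'n) tvec \<Rightarrow> real) \<Rightarrow> bool" where
  "landsberg_space \<A> F \<longleftrightarrow> finsler_structure \<A> F \<and>
     (\<forall>\<kappa>\<in>\<A>. \<forall>p\<in>snd \<kappa> ` fst \<kappa>. \<forall>y. y \<noteq> 0 \<longrightarrow>
        (\<forall>i k l. A_dot (local_rep \<A> F \<kappa>) i k l (p, y) = 0))"

definition berwald_space ::
    "('m, 'n::finite) chart set \<Rightarrow> ('m \<Rightarrow> ('m, 'n) tvec \<Rightarrow> real) \<Rightarrow> bool" where
  "berwald_space \<A> F \<longleftrightarrow> finsler_structure \<A> F \<and>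
     (\<forall>\<kappa>\<in>\<A>. \<forall>p\<in>snd \<kappa> ` fst \<kappa>. \<forall>y y'. y \<noteq> 0 \<longrightarrow> y' \<noteq> 0 \<longrightarrow>
        (\<forall>i j k. chern_coeff (local_rep \<A> F \<kappa>) i j k (p, y)
               = chern_coeff (local_rep \<A> F \<kappa>) i j k (p, y')))"

definition locally_minkowski_space ::
    "('m, 'n::finite) chart set \<Rightarrow> ('m \<Rightarrow> ('m, 'n) tvec \<Rightarrow> real) \<Rightarrow> bool" where
  "locally_minkowski_space \<A> F \<longleftrightarrow> finsler_structure \<A> F \<and>
     (\<forall>x\<in>points \<A>. \<exists>\<kappa>\<in>charts_at \<A> x. \<forall>p\<in>snd \<kappa> ` fst \<kappa>. \<forall>p'\<in>snd \<kappa> ` fst \<kappa>. \<forall>y.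
        local_rep \<A> F \<kappa> (p, y) = local_rep \<A> F \<kappa> (p', y))"

definition pure_landsberg_space ::
    "('m, 'n::finite) chart set \<Rightarrow> ('m \<Rightarrow> ('m, 'n) tvec \<Rightarrow> real) \<Rightarrow> bool" where
  "pure_landsberg_space \<A> F \<longleftrightarrow>
     landsberg_space \<A> F \<and> \<not> berwald_space \<A> F \<and> \<not> locally_minkowski_space \<A> F"


section \<open>Holonomy of the averaged connection\<close>

text \<open>A smooth arc is smooth on an open neighbourhood of \<open>[0,1]\<close>.\<close>

definition smooth_arc ::
    "('m::topological_space, 'n::finite) chart set \<Rightarrow> (real \<Rightarrow> 'm) \<Rightarrow> bool" where
  "smooth_arc \<A> \<gamma> \<longleftrightarrow> (\<exists>J. open J \<and> {0..1} \<subseteq> J \<and> \<gamma> ` J \<subseteq> points \<A> \<and> continuous_on J \<gamma> \<and>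
     (\<forall>\<kappa>\<in>\<A>. smooth_on {t\<in>J. \<gamma> t \<in> fst \<kappa>} (snd \<kappa> \<circ> \<gamma>)))"

text \<open>\<open>V\<close> is a parallel vector field along \<open>\<gamma>\<close>.\<close>

definition parallel_along ::
    "('m, 'n::finite) chart set \<Rightarrow> ('m \<Rightarrow> ('m, 'n) tvec \<Rightarrow> real) \<Rightarrow> (real \<Rightarrow> 'm)
     \<Rightarrow> (real \<Rightarrow> ('m, 'n) tvec) \<Rightarrow> bool" where
  "parallel_along \<A> F \<gamma> V \<longleftrightarrow>
     (\<forall>t\<in>{0..1}. V t \<in> tangent_space \<A> (\<gamma> t)) \<and>
     (\<forall>t\<in>{0..1}. \<forall>\<kappa>\<in>charts_at \<A> (\<gamma> t).
        ((\<lambda>s. V s \<kappa>) has_vector_derivative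
           - (\<chi> i. \<Sum>j\<in>UNIV. \<Sum>k\<in>UNIV.
                averaged_coeff (local_rep \<A> F \<kappa>) i j k (snd \<kappa> (\<gamma> t))
                * V t \<kappa> $ j * vector_derivative (snd \<kappa> \<circ> \<gamma>) (at t) $ k))
          (at t within {0..1}))"

text \<open>\<open>P\<close> is the parallel transport along \<open>\<gamma>\<close>.\<close>

definition parallel_transport ::
    "('m, 'n::finite) chart set \<Rightarrow> ('m \<Rightarrow> ('m, 'n) tvec \<Rightarrow> real) \<Rightarrow> (real \<Rightarrow> 'm)
     \<Rightarrow> (('m, 'n) tvec \<Rightarrow> ('m, 'n) tvec) \<Rightarrow> bool" where
  "parallel_transport \<A> F \<gamma> P \<longleftrightarrow>
     P \<in> tangent_space \<A> (\<gamma> 0) \<rightarrow>\<^sub>E tangent_space \<A> (\<gamma> 1) \<and>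
     (\<forall>v\<in>tangent_space \<A> (\<gamma> 0). \<exists>V. parallel_along \<A> F \<gamma> V \<and> V 0 = v \<and> V 1 = P v)"

text \<open>Parallel transports from \<open>x\<close> to \<open>y\<close> along piecewise smooth curves, i.e. along finite
  concatenations of smooth arcs.\<close>

inductive piecewise_transport ::
    "('m::topological_space, 'n::finite) chart set \<Rightarrow> ('m \<Rightarrow> ('m, 'n) tvec \<Rightarrow> real) \<Rightarrow> 'm \<Rightarrow> 'm
     \<Rightarrow> (('m, 'n) tvec \<Rightarrow> ('m, 'n) tvec) \<Rightarrow> bool"
  for \<A> F x where
  trivial_path: "x \<in> points \<A> \<Longrightarrow> piecewise_transport \<A> F x x (\<lambda>v\<in>tangent_space \<A> x. v)"
| append_arc: "piecewise_transport \<A> F x (\<gamma> 0) P \<Longrightarrow> smooth_arc \<A> \<gamma> \<Longrightarrow> parallel_transport \<A> F \<gamma> Q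
    \<Longrightarrow> piecewise_transport \<A> F x (\<gamma> 1) (compose (tangent_space \<A> x) Q P)"

definition holonomy_group ::
    "('m::topological_space, 'n::finite) chart set \<Rightarrow> ('m \<Rightarrow> ('m, 'n) tvec \<Rightarrow> real) \<Rightarrow> 'm
     \<Rightarrow> (('m, 'n) tvec \<Rightarrow> ('m, 'n) tvec) set" where
  "holonomy_group \<A> F x = {P. piecewise_transport \<A> F x x P}"

definition holonomy_invariant ::
    "('m::topological_space, 'n::finite) chart set \<Rightarrow> ('m \<Rightarrow> ('m, 'n) tvec \<Rightarrow> real) \<Rightarrow> 'm
     \<Rightarrow> ('m, 'n) tvec set \<Rightarrow> bool" where
  "holonomy_invariant \<A> F x S \<longleftrightarrow> (\<forall>P\<in>holonomy_group \<A> F x. P ` S \<subseteq> S)"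


section \<open>Riemannian metrics and the sets \<open>I\<^sub>x(t)\<close>\<close>

definition riemannian_metric ::
    "('m, 'n::finite) chart set \<Rightarrow> ('m \<Rightarrow> ('m, 'n) tvec \<Rightarrow> ('m, 'n) tvec \<Rightarrow> real) \<Rightarrow> bool" where
  "riemannian_metric \<A> h \<longleftrightarrow>
     (\<forall>x\<in>points \<A>. \<forall>u\<in>tangent_space \<A> x. \<forall>v\<in>tangent_space \<A> x. h x u v = h x v u) \<and>
     (\<forall>x\<in>points \<A>. \<forall>u\<in>tangent_space \<A> x. \<forall>v\<in>tangent_space \<A> x. \<forall>w\<in>tangent_space \<A> x. \<forall>a b.
        h x (\<lambda>\<kappa>. a *\<^sub>R u \<kappa> + b *\<^sub>R v \<kappa>) w = a * h x u w + b * h x v w) \<and>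
     (\<forall>x\<in>points \<A>. \<forall>v\<in>tangent_space \<A> x. v \<noteq> (\<lambda>\<kappa>. 0) \<longrightarrow> 0 < h x v v) \<and>
     (\<forall>\<kappa>\<in>\<A>. \<forall>i j. smooth_on (snd \<kappa> ` fst \<kappa>)
        (\<lambda>p. h (chart_inv \<kappa> p) (tvec_of \<A> \<kappa> (chart_inv \<kappa> p) (axis i 1))
                               (tvec_of \<A> \<kappa> (chart_inv \<kappa> p) (axis j 1))))"

definition interpolation ::
    "('m \<Rightarrow> ('m, 'n) tvec \<Rightarrow> real) \<Rightarrow> ('m \<Rightarrow> ('m, 'n) tvec \<Rightarrow> ('m, 'n) tvec \<Rightarrow> real)
     \<Rightarrow> real \<Rightarrow> 'm \<Rightarrow> ('m, 'n) tvec \<Rightarrow> real" where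
  "interpolation F h t x v = (1 - t) * F x v + t * sqrt (h x v v)"

definition indicatrix ::
    "('m, 'n::finite) chart set \<Rightarrow> ('m \<Rightarrow> ('m, 'n) tvec \<Rightarrow> real) \<Rightarrow> 'm \<Rightarrow> ('m, 'n) tvec set" where
  "indicatrix \<A> F x = {v\<in>tangent_space \<A> x. F x v = 1}"

definition indicatrix_union ::
    "('m, 'n::finite) chart set \<Rightarrow> ('m \<Rightarrow> ('m, 'n) tvec \<Rightarrow> real)
     \<Rightarrow> ('m \<Rightarrow> ('m, 'n) tvec \<Rightarrow> ('m, 'n) tvec \<Rightarrow> real) \<Rightarrow> 'm \<Rightarrow> ('m, 'n) tvec set" where
  "indicatrix_union \<A> F h x = (\<Union>t\<in>{0..1}. indicatrix \<A> (interpolation F h t) x)"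

text \<open>Smooth embedded submanifolds, possibly with boundary, of codimension zero of \<open>\<real>\<^sup>n\<close>.\<close>

definition codim0_submanifold :: "(real^'n::finite) set \<Rightarrow> bool" where
  "codim0_submanifold S \<longleftrightarrow> (\<forall>q\<in>S. \<exists>W \<Phi>. q \<in> W \<and> open W \<and> open (\<Phi> ` W) \<and> inj_on \<Phi> W \<and>
     smooth_on W \<Phi> \<and> smooth_on (\<Phi> ` W) (inv_into W \<Phi>) \<and>
     (\<Phi> ` (S \<inter> W) = \<Phi> ` W \<or> (\<exists>m::'n. \<Phi> ` (S \<inter> W) = \<Phi> ` W \<inter> {z::real^'n. 0 \<le> z $ m})))"

text \<open>\<open>T\<^sub>xM\<close> is identified with \<open>\<real>\<^sup>n\<close> by the components in a chart; the choice of the chart is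
  immaterial, as two such identifications differ by a linear isomorphism.\<close>

definition compact_codim0_submanifold ::
    "('m, 'n::finite) chart set \<Rightarrow> 'm \<Rightarrow> ('m, 'n) tvec set \<Rightarrow> bool" where
  "compact_codim0_submanifold \<A> x S \<longleftrightarrow> S \<subseteq> tangent_space \<A> x \<and>
     (\<exists>\<kappa>\<in>charts_at \<A> x. compact ((\<lambda>v. v \<kappa>) ` S) \<and> codim0_submanifold ((\<lambda>v. v \<kappa>) ` S))"

end

(* For a Berwald or a locally Minkowski space the Chern coefficients do not depend on y in suitable
   charts, so they are the coefficients of the averaged connection. The identity
   \<delta>F\<^sup>2/\<delta>x\<^sup>k = 0 then says that F is constant along parallel fields; hence the holonomy
   group acts by linear isometries of F. Let \<rho> be a smooth bump function supported in [1,2]. The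
   quadratic form h\<^sub>x(a,b) = \<integral> D\<^sub>a(\<rho>\<circ>F\<^sub>x) D\<^sub>b(\<rho>\<circ>F\<^sub>x) dy / \<integral> \<rho>\<circ>F\<^sub>x dy does not depend on
   linear coordinates, depends smoothly on x, and is invariant under linear isometries of F\<^sub>x. After
   scaling, F\<^sub>x < \<surd>h\<^sub>x off 0, so the union of the I\<^sub>x(t) is the invariant shell
   {F\<^sub>x \<le> 1 \<le> \<surd>h\<^sub>x}, contrary to the hypothesis. *)

theory Submission
  imports Defs
begin

text \<open>The zero section shapes the proof: F is not differentiable there, yet parallel fields
  may vanish and the integrals that define h run across it. Hence norms are followed through F^2,
  which has derivative zero at zero vectors, and the bump function is identically 0 on [0,1]. The
  form h is a quotient of integrals over the whole tangent space, not an average over the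
  indicatrix. In the quotient the determinant of a linear substitution cancels, so Fubini and the
  invariance of Lebesgue measure under translation and reflection give independence of coordinates
  and invariance under isometries; smooth dependence on x is differentiation under an integral over
  a fixed box. The scaling constant is chosen at one point and multiplies h everywhere, so h stays a
  Riemannian metric on all of M. Strictness of F < \<surd>h keeps the two boundary components of the
  shell apart, so that no corners arise. The identity for F^2 rests on an explicit solution of the
  Chern equations: Christoffel symbols formed with \<delta>/\<delta>x^k, whose contraction with y is
  N^i_k.\<close>

section \<open>Calculus of continuously differentiable functions\<close>

lemma frechet_derivative_eqI:
  "(f has_derivative f') (at x) \<Longrightarrow> frechet_derivative f (at x) = f'"
  by (rule frechet_derivative_at[symmetric])

text \<open>Derivatives in \<open>C_on\<close> are taken in the whole space, so values off
  \<open>S\<close> could matter; since \<open>S\<close> is open, the values on \<open>S\<close>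
  alone determine them.\<close>

lemma C_on_cong:
  assumes "open S" "\<And>x. x \<in> S \<Longrightarrow> f x = g x"
  shows "C_on k S f \<longleftrightarrow> C_on k S g"
proof -
  have "C_on k S g" if "C_on k S f" "\<And>x. x \<in> S \<Longrightarrow> f x = g x" for f g :: "'a \<Rightarrow> 'b"
    using that
  proof (induction k arbitrary: f g)
    case 0
    then show ?case by (simp cong: continuous_on_cong)
  next
    case (Suc k)
    have d: "(g has_derivative frechet_derivative f (at x)) (at x)" if "x \<in> S" for x
    proof (rule has_derivative_transform_within_open)
      show "(f has_derivative frechet_derivative f (at x)) (at x)"
        using Suc.prems(1) that by (simp add: frechet_derivative_works)
    qed (use assms(1) that Suc.prems in auto)
    have "C_on k S (\<lambda>x. frechet_derivative g (at x) v)" for v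
    proof (rule Suc.IH)
      show "C_on k S (\<lambda>x. frechet_derivative f (at x) v)"
        using Suc.prems by simp
    qed (use d frechet_derivative_eqI in metis)
    then show ?case
      using d by (auto simp: differentiable_def)
  qed
  from this[of f g] this[of g f] show ?thesis
    using assms(2) by metis
qed

text \<open>Lets inductions over the order of differentiability work with an explicit formula for
  the derivative in place of \<open>frechet_derivative\<close>.\<close>

lemma C_on_SucI:
  assumes "open S" "\<And>x. x \<in> S \<Longrightarrow> (f has_derivative f' x) (at x)"
    and "\<And>v. C_on k S (\<lambda>x. f' x v)"
  shows "C_on (Suc k) S f"
proof -
  have "C_on k S (\<lambda>x. frechet_derivative f (at x) v)" for v
    using C_on_cong[OF assms(1), of "\<lambda>x. frechet_derivative f (at x) v" "\<lambda>x. f' x v"] assms(2,3)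
    by (metis frechet_derivative_eqI)
  then show ?thesis
    using assms(2) by (auto simp: differentiable_def)
qed

lemma C_on_has_derivative:
  "C_on (Suc k) S f \<Longrightarrow> x \<in> S \<Longrightarrow> (f has_derivative frechet_derivative f (at x)) (at x)"
  by (simp add: frechet_derivative_works)

lemma C_on_SucD: "C_on (Suc k) S f \<Longrightarrow> C_on k S f"
proof (induction k arbitrary: f)
  case 0
  then show ?case
    by (auto intro!: continuous_at_imp_continuous_on differentiable_imp_continuous_within)
qed auto

lemma C_on_le: "C_on k S f \<Longrightarrow> j \<le> k \<Longrightarrow> C_on j S f"
proof (induction k)
  case (Suc k)
  then show ?case
    using C_on_SucD by (metis le_Suc_eq)
qed auto

lemma C_on_continuous: "C_on k S f \<Longrightarrow> continuous_on S f"
  using C_on_le[of k S f 0] by simp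

lemma C_on_subset: "C_on k S f \<Longrightarrow> T \<subseteq> S \<Longrightarrow> C_on k T f"
proof (induction k arbitrary: f)
  case 0
  then show ?case by (auto intro: continuous_on_subset)
qed auto

lemma C_on_Union:
  assumes "\<And>U. U \<in> \<U> \<Longrightarrow> open U" "\<And>U. U \<in> \<U> \<Longrightarrow> C_on k U f"
  shows "C_on k (\<Union>\<U>) f"
  using assms(2)
proof (induction k arbitrary: f)
  case 0
  then show ?case
    using assms(1) continuous_on_open_Union by (metis C_on.simps(1))
qed auto

text \<open>The class C^k is local: the union of all open sets on which \<open>f\<close> has this
  class is again such a set.\<close>

lemma C_on_locally:
  assumes "\<And>x. x \<in> S \<Longrightarrow> \<exists>U. open U \<and> x \<in> U \<and> C_on k U f"
  shows "C_on k S f"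
proof -
  have "C_on k (\<Union>{U. open U \<and> C_on k U f}) f"
    by (rule C_on_Union) auto
  then show ?thesis
    by (rule C_on_subset) (use assms in blast)
qed

lemma C_on_const: "C_on k S (\<lambda>x. c)"
  by (induction k arbitrary: c) (auto simp: continuous_on_const)

lemma C_on_bounded_linear_comp:
  assumes "open S" "bounded_linear h"
  shows "C_on k S f \<Longrightarrow> C_on k S (\<lambda>x. h (f x))"
proof (induction k arbitrary: f)
  case 0
  then show ?case
    using assms(2) by (simp add: bounded_linear.continuous_on)
next
  case (Suc k)
  show ?case
  proof (rule C_on_SucI[OF assms(1)])
    show "((\<lambda>x. h (f x)) has_derivative (\<lambda>v. h (frechet_derivative f (at x) v))) (at x)"
      if "x \<in> S" for x
      using bounded_linear.has_derivative[OF assms(2) C_on_has_derivative[OF Suc.prems that]] .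
  qed (use Suc in auto)
qed

lemma C_on_ident: "open S \<Longrightarrow> C_on k S (\<lambda>x. x)"
proof (cases k)
  case (Suc j)
  assume "open S"
  then show ?thesis
    unfolding Suc by (intro C_on_SucI[where f' = "\<lambda>_ v. v"]) (auto intro: C_on_const)
qed (simp add: continuous_on_id)

lemma C_on_add:
  assumes "open S"
  shows "C_on k S f \<Longrightarrow> C_on k S g \<Longrightarrow> C_on k S (\<lambda>x. f x + g x)"
proof (induction k arbitrary: f g)
  case 0
  then show ?case by (simp add: continuous_on_add)
next
  case (Suc k)
  show ?case
    by (rule C_on_SucI[OF assms has_derivative_add[OF C_on_has_derivative C_on_has_derivative]]) (use Suc in auto)
qed

lemma C_on_sum:
  assumes "open S" "\<And>i. i \<in> I \<Longrightarrow> C_on k S (f i)"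
  shows "C_on k S (\<lambda>x. \<Sum>i\<in>I. f i x)"
  using assms(2)
proof (induction I rule: infinite_finite_induct)
  case (insert i I)
  then show ?case by (simp add: C_on_add assms(1))
qed (auto intro: C_on_const)

lemma C_on_bilinear:
  assumes "open S" "bounded_bilinear B"
  shows "C_on k S f \<Longrightarrow> C_on k S g \<Longrightarrow> C_on k S (\<lambda>x. B (f x) (g x))"
proof (induction k arbitrary: f g)
  case 0
  then show ?case by (simp add: bounded_bilinear.continuous_on[OF assms(2)])
next
  case (Suc k)
  show ?case
  proof (rule C_on_SucI[OF assms(1)])
    show "((\<lambda>x. B (f x) (g x)) has_derivative
        (\<lambda>v. B (f x) (frechet_derivative g (at x) v) + B (frechet_derivative f (at x) v) (g x))) (at x)"
      if "x \<in> S" for x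
      by (intro bounded_bilinear.FDERIV[OF assms(2)] C_on_has_derivative[OF Suc.prems(1) that]
          C_on_has_derivative[OF Suc.prems(2) that])
    show "C_on k S (\<lambda>x. B (f x) (frechet_derivative g (at x) v) + B (frechet_derivative f (at x) v) (g x))"
      for v
      by (intro C_on_add[OF assms(1)] Suc.IH C_on_SucD[OF Suc.prems(1)] C_on_SucD[OF Suc.prems(2)])
        (use Suc.prems in auto)
  qed
qed

lemmas C_on_scaleR = C_on_bilinear[OF _ bounded_bilinear_scaleR]
lemmas C_on_inner = C_on_bilinear[OF _ bounded_bilinear_inner]

lemma C_on_mult:
  fixes f g :: "'a::real_normed_vector \<Rightarrow> 'b::real_normed_algebra"
  shows "open S \<Longrightarrow> C_on k S f \<Longrightarrow> C_on k S g \<Longrightarrow> C_on k S (\<lambda>x. f x * g x)"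
  by (rule C_on_bilinear[OF _ bounded_bilinear_mult])

lemma C_on_diff:
  assumes "open S" "C_on k S f" "C_on k S g"
  shows "C_on k S (\<lambda>x. f x - g x)"
proof -
  have "C_on k S (\<lambda>x. f x + - g x)"
    using assms
    by (intro C_on_add C_on_bounded_linear_comp[OF _ bounded_linear_minus[OF bounded_linear_ident]])
  then show ?thesis by simp
qed

lemma C_on_Pair:
  assumes "open S" "C_on k S f" "C_on k S g"
  shows "C_on k S (\<lambda>x. (f x, g x))"
proof -
  have "C_on k S (\<lambda>x. (f x, 0) + (0, g x))"
    using assms
    by (intro C_on_add C_on_bounded_linear_comp[of S "\<lambda>x. (x, 0)"] C_on_bounded_linear_comp[of S "\<lambda>x. (0, x)"])
      (auto intro!: bounded_linear_Pair bounded_linear_ident bounded_linear_zero)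
  then show ?thesis by simp
qed

lemma C_on_vec:
  fixes f :: "'a::real_normed_vector \<Rightarrow> real^'n::finite"
  assumes "open S" "\<And>i. C_on k S (\<lambda>x. f x $ i)"
  shows "C_on k S f"
proof -
  have "C_on k S (\<lambda>x. \<Sum>i\<in>UNIV. f x $ i *\<^sub>R axis i (1::real))"
    by (intro C_on_sum C_on_scaleR assms C_on_const)
  moreover have "(\<Sum>i\<in>UNIV. f x $ i *\<^sub>R axis i (1::real)) = f x" for x
    using basis_expansion[of "f x"] by (simp add: scalar_mult_eq_scaleR)
  ultimately show ?thesis by simp
qed

lemma C_on_nth: "open S \<Longrightarrow> C_on k S f \<Longrightarrow> C_on k S (\<lambda>x. (f x :: real^'n::finite) $ i)"
  by (rule C_on_bounded_linear_comp[OF _ bounded_linear_vec_nth])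

text \<open>The chain rule evaluates the derivative of \<open>g\<close> in a direction that moves
  with \<open>x\<close>, while \<open>C_on\<close> controls fixed directions only. Expanding the
  inner derivative in a basis gives a finite sum of products to which the induction hypothesis
  applies; hence the middle space is Euclidean.\<close>

lemma C_on_compose:
  fixes f :: "'a::real_normed_vector \<Rightarrow> 'b::euclidean_space"
  assumes "open S" "open T"
  shows "C_on k T g \<Longrightarrow> C_on k S f \<Longrightarrow> f ` S \<subseteq> T \<Longrightarrow> C_on k S (\<lambda>x. g (f x))"
proof (induction k arbitrary: g)
  case 0
  then show ?case by (auto intro: continuous_on_compose2)
next
  case (Suc k)
  show ?case
  proof (rule C_on_SucI[OF assms(1)])
    show d: "((\<lambda>x. g (f x)) has_derivative
        (\<lambda>v. \<Sum>b\<in>Basis. (frechet_derivative f (at x) v \<bullet> b) *\<^sub>R frechet_derivative g (at (f x)) b)) (at x)"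
      if "x \<in> S" for x
    proof -
      have g: "(g has_derivative frechet_derivative g (at (f x))) (at (f x))"
        using Suc.prems that by (intro C_on_has_derivative[OF Suc.prems(1)]) auto
      then interpret bounded_linear "frechet_derivative g (at (f x))"
        by (rule has_derivative_bounded_linear)
      have "((\<lambda>x. g (f x)) has_derivative
          (\<lambda>v. frechet_derivative g (at (f x)) (frechet_derivative f (at x) v))) (at x)"
        using has_derivative_compose[OF C_on_has_derivative[OF Suc.prems(2) that] g] .
      then show ?thesis
      proof (rule has_derivative_eq_rhs, intro ext)
        fix v
        let ?w = "frechet_derivative f (at x) v"
        show "frechet_derivative g (at (f x)) ?w = (\<Sum>b\<in>Basis. (?w \<bullet> b) *\<^sub>R frechet_derivative g (at (f x)) b)"
          by (subst euclidean_representation[symmetric, of ?w]) (simp only: sum scaleR)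
      qed
    qed
    show "C_on k S (\<lambda>x. \<Sum>b\<in>Basis. (frechet_derivative f (at x) v \<bullet> b) *\<^sub>R frechet_derivative g (at (f x)) b)"
      for v
    proof (intro C_on_sum C_on_scaleR C_on_inner assms C_on_const)
      show "C_on k S (\<lambda>x. frechet_derivative f (at x) v)"
        using Suc.prems by simp
      show "C_on k S (\<lambda>x. frechet_derivative g (at (f x)) b)" for b
        by (rule Suc.IH[where g = "\<lambda>z. frechet_derivative g (at z) b"])
          (use Suc.prems C_on_SucD[OF Suc.prems(2)] in auto)
    qed
  qed
qed

text \<open>All real exponents are treated at once, because differentiation lowers the exponent.
  Square roots and quotients are both obtained from this.\<close>

lemma C_on_powr: "C_on k {0<..} (\<lambda>x::real. x powr a)"
proof (induction k arbitrary: a)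
  case 0
  then show ?case by (auto intro!: continuous_intros)
next
  case (Suc k)
  have "((\<lambda>x. x powr a) has_derivative (\<lambda>v. v * (a * x powr (a - 1)))) (at x)" if "x \<in> {0<..}" for x :: real
    using has_real_derivative_powr[of x a] that by (simp add: has_field_derivative_def mult_commute_abs)
  then show ?case
    by (rule C_on_SucI[rotated]) (auto intro!: C_on_mult C_on_const Suc)
qed

lemma C_on_sqrt_comp:
  assumes "open S" "C_on k S f" "\<And>x. x \<in> S \<Longrightarrow> 0 < f x"
  shows "C_on k S (\<lambda>x. sqrt (f x))"
proof -
  have "C_on k S (\<lambda>x. f x powr (1/2))"
    by (rule C_on_compose[OF assms(1) _ C_on_powr assms(2)]) (use assms(3) in auto)
  then show ?thesis
    using C_on_cong[OF assms(1), of "\<lambda>x. sqrt (f x)" "\<lambda>x. f x powr (1/2)"] assms(3)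
    by (metis powr_half_sqrt less_imp_le)
qed

lemma C_on_divide:
  assumes "open S" "C_on k S f" "C_on k S g" "\<And>x. x \<in> S \<Longrightarrow> 0 < g x"
  shows "C_on k S (\<lambda>x. f x / g x :: real)"
proof -
  have "C_on k S (\<lambda>x. g x powr - 1)"
    by (rule C_on_compose[OF assms(1) _ C_on_powr assms(3)]) (use assms(4) in auto)
  then have "C_on k S (\<lambda>x. f x * g x powr - 1)"
    by (intro C_on_mult assms)
  then show ?thesis
    using C_on_cong[OF assms(1), of "\<lambda>x. f x / g x" "\<lambda>x. f x * g x powr -1"] assms(4)
    by (metis powr_minus_divide powr_one less_imp_le times_divide_eq_right mult.right_neutral)
qed

lemma smooth_on_C_on: "smooth_on S f \<Longrightarrow> C_on k S f"
  by (simp add: smooth_on_def)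

lemma smooth_on_frechet:
  assumes "smooth_on S f"
  shows "smooth_on S (\<lambda>x. frechet_derivative f (at x) v)"
  unfolding smooth_on_def
proof
  show "C_on k S (\<lambda>x. frechet_derivative f (at x) v)" for k
    using smooth_on_C_on[OF assms, of "Suc k"] by simp
qed

lemma smooth_on_has_derivative:
  "smooth_on S f \<Longrightarrow> x \<in> S \<Longrightarrow> (f has_derivative frechet_derivative f (at x)) (at x)"
  by (rule C_on_has_derivative[OF smooth_on_C_on])

lemma smooth_on_continuous: "smooth_on S f \<Longrightarrow> continuous_on S f"
  unfolding smooth_on_def using C_on_continuous by blast

lemma smooth_on_compose:
  fixes f :: "'a::real_normed_vector \<Rightarrow> 'b::euclidean_space"
  shows "open S \<Longrightarrow> open T \<Longrightarrow> smooth_on T g \<Longrightarrow> smooth_on S f \<Longrightarrow> f ` S \<subseteq> T \<Longrightarrow> smooth_on S (\<lambda>x. g (f x))"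
  unfolding smooth_on_def using C_on_compose by blast

section \<open>Symmetry of second derivatives\<close>

text \<open>The mean value theorem is applied twice, first along \<open>u\<close> to the increment
  in direction \<open>v\<close>, then along \<open>v\<close> to the derivative in direction
  \<open>u\<close>. The second difference is symmetric in \<open>u\<close> and \<open>v\<close>, the
  right-hand side is not; this asymmetry is exploited next.\<close>

lemma second_difference_mvt:
  fixes f :: "'a::real_normed_vector \<Rightarrow> real"
  assumes f: "\<And>z. z \<in> S \<Longrightarrow> (f has_derivative D z) (at z)"
    and Df: "\<And>z. z \<in> S \<Longrightarrow> ((\<lambda>z. D z u) has_derivative D2 z) (at z)"
    and S: "ball x r \<subseteq> S"
    and s: "0 < s" "s * (norm u + norm v) < r"
  shows "\<exists>\<sigma> \<tau>. 0 < \<sigma> \<and> \<sigma> < s \<and> 0 < \<tau> \<and> \<tau> < s \<and>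
    f (x + s *\<^sub>R u + s *\<^sub>R v) - f (x + s *\<^sub>R u) - f (x + s *\<^sub>R v) + f x = s\<^sup>2 * D2 (x + \<sigma> *\<^sub>R u + \<tau> *\<^sub>R v) v"
proof -
  have b: "x + a *\<^sub>R u + b *\<^sub>R v \<in> S" if "0 \<le> a" "a \<le> s" "0 \<le> b" "b \<le> s" for a b
  proof -
    have "norm (a *\<^sub>R u + b *\<^sub>R v) \<le> a * norm u + b * norm v"
      using that by (intro order_trans[OF norm_triangle_ineq]) simp
    also have "\<dots> \<le> s * norm u + s * norm v"
      using that by (intro add_mono mult_right_mono) auto
    also have "\<dots> < r" using s by (simp add: algebra_simps)
    finally have "x + a *\<^sub>R u + b *\<^sub>R v \<in> ball x r"
      by (metis add.assoc add_diff_cancel_left' dist_commute dist_norm mem_ball)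
    then show ?thesis using S by blast
  qed
  \<comment> \<open>The summand \<open>0 *\<^sub>R v\<close> gives both terms one shape, so a single
    derivative formula covers \<open>c = s\<close> and \<open>c = 0\<close>.\<close>
  define \<phi> where "\<phi> a = f (x + a *\<^sub>R u + s *\<^sub>R v) - f (x + a *\<^sub>R u + 0 *\<^sub>R v)" for a
  have "(\<phi> has_real_derivative (D (x + a *\<^sub>R u + s *\<^sub>R v) u - D (x + a *\<^sub>R u + 0 *\<^sub>R v) u)) (at a)"
    if "0 \<le> a" "a \<le> s" for a
  proof -
    have 1: "((\<lambda>a. f (x + a *\<^sub>R u + c *\<^sub>R v)) has_derivative (\<lambda>h. D (x + a *\<^sub>R u + c *\<^sub>R v) (h *\<^sub>R u))) (at a)"
      if "0 \<le> c" "c \<le> s" for c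
    proof -
      have "((\<lambda>a. x + a *\<^sub>R u + c *\<^sub>R v) has_derivative (\<lambda>h. h *\<^sub>R u)) (at a)"
        by (rule has_derivative_eq_rhs, (rule derivative_intros)+) simp
      from has_derivative_compose[OF this f[OF b]] show ?thesis
        using \<open>0 \<le> a\<close> \<open>a \<le> s\<close> that by simp
    qed
    have lin: "D (x + a *\<^sub>R u + c *\<^sub>R v) (h *\<^sub>R u) = h * D (x + a *\<^sub>R u + c *\<^sub>R v) u"
      if "0 \<le> c" "c \<le> s" for c h
      using linear_cmul[OF has_derivative_linear[OF f[OF b[OF \<open>0 \<le> a\<close> \<open>a \<le> s\<close> that]]]] by simp
    show ?thesis
      unfolding has_field_derivative_def \<phi>_def
      by (rule has_derivative_eq_rhs, rule has_derivative_diff[OF 1[of s] 1[of 0]])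
        (use s(1) lin[of s] lin[of 0] in \<open>auto simp: fun_eq_iff algebra_simps\<close>)
  qed
  from MVT2[OF s(1), of \<phi>, OF this] obtain \<sigma> where \<sigma>: "0 < \<sigma>" "\<sigma> < s"
    and 1: "\<phi> s - \<phi> 0 = s * (D (x + \<sigma> *\<^sub>R u + s *\<^sub>R v) u - D (x + \<sigma> *\<^sub>R u + 0 *\<^sub>R v) u)"
    by auto
  have "((\<lambda>c. D (x + \<sigma> *\<^sub>R u + c *\<^sub>R v) u) has_real_derivative D2 (x + \<sigma> *\<^sub>R u + c *\<^sub>R v) v) (at c)"
    if "0 \<le> c" "c \<le> s" for c
  proof -
    have "((\<lambda>c. D (x + \<sigma> *\<^sub>R u + c *\<^sub>R v) u) has_derivative (\<lambda>h. D2 (x + \<sigma> *\<^sub>R u + c *\<^sub>R v) (h *\<^sub>R v))) (at c)"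
    proof -
      have "((\<lambda>c. x + \<sigma> *\<^sub>R u + c *\<^sub>R v) has_derivative (\<lambda>h. h *\<^sub>R v)) (at c)"
        by (rule has_derivative_eq_rhs, (rule derivative_intros)+) simp
      from has_derivative_compose[OF this Df[OF b]] show ?thesis
        using \<sigma> that by simp
    qed
    moreover have "D2 (x + \<sigma> *\<^sub>R u + c *\<^sub>R v) (h *\<^sub>R v) = D2 (x + \<sigma> *\<^sub>R u + c *\<^sub>R v) v * h" for h
      using linear_cmul[OF has_derivative_linear[OF Df[OF b, of \<sigma> c]]] \<sigma> that by simp
    ultimately show ?thesis
      unfolding has_field_derivative_def by simp
  qed
  from MVT2[OF s(1), of "\<lambda>c. D (x + \<sigma> *\<^sub>R u + c *\<^sub>R v) u", OF this] obtain \<tau> where \<tau>: "0 < \<tau>" "\<tau> < s"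
    and "D (x + \<sigma> *\<^sub>R u + s *\<^sub>R v) u - D (x + \<sigma> *\<^sub>R u + 0 *\<^sub>R v) u = s * D2 (x + \<sigma> *\<^sub>R u + \<tau> *\<^sub>R v) v"
    by auto
  with 1 \<sigma> \<tau> show ?thesis
    by (intro exI[of _ \<sigma>] exI[of _ \<tau>]) (simp add: \<phi>_def power2_eq_square)
qed

text \<open>One and the same second difference equals \<open>s\<^sup>2\<close> times either mixed
  derivative at points near \<open>x\<close>. If the mixed derivatives at \<open>x\<close> differed
  by \<open>2 * e\<close>, continuity would keep them apart on a small ball, so they could not share
  a value there.\<close>

theorem frechet_derivative_symmetric:
  fixes f :: "'a::real_normed_vector \<Rightarrow> real"
  assumes "open S" "x \<in> S" and f: "C_on 2 S f"
  shows "frechet_derivative (\<lambda>z. frechet_derivative f (at z) u) (at x) v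
       = frechet_derivative (\<lambda>z. frechet_derivative f (at z) v) (at x) u"
proof (rule ccontr)
  let ?H = "\<lambda>u v z. frechet_derivative (\<lambda>z. frechet_derivative f (at z) u) (at z) v"
  assume ne: "?H u v x \<noteq> ?H v u x"
  define e where "e = \<bar>?H u v x - ?H v u x\<bar> / 2"
  have "e > 0" using ne by (simp add: e_def)
  have f1: "(f has_derivative frechet_derivative f (at z)) (at z)" if "z \<in> S" for z
    using f that C_on_has_derivative by (metis numeral_2_eq_2)
  have f2: "((\<lambda>z. frechet_derivative f (at z) a) has_derivative
      frechet_derivative (\<lambda>z. frechet_derivative f (at z) a) (at z)) (at z)" if "z \<in> S" for z a
    using f that C_on_has_derivative[of 0 S "\<lambda>z. frechet_derivative f (at z) a"] by (simp add: numeral_2_eq_2)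
  have "continuous_on S (?H a b)" for a b
    using f by (simp add: numeral_2_eq_2)
  then have c: "isCont (?H a b) x" for a b
    using assms by (metis continuous_on_eq_continuous_at)
  obtain r0 where r0: "r0 > 0" "ball x r0 \<subseteq> S"
    using assms openE by blast
  obtain r1 where r1: "r1 > 0" "\<And>z. dist z x < r1 \<Longrightarrow> \<bar>?H u v z - ?H u v x\<bar> < e"
    using c[of u v, unfolded continuous_at_eps_delta, rule_format, OF \<open>e > 0\<close>] by (auto simp: dist_real_def)
  obtain r2 where r2: "r2 > 0" "\<And>z. dist z x < r2 \<Longrightarrow> \<bar>?H v u z - ?H v u x\<bar> < e"
    using c[of v u, unfolded continuous_at_eps_delta, rule_format, OF \<open>e > 0\<close>] by (auto simp: dist_real_def)
  define r where "r = min r0 (min r1 r2)"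
  have r: "r > 0" using r0 r1 r2 by (simp add: r_def)
  \<comment> \<open>The added 1 keeps the denominator positive when \<open>u\<close> and
    \<open>v\<close> are both zero; the factor 2 makes the bound by \<open>r\<close> strict.\<close>
  define s where "s = r / (2 * (norm u + norm v + 1))"
  have n: "norm u + norm v + 1 > 0" by (smt (verit) norm_ge_zero)
  have s: "s > 0" "s * (norm u + norm v) < r"
  proof -
    show "s > 0" using r n by (simp add: s_def)
    have "s * (norm u + norm v) \<le> s * (norm u + norm v + 1)" using \<open>s > 0\<close> by simp
    also have "\<dots> = r / 2" using n by (simp add: s_def field_simps)
    finally show "s * (norm u + norm v) < r" using r by simp
  qed
  have sub: "ball x r \<subseteq> S" using r0(2) by (auto simp: r_def)
  have near: "dist (x + a *\<^sub>R p + b *\<^sub>R q) x < r" if "0 < a" "a < s" "0 < b" "b < s" "s * (norm p + norm q) < r" for a b p q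
  proof -
    have "norm (a *\<^sub>R p + b *\<^sub>R q) \<le> a * norm p + b * norm q"
      using that by (intro order_trans[OF norm_triangle_ineq]) simp
    also have "\<dots> \<le> s * norm p + s * norm q"
      using that by (intro add_mono mult_right_mono) auto
    also have "\<dots> < r" using that by (simp add: algebra_simps)
    finally show ?thesis by (simp add: dist_norm add.assoc)
  qed
  from second_difference_mvt[of S f "\<lambda>z. frechet_derivative f (at z)" u
      "\<lambda>z. frechet_derivative (\<lambda>z. frechet_derivative f (at z) u) (at z)" x r s v,
      OF f1 f2 sub s(1) s(2)]
  obtain a b where ab: "0 < a" "a < s" "0 < b" "b < s"
    "f (x + s *\<^sub>R u + s *\<^sub>R v) - f (x + s *\<^sub>R u) - f (x + s *\<^sub>R v) + f x = s\<^sup>2 * ?H u v (x + a *\<^sub>R u + b *\<^sub>R v)"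
    by metis
  have s': "s * (norm v + norm u) < r" using s(2) by (simp add: add.commute)
  from second_difference_mvt[of S f "\<lambda>z. frechet_derivative f (at z)" v
      "\<lambda>z. frechet_derivative (\<lambda>z. frechet_derivative f (at z) v) (at z)" x r s u,
      OF f1 f2 sub s(1) s']
  obtain c d where cd: "0 < c" "c < s" "0 < d" "d < s"
    "f (x + s *\<^sub>R v + s *\<^sub>R u) - f (x + s *\<^sub>R v) - f (x + s *\<^sub>R u) + f x = s\<^sup>2 * ?H v u (x + c *\<^sub>R v + d *\<^sub>R u)"
    by metis
  have "s\<^sup>2 * ?H u v (x + a *\<^sub>R u + b *\<^sub>R v) = s\<^sup>2 * ?H v u (x + c *\<^sub>R v + d *\<^sub>R u)"
    using ab(5) cd(5) by (simp add: algebra_simps)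
  then have eq: "?H u v (x + a *\<^sub>R u + b *\<^sub>R v) = ?H v u (x + c *\<^sub>R v + d *\<^sub>R u)"
    using s(1) by simp
  have "\<bar>?H u v (x + a *\<^sub>R u + b *\<^sub>R v) - ?H u v x\<bar> < e"
    using near[OF ab(1-4) s(2)] r1(2) by (simp add: r_def)
  moreover have "\<bar>?H v u (x + c *\<^sub>R v + d *\<^sub>R u) - ?H v u x\<bar> < e"
    using near[OF cd(1-4) s'] r2(2) by (simp add: r_def)
  ultimately have "\<bar>?H u v x - ?H v u x\<bar> < 2 * e"
    using eq by linarith
  then show False by (simp add: e_def)
qed

section \<open>Bump functions and integrals\<close>

lemma C_on_frechet: "C_on (Suc k) S f \<Longrightarrow> C_on k S (\<lambda>x. frechet_derivative f (at x) v)"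
  by simp

section \<open>A smooth bump function on the line\<close>

definition flat :: "real poly \<Rightarrow> real \<Rightarrow> real" where
  "flat p s = (if 0 < s then poly p (1 / s) * exp (- (1 / s)) else 0)"

lemma poly_mult_exp_tendsto_0: "((\<lambda>t. poly p t * exp (- t)) \<longlongrightarrow> (0::real)) at_top"
proof -
  have "((\<lambda>t. \<Sum>i\<le>degree p. coeff p i * (t ^ i / exp t)) \<longlongrightarrow> (\<Sum>i\<le>degree p. coeff p i * 0)) at_top"
    by (intro tendsto_sum tendsto_mult tendsto_const tendsto_power_div_exp_0)
  moreover have "(\<Sum>i\<le>degree p. coeff p i * (t ^ i / exp t)) = poly p t * exp (- t)" for t
    by (simp add: poly_altdef sum_distrib_right exp_minus divide_inverse mult.assoc)
  ultimately show ?thesis by simp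
qed

lemma flat_tendsto_0: "(flat p \<longlongrightarrow> 0) (at 0)"
proof (rule filterlim_split_at)
  have "(flat p \<longlongrightarrow> 0) (at_left 0) \<longleftrightarrow> ((\<lambda>s. 0::real) \<longlongrightarrow> (0::real)) (at_left (0::real))"
    by (rule tendsto_cong) (auto simp: eventually_at_filter flat_def)
  then show "(flat p \<longlongrightarrow> 0) (at_left 0)"
    by simp
  have "((\<lambda>s. poly p (inverse s) * exp (- inverse s)) \<longlongrightarrow> 0) (at_right 0)"
    by (rule filterlim_compose[OF poly_mult_exp_tendsto_0 filterlim_inverse_at_top_right])
  moreover have "((\<lambda>s. poly p (inverse s) * exp (- inverse s)) \<longlongrightarrow> 0) (at_right 0) \<longleftrightarrow>
      (flat p \<longlongrightarrow> 0) (at_right 0)"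
    by (rule tendsto_cong) (auto simp: eventually_at_filter flat_def divide_inverse)
  ultimately show "(flat p \<longlongrightarrow> 0) (at_right 0)"
    by simp
qed

text \<open>With t = 1/s one has d/ds = - t^2 d/dt, and t^2 (p - p') is the polynomial that arises
  from differentiating p(t) exp(-t); this explains \<open>monom 1 2\<close>.\<close>

lemma flat_has_derivative: "(flat p has_real_derivative flat (monom 1 2 * (p - pderiv p)) s) (at s)"
proof -
  consider "s < 0" | "s = 0" | "0 < s" by linarith
  then show ?thesis
  proof cases
    case 1
    have "(flat p has_real_derivative 0) (at s)"
      by (rule has_field_derivative_transform_within_open[OF DERIV_const, of "{..<0}"])
        (use 1 in \<open>auto simp: flat_def\<close>)
    then show ?thesis
      using 1 by (simp add: flat_def)
  next
    case 2
    \<comment> \<open>The difference quotient at 0 is itself flat: division by \<open>h\<close>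
      multiplies the polynomial by its variable, \<open>[:0, 1:]\<close>.\<close>
    have "(flat ([:0, 1:] * p) \<longlongrightarrow> 0) (at 0)"
      by (rule flat_tendsto_0)
    moreover have "flat ([:0, 1:] * p) = (\<lambda>h. (flat p (0 + h) - flat p 0) / h)"
      by (auto simp: flat_def fun_eq_iff)
    ultimately have "(\<lambda>h. (flat p (0 + h) - flat p 0) / h) \<midarrow>0\<rightarrow> 0"
      by simp
    then show ?thesis
      using 2 by (simp add: DERIV_def flat_def)
  next
    case 3
    have "((\<lambda>s. poly p (1 / s) * exp (- (1 / s))) has_real_derivative
        poly (monom 1 2 * (p - pderiv p)) (1 / s) * exp (- (1 / s))) (at s)"
      using 3
      by (auto intro!: derivative_eq_intros DERIV_chain2[OF poly_DERIV]
          simp: poly_monom field_simps power2_eq_square)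
    then have "(flat p has_real_derivative poly (monom 1 2 * (p - pderiv p)) (1 / s) * exp (- (1 / s))) (at s)"
      by (rule has_field_derivative_transform_within_open[of _ _ _ "{0<..}"])
        (use 3 in \<open>auto simp: flat_def\<close>)
    then show ?thesis
      using 3 by (simp add: flat_def)
  qed
qed

lemma C_on_flat: "C_on k UNIV (flat p)"
proof (induction k arbitrary: p)
  case 0
  then show ?case
    using DERIV_isCont[OF flat_has_derivative] by (auto intro!: continuous_at_imp_continuous_on)
next
  case (Suc k)
  have "(flat p has_derivative (\<lambda>v. flat (monom 1 2 * (p - pderiv p)) s * v)) (at s)" for s
    using flat_has_derivative[of p s] by (simp add: has_field_derivative_def)
  then show ?case
    by (rule C_on_SucI[rotated]) (auto intro!: C_on_mult C_on_const Suc)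
qed

text \<open>Composed with F, the gap below 1 hides the non-smooth zero section, and the cut at 2
  gives compact support in every fibre.\<close>

definition bump :: "real \<Rightarrow> real" where
  "bump s = flat 1 (s - 1) * flat 1 (2 - s)"

lemma C_on_bump: "C_on k UNIV bump"
  unfolding bump_def
  by (intro C_on_mult C_on_compose[OF _ _ C_on_flat] C_on_diff C_on_ident C_on_const) auto

lemma bump_nonneg: "0 \<le> bump s"
  by (simp add: bump_def flat_def)

lemma bump_eq_0: "bump s = 0 \<longleftrightarrow> s \<le> 1 \<or> 2 \<le> s"
  by (auto simp: bump_def flat_def)

section \<open>Integrals depending smoothly on a parameter\<close>

text \<open>Leibniz rule and induction: the derivative in direction \<open>v\<close> is the integral
  of the derivative of \<open>G\<close> in direction \<open>(v, 0)\<close>, which is an integral of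
  the same kind. Over a fixed compact box, continuity of that derivative suffices.\<close>

lemma C_on_integral:
  fixes G :: "'a::euclidean_space \<times> 'b::euclidean_space \<Rightarrow> real"
  assumes "open U"
  shows "C_on k (U \<times> UNIV) G \<Longrightarrow> C_on k U (\<lambda>p. integral (cbox a b) (\<lambda>y. G (p, y)))"
proof (induction k arbitrary: G)
  case 0
  then have "continuous_on (U \<times> cbox a b) (\<lambda>(p, y). G (p, y))"
    by (auto intro: continuous_on_subset)
  then show ?case
    by (simp add: integral_continuous_on_param)
next
  case (Suc k)
  let ?D = "\<lambda>z. frechet_derivative G (at z)"
  have D: "(G has_derivative ?D (p, y)) (at (p, y))" if "p \<in> U" for p y
    using C_on_has_derivative[OF Suc.prems] that by simp
  have bl: "bounded_linear (\<lambda>v. ?D (p, y) (v, 0))" if "p \<in> U" for p y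
    by (rule bounded_linear_compose[OF has_derivative_bounded_linear[OF D[OF that]]])
      (intro bounded_linear_Pair bounded_linear_ident bounded_linear_zero)
  have cont: "continuous_on (U \<times> UNIV) (\<lambda>z. ?D z w)" for w
    by (rule C_on_continuous[OF C_on_frechet[OF Suc.prems]])
  \<comment> \<open>The Leibniz rule asks for the derivative as a bounded linear map varying
    continuously with both variables; continuity is then reduced to basis vectors.\<close>
  define fx where "fx p y = Blinfun (\<lambda>v. ?D (p, y) (v, 0))" for p y
  have fx: "blinfun_apply (fx p y) v = ?D (p, y) (v, 0)" if "p \<in> U" for p y v
    unfolding fx_def using bl[OF that] by (simp add: bounded_linear_Blinfun_apply)
  have cfx: "continuous_on (U \<times> cbox a b) (\<lambda>(p, y). fx p y)"
  proof (rule continuous_on_blinfun_componentwise)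
    fix i :: 'a
    have "continuous_on (U \<times> cbox a b) (\<lambda>z. ?D z (i, 0))"
      using cont by (rule continuous_on_subset) auto
    then show "continuous_on (U \<times> cbox a b) (\<lambda>x. blinfun_apply (case x of (p, y) \<Rightarrow> fx p y) i)"
      by (rule continuous_on_eq) (auto simp: fx)
  qed
  show ?case
  proof (rule C_on_SucI[OF assms])
    fix p0 assume p0: "p0 \<in> U"
    then obtain r where r: "r > 0" "ball p0 r \<subseteq> U"
      using assms openE by blast
    have int: "fx p0 integrable_on cbox a b"
    proof (rule integrable_continuous)
      have "continuous_on (cbox a b) ((\<lambda>(p, y). fx p y) \<circ> (\<lambda>y. (p0, y)))"
        by (rule continuous_on_compose) (auto intro!: continuous_intros continuous_on_subset[OF cfx] simp: p0)
      then show "continuous_on (cbox a b) (fx p0)" by (simp add: o_def)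
    qed
    have "((\<lambda>p. integral (cbox a b) (\<lambda>y. G (p, y))) has_derivative
        blinfun_apply (integral (cbox a b) (fx p0))) (at p0 within ball p0 r)"
    proof (rule leibniz_rule[where f = "\<lambda>p y. G (p, y)"])
      fix p and y :: 'b assume "p \<in> ball p0 r"
      then have p: "p \<in> U" using r by blast
      have "((\<lambda>p. (p, y)) has_derivative (\<lambda>v. (v, 0))) (at p)"
        by (auto intro!: derivative_eq_intros)
      from has_derivative_compose[OF this D[OF p, of y]]
      have "((\<lambda>p. G (p, y)) has_derivative blinfun_apply (fx p y)) (at p)"
        by (rule has_derivative_eq_rhs) (simp add: fx[OF p] fun_eq_iff)
      then show "((\<lambda>p. G (p, y)) has_derivative blinfun_apply (fx p y)) (at p within ball p0 r)"
        by (rule has_derivative_at_withinI)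
    next
      fix p assume "p \<in> ball p0 r"
      then have p: "p \<in> U" using r by blast
      have "continuous_on (cbox a b) (G \<circ> (\<lambda>y. (p, y)))"
        by (rule continuous_on_compose)
          (auto intro!: continuous_intros continuous_on_subset[OF C_on_continuous[OF Suc.prems]] simp: p)
      then show "(\<lambda>y. G (p, y)) integrable_on cbox a b"
        by (intro integrable_continuous) (simp add: o_def)
    qed (use r cfx in \<open>auto intro: continuous_on_subset\<close>)
    moreover have "at p0 within ball p0 r = at p0"
      using r by (intro at_within_open) auto
    moreover have "blinfun_apply (integral (cbox a b) (fx p0)) =
        (\<lambda>v. integral (cbox a b) (\<lambda>y. ?D (p0, y) (v, 0)))"
      using fx[OF p0] int by (auto simp: blinfun_apply_integral)
    ultimately show "((\<lambda>p. integral (cbox a b) (\<lambda>y. G (p, y))) has_derivative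
        (\<lambda>v. integral (cbox a b) (\<lambda>y. ?D (p0, y) (v, 0)))) (at p0)"
      by (simp only:)
  qed (rule Suc.IH[OF C_on_frechet[OF Suc.prems]])
qed

section \<open>Lebesgue integrals under linear substitutions\<close>

lemma nn_integral_lborel_translate:
  fixes f :: "'a::euclidean_space \<Rightarrow> ennreal"
  assumes [measurable]: "f \<in> borel_measurable borel"
  shows "(\<integral>\<^sup>+x. f (a + x) \<partial>lborel) = (\<integral>\<^sup>+x. f x \<partial>lborel)"
  by (subst (2) lborel_distr_plus[symmetric, of a]) (simp add: nn_integral_distr)

lemma nn_integral_lborel_uminus:
  fixes f :: "'a::euclidean_space \<Rightarrow> ennreal"
  assumes [measurable]: "f \<in> borel_measurable borel"
  shows "(\<integral>\<^sup>+x. f (- x) \<partial>lborel) = (\<integral>\<^sup>+x. f x \<partial>lborel)"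
proof -
  have 1: "lborel = distr lborel borel (\<lambda>x. 0 + (\<Sum>j\<in>Basis. ((\<lambda>_. - 1) j * (x \<bullet> j)) *\<^sub>R j) :: 'a)"
    using lborel_affine_euclidean[of "\<lambda>_. - 1" "0::'a"] by (simp add: density_1 one_ennreal_def[symmetric])
  have "(\<Sum>j\<in>Basis. (- 1 * (x \<bullet> j)) *\<^sub>R j) = - x" for x :: 'a
    by (simp add: sum_negf euclidean_representation)
  with 1 have "lborel = distr lborel borel (uminus :: 'a \<Rightarrow> 'a)"
    by simp
  then have "(\<integral>\<^sup>+x. f x \<partial>lborel) = (\<integral>\<^sup>+x. f x \<partial>distr lborel borel uminus)"
    by simp
  then show ?thesis by (simp add: nn_integral_distr)
qed

text \<open>Uniqueness of Haar measure: both sides equal \<open>\<integral>\<integral> f x * g (x + J y) dx dy\<close>.\<close>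

lemma nn_integral_linear_proportional:
  fixes f g :: "'a::euclidean_space \<Rightarrow> ennreal" and J :: "'b::euclidean_space \<Rightarrow> 'a"
  assumes [measurable]: "f \<in> borel_measurable borel" "g \<in> borel_measurable borel"
    and J: "linear J" and surj: "surj J"
  shows "(\<integral>\<^sup>+x. f x \<partial>lborel) * (\<integral>\<^sup>+y. g (J y) \<partial>lborel) = (\<integral>\<^sup>+y. f (J y) \<partial>lborel) * (\<integral>\<^sup>+x. g x \<partial>lborel)"
proof -
  have [measurable]: "J \<in> borel_measurable borel"
    using J by (intro borel_measurable_continuous_onI linear_continuous_on linear_conv_bounded_linear[THEN iffD1])
  \<comment> \<open>By surjectivity \<open>x = J w\<close>, so a translation by \<open>x\<close> in
    the target becomes a translation by \<open>w\<close> in the source, which leaves Lebesgue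
    measure unchanged.\<close>
  have shift: "(\<integral>\<^sup>+y. h (x + J y) \<partial>lborel) = (\<integral>\<^sup>+y. h (J y) \<partial>lborel)"
    if [measurable]: "h \<in> borel_measurable borel" for x and h :: "'a \<Rightarrow> ennreal"
  proof -
    obtain w where "x = J w" using surj by blast
    then have "(\<integral>\<^sup>+y. h (x + J y) \<partial>lborel) = (\<integral>\<^sup>+y. h (J (w + y)) \<partial>lborel)"
      using J by (simp add: linear_add)
    also have "\<dots> = (\<integral>\<^sup>+y. h (J y) \<partial>lborel)"
      by (rule nn_integral_lborel_translate) simp
    finally show ?thesis .
  qed
  have "(\<integral>\<^sup>+x. f x \<partial>lborel) * (\<integral>\<^sup>+y. g (J y) \<partial>lborel) = (\<integral>\<^sup>+x. f x * (\<integral>\<^sup>+y. g (x + J y) \<partial>lborel) \<partial>lborel)"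
    by (simp add: shift nn_integral_multc)
  also have "\<dots> = (\<integral>\<^sup>+x. (\<integral>\<^sup>+y. f x * g (x + J y) \<partial>lborel) \<partial>lborel)"
    by (simp add: nn_integral_cmult)
  also have "\<dots> = (\<integral>\<^sup>+y. (\<integral>\<^sup>+x. f x * g (x + J y) \<partial>lborel) \<partial>lborel)"
    by (rule lborel_pair.Fubini'[symmetric]) measurable
  also have "\<dots> = (\<integral>\<^sup>+y. (\<integral>\<^sup>+x. f (x - J y) * g x \<partial>lborel) \<partial>lborel)"
  proof (rule nn_integral_cong)
    show "(\<integral>\<^sup>+x. f x * g (x + J y) \<partial>lborel) = (\<integral>\<^sup>+x. f (x - J y) * g x \<partial>lborel)" for y
      using nn_integral_lborel_translate[of "\<lambda>x. f (x - J y) * g x" "J y"] by (simp add: add.commute)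
  qed
  also have "\<dots> = (\<integral>\<^sup>+x. (\<integral>\<^sup>+y. f (x - J y) * g x \<partial>lborel) \<partial>lborel)"
    by (rule lborel_pair.Fubini') measurable
  also have "\<dots> = (\<integral>\<^sup>+x. (\<integral>\<^sup>+y. f (J y) \<partial>lborel) * g x \<partial>lborel)"
  proof (rule nn_integral_cong)
    fix x
    have "(\<integral>\<^sup>+y. f (x - J y) \<partial>lborel) = (\<integral>\<^sup>+y. f (x + J y) \<partial>lborel)"
      using nn_integral_lborel_uminus[of "\<lambda>y. f (x + J y)"] J by (simp add: linear_neg)
    then show "(\<integral>\<^sup>+y. f (x - J y) * g x \<partial>lborel) = (\<integral>\<^sup>+y. f (J y) \<partial>lborel) * g x"
      by (simp add: nn_integral_multc shift)
  qed
  also have "\<dots> = (\<integral>\<^sup>+y. f (J y) \<partial>lborel) * (\<integral>\<^sup>+x. g x \<partial>lborel)"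
    by (simp add: nn_integral_cmult)
  finally show ?thesis .
qed

text \<open>The factor by which \<open>J\<close> changes volume is eliminated instead of computed:
  both integrals acquire the same one. Splitting \<open>g\<close> into positive and negative parts
  reduces the claim to nonnegative functions.\<close>

lemma lebesgue_integral_linear_proportional:
  fixes f g :: "'a::euclidean_space \<Rightarrow> real" and J :: "'b::euclidean_space \<Rightarrow> 'a"
  assumes J: "linear J" "surj J"
    and f: "integrable lborel f" "integrable lborel (\<lambda>y. f (J y))" "\<And>x. 0 \<le> f x"
    and g: "integrable lborel g" "integrable lborel (\<lambda>y. g (J y))"
  shows "(LINT x|lborel. f x) * (LINT y|lborel. g (J y)) = (LINT y|lborel. f (J y)) * (LINT x|lborel. g x)"
proof -
  have [measurable]: "f \<in> borel_measurable borel" "g \<in> borel_measurable borel"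
    using f g by (auto dest: borel_measurable_integrable)
  have nonneg: "(LINT x|lborel. f x) * (LINT y|lborel. h (J y)) = (LINT y|lborel. f (J y)) * (LINT x|lborel. h x)"
    if h: "integrable lborel h" "integrable lborel (\<lambda>y. h (J y))" "\<And>x. 0 \<le> h x" for h :: "'a \<Rightarrow> real"
  proof -
    have [measurable]: "h \<in> borel_measurable borel"
      using h by (auto dest: borel_measurable_integrable)
    have "ennreal ((LINT x|lborel. f x) * (LINT y|lborel. h (J y))) = ennreal ((LINT y|lborel. f (J y)) * (LINT x|lborel. h x))"
      using nn_integral_linear_proportional[of "\<lambda>x. ennreal (f x)" "\<lambda>x. ennreal (h x)" J] f h J
      by (simp add: nn_integral_eq_integral ennreal_mult)
    then show ?thesis
      by (subst (asm) ennreal_inj) (use f h in auto)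
  qed
  have "integrable lborel (\<lambda>x. max 0 (g x))" "integrable lborel (\<lambda>x. max 0 (- g x))"
    "integrable lborel (\<lambda>y. max 0 (g (J y)))" "integrable lborel (\<lambda>y. max 0 (- g (J y)))"
    using g by auto
  note p = this
  have split: "h = (\<lambda>x. max 0 (h x) - max 0 (- h x))" for h :: "'c \<Rightarrow> real"
    by auto
  have "(LINT x|lborel. g x) = (LINT x|lborel. max 0 (g x)) - (LINT x|lborel. max 0 (- g x))"
    by (subst split) (simp add: p)
  moreover have "(LINT y|lborel. g (J y)) = (LINT y|lborel. max 0 (g (J y))) - (LINT y|lborel. max 0 (- g (J y)))"
    by (subst split) (simp add: p)
  ultimately show ?thesis
    using nonneg[of "\<lambda>x. max 0 (g x)"] nonneg[of "\<lambda>x. max 0 (- g x)"] p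
    by (simp add: right_diff_distrib)
qed

section \<open>Finsler geometry in natural coordinates\<close>

lemma smooth_on_mult:
  fixes f g :: "'a::real_normed_vector \<Rightarrow> 'b::real_normed_algebra"
  shows "open S \<Longrightarrow> smooth_on S f \<Longrightarrow> smooth_on S g \<Longrightarrow> smooth_on S (\<lambda>x. f x * g x)"
  by (simp add: smooth_on_def C_on_mult)

lemma smooth_on_const: "smooth_on S (\<lambda>x. c)"
  by (simp add: smooth_on_def C_on_const)

lemma vec_expand: "(\<Sum>k\<in>UNIV. (v $ k) *\<^sub>R axis k 1) = (v :: real^'n::finite)"
  using basis_expansion[of v] by (simp add: scalar_mult_eq_scaleR)

lemma matrix_inv:
  fixes A :: "real^'n::finite^'n"
  assumes "invertible A"
  shows "A ** matrix_inv A = mat 1" "matrix_inv A ** A = mat 1"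
  using someI_ex[OF assms[unfolded invertible_def]] by (simp_all add: matrix_inv_def)

lemma frechet_derivative_split:
  fixes G :: "(real^'n::finite) \<times> (real^'n) \<Rightarrow> real"
  assumes "G differentiable at z"
  shows "frechet_derivative G (at z) u =
    (\<Sum>k\<in>UNIV. fst u $ k * d_x k G z) + (\<Sum>k\<in>UNIV. snd u $ k * d_y k G z)"
proof -
  interpret D: linear "frechet_derivative G (at z)"
    by (rule linear_frechet_derivative[OF assms])
  have "(\<Sum>k\<in>UNIV. (fst u $ k) *\<^sub>R (axis k 1, 0)) + (\<Sum>k\<in>UNIV. (snd u $ k) *\<^sub>R (0, axis k 1)) = u"
    by (simp add: prod_eq_iff fst_sum snd_sum vec_expand)
  then have "frechet_derivative G (at z) u = frechet_derivative G (at z)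
      ((\<Sum>k\<in>UNIV. (fst u $ k) *\<^sub>R (axis k 1, 0)) + (\<Sum>k\<in>UNIV. (snd u $ k) *\<^sub>R (0, axis k 1)))"
    by simp
  also have "\<dots> = (\<Sum>k\<in>UNIV. fst u $ k * d_x k G z) + (\<Sum>k\<in>UNIV. snd u $ k * d_y k G z)"
    by (simp only: D.add D.sum D.scale d_x_def d_y_def real_scaleR_def)
  finally show ?thesis .
qed

text \<open>What a chart shows of a Finsler space, with \<open>U\<close> the image of the chart.
  Smoothness is confined to nonzero \<open>y\<close>; strict positivity of \<open>L\<close> there
  comes out of Euler's identity and \<open>g_pos\<close>.\<close>

locale local_finsler =
  fixes L :: "(real^'n::finite) \<times> (real^'n) \<Rightarrow> real" and U :: "(real^'n) set"
  assumes open_U: "open U"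
    and smooth_L: "smooth_on (U \<times> - {0}) L"
    and hom_L: "\<And>p y c. p \<in> U \<Longrightarrow> 0 < c \<Longrightarrow> L (p, c *\<^sub>R y) = c * L (p, y)"
    and L_nonneg: "\<And>p y. p \<in> U \<Longrightarrow> 0 \<le> L (p, y)"
    and g_pos: "\<And>p y v. p \<in> U \<Longrightarrow> y \<noteq> 0 \<Longrightarrow> v \<noteq> 0 \<Longrightarrow> 0 < g_inner L (p, y) v v"
begin

definition slit where "slit = U \<times> - {0::real^'n}"

abbreviation energy where "energy \<equiv> \<lambda>w. (L w)\<^sup>2"

lemma open_slit: "open slit"
  unfolding slit_def by (intro open_Times open_U) auto

lemma slit_iff: "z \<in> slit \<longleftrightarrow> fst z \<in> U \<and> snd z \<noteq> 0"
  by (cases z) (auto simp: slit_def)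

lemma L_zero: "p \<in> U \<Longrightarrow> L (p, 0) = 0"
  using hom_L[of p 2 0] by simp

lemma smooth_energy: "smooth_on slit energy"
  unfolding power2_eq_square using smooth_L by (intro smooth_on_mult open_slit) (auto simp: slit_def)

lemma smooth_d_y: "smooth_on slit G \<Longrightarrow> smooth_on slit (d_y j G)"
  unfolding d_y_def by (rule smooth_on_frechet)

lemma smooth_g: "smooth_on slit (g_low L i j)"
  unfolding g_low_def by (intro smooth_on_mult open_slit smooth_on_const smooth_d_y smooth_energy)

lemma smooth_differentiable: "smooth_on slit G \<Longrightarrow> z \<in> slit \<Longrightarrow> G differentiable at z"
  by (rule differentiableI[OF smooth_on_has_derivative])

lemmas differentiable_energy = smooth_differentiable[OF smooth_energy]
lemmas differentiable_g = smooth_differentiable[OF smooth_g]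

lemma frechet_cong_slit:
  assumes "\<And>w. w \<in> slit \<Longrightarrow> G w = H w" "smooth_on slit G" "z \<in> slit"
  shows "frechet_derivative G (at z) = frechet_derivative H (at z)"
  by (rule frechet_derivative_transform_within_open[OF smooth_differentiable open_slit])
    (use assms in auto)

lemma d_y_commute:
  assumes "smooth_on slit G" "z \<in> slit"
  shows "d_y i (d_y j G) z = d_y j (d_y i G) z"
  unfolding d_y_def
  by (rule frechet_derivative_symmetric[OF open_slit assms(2) smooth_on_C_on[OF assms(1)]])

section \<open>Homogeneity in the fibre\<close>

definition homogeneous where
  "homogeneous r G \<longleftrightarrow> (\<forall>p y c. p \<in> U \<longrightarrow> y \<noteq> 0 \<longrightarrow> 0 < c \<longrightarrow> G (p, c *\<^sub>R y) = c ^ r * G (p, y))"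

text \<open>Differentiating G(p, c y) = c^(r+1) G(p, y) along the fibre produces one factor
  \<open>c\<close> on the left, which cancels one on the right.\<close>

lemma homogeneous_d_y:
  assumes sm: "smooth_on slit G" and hom: "homogeneous (Suc r) G"
  shows "homogeneous r (d_y i G)"
  unfolding homogeneous_def
proof (intro allI impI)
  fix p y :: "real^'n" and c :: real
  assume *: "p \<in> U" "y \<noteq> 0" "0 < c"
  let ?m = "\<lambda>w :: (real^'n) \<times> (real^'n). (fst w, c *\<^sub>R snd w)"
  have z: "(p, y) \<in> slit" "(p, c *\<^sub>R y) \<in> slit" using * by (auto simp: slit_def)
  have "(?m has_derivative ?m) (at (p, y))"
    by (auto intro!: derivative_eq_intros)
  from has_derivative_compose[OF this, of G "frechet_derivative G (at (p, c *\<^sub>R y))"]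
  have "((\<lambda>w. G (?m w)) has_derivative (\<lambda>u. frechet_derivative G (at (p, c *\<^sub>R y)) (?m u))) (at (p, y))"
    using smooth_on_has_derivative[OF sm z(2)] by simp
  moreover have "((\<lambda>w. G (?m w)) has_derivative (\<lambda>u. c ^ Suc r * frechet_derivative G (at (p, y)) u)) (at (p, y))"
  proof (rule has_derivative_transform_within_open[OF _ open_slit z(1)])
    show "((\<lambda>w. c ^ Suc r * G w) has_derivative (\<lambda>u. c ^ Suc r * frechet_derivative G (at (p, y)) u)) (at (p, y))"
      by (rule has_derivative_mult_right[OF smooth_on_has_derivative[OF sm z(1)]])
    show "c ^ Suc r * G w = G (?m w)" if "w \<in> slit" for w
      using hom * that unfolding homogeneous_def by (cases w) (auto simp: slit_def)
  qed
  ultimately have "(\<lambda>u. frechet_derivative G (at (p, c *\<^sub>R y)) (?m u)) = (\<lambda>u. c ^ Suc r * frechet_derivative G (at (p, y)) u)"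
    by (rule has_derivative_unique)
  from fun_cong[OF this, of "(0, axis i 1)"]
  have "frechet_derivative G (at (p, c *\<^sub>R y)) (0, c *\<^sub>R axis i 1) = c ^ Suc r * d_y i G (p, y)"
    by (simp add: d_y_def)
  moreover have "frechet_derivative G (at (p, c *\<^sub>R y)) (0, c *\<^sub>R axis i 1) = c * d_y i G (p, c *\<^sub>R y)"
    using linear_cmul[OF linear_frechet_derivative[OF smooth_differentiable[OF sm z(2)]], of c "(0, axis i 1)"]
    by (simp add: d_y_def)
  ultimately show "d_y i G (p, c *\<^sub>R y) = c ^ r * d_y i G (p, y)"
    using * by simp
qed

text \<open>The derivative of c \<mapsto> G(p, c y) at c = 1, computed once by the chain rule and
  once from homogeneity.\<close>

lemma euler:
  assumes sm: "smooth_on slit G" and hom: "homogeneous r G" and z: "z \<in> slit"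
  shows "(\<Sum>i\<in>UNIV. snd z $ i * d_y i G z) = real r * G z"
proof -
  obtain p y where zz: "z = (p, y)" by (cases z)
  have *: "p \<in> U" "y \<noteq> 0" using z by (auto simp: zz slit_def)
  have "((\<lambda>c. (p, c *\<^sub>R y)) has_derivative (\<lambda>h. (0, h *\<^sub>R y))) (at 1)"
    by (auto intro!: derivative_eq_intros)
  from has_derivative_compose[OF this, of G "frechet_derivative G (at z)"]
  have "((\<lambda>c. G (p, c *\<^sub>R y)) has_derivative (\<lambda>h. frechet_derivative G (at z) (0, h *\<^sub>R y))) (at 1)"
    using smooth_on_has_derivative[OF sm z] by (simp add: zz)
  moreover have "((\<lambda>c. G (p, c *\<^sub>R y)) has_derivative (\<lambda>h. h * (real r * G z))) (at 1)"
  proof (rule has_derivative_transform_within_open[of _ _ _ _ "{0<..}"])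
    show "((\<lambda>c. c ^ r * G (p, y)) has_derivative (\<lambda>h. h * (real r * G z))) (at 1)"
      by (auto intro!: derivative_eq_intros simp: zz)
    show "c ^ r * G (p, y) = G (p, c *\<^sub>R y)" if "c \<in> {0<..}" for c
      using hom * that unfolding homogeneous_def by simp
  qed auto
  ultimately have "(\<lambda>h. frechet_derivative G (at z) (0, h *\<^sub>R y)) = (\<lambda>h. h * (real r * G z))"
    by (rule has_derivative_unique)
  from fun_cong[OF this, of 1] show ?thesis
    using frechet_derivative_split[OF smooth_differentiable[OF sm z], of "(0, y)"] by (simp add: zz)
qed

lemma homogeneous_energy: "homogeneous 2 energy"
  unfolding homogeneous_def by (simp add: hom_L power_mult_distrib)

lemma homogeneous_g: "homogeneous 0 (g_low L i j)"
proof -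
  have "homogeneous 1 (d_y j energy)"
    using homogeneous_d_y[OF smooth_energy, of 1] homogeneous_energy by (simp add: numeral_2_eq_2)
  then have "homogeneous 0 (d_y i (d_y j energy))"
    using homogeneous_d_y[OF smooth_d_y[OF smooth_energy], of 0] by simp
  then show ?thesis
    by (simp add: homogeneous_def g_low_def)
qed

section \<open>The fundamental tensor and the Cartan tensor\<close>

lemma g_sym: "z \<in> slit \<Longrightarrow> g_low L i j z = g_low L j i z"
  unfolding g_low_def using d_y_commute[OF smooth_energy] by simp

lemma frechet_g_sym: "z \<in> slit \<Longrightarrow> frechet_derivative (g_low L i j) (at z) = frechet_derivative (g_low L j i) (at z)"
  by (rule frechet_cong_slit) (auto intro: g_sym smooth_g)

lemma d_x_g_sym: "z \<in> slit \<Longrightarrow> d_x k (g_low L i j) z = d_x k (g_low L j i) z"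
  unfolding d_x_def using frechet_g_sym by metis

lemma d_y_g_sym: "z \<in> slit \<Longrightarrow> d_y k (g_low L i j) z = d_y k (g_low L j i) z"
  unfolding d_y_def using frechet_g_sym by metis

lemma d_y_half: "smooth_on slit G \<Longrightarrow> z \<in> slit \<Longrightarrow> d_y k (\<lambda>w. 1 / 2 * G w) z = 1 / 2 * d_y k G z"
  unfolding d_y_def
  by (subst frechet_derivative_eqI[OF has_derivative_mult_right[OF smooth_on_has_derivative]]) auto

text \<open>The vertical derivatives of g are, up to the factor 1/2, third fibre derivatives of F^2,
  so Schwarz's theorem makes them totally symmetric.\<close>

lemma cartan_sym1: "z \<in> slit \<Longrightarrow> d_y k (g_low L i j) z = d_y i (g_low L k j) z"
proof -
  assume z: "z \<in> slit"
  have "d_y k (g_low L i j) z = 1 / 2 * d_y k (d_y i (d_y j energy)) z" for k i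
    unfolding g_low_def by (rule d_y_half[OF smooth_d_y[OF smooth_d_y[OF smooth_energy]] z])
  then show ?thesis
    using d_y_commute[OF smooth_d_y[OF smooth_energy, of j] z, of k i] by (simp only:)
qed

lemma cartan_sym2: "z \<in> slit \<Longrightarrow> d_y k (g_low L i j) z = d_y j (g_low L i k) z"
  using cartan_sym1 d_y_g_sym by metis

lemma g_contract: "z \<in> slit \<Longrightarrow> (\<Sum>i\<in>UNIV. g_low L i j z * snd z $ i) = 1 / 2 * d_y j energy z"
proof -
  assume z: "z \<in> slit"
  have "homogeneous 1 (d_y j energy)"
    using homogeneous_d_y[OF smooth_energy, of 1] homogeneous_energy by (simp add: numeral_2_eq_2)
  from euler[OF smooth_d_y[OF smooth_energy] this z] show ?thesis
    by (simp add: g_low_def sum_divide_distrib[symmetric] mult.commute)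
qed

lemma g_contract': "z \<in> slit \<Longrightarrow> (\<Sum>i\<in>UNIV. g_low L j i z * snd z $ i) = 1 / 2 * d_y j energy z"
  by (subst g_contract[symmetric]) (auto intro!: sum.cong simp: g_sym)

lemma energy_contract: "z \<in> slit \<Longrightarrow> (\<Sum>j\<in>UNIV. snd z $ j * d_y j energy z) = 2 * energy z"
  using euler[OF smooth_energy homogeneous_energy] by simp

text \<open>Euler's identity for F^2 and for its fibre derivatives. It yields positivity of F off
  the zero section and an expression of F^2 that can be differentiated through g.\<close>

lemma energy_eq: "z \<in> slit \<Longrightarrow> energy z = g_inner L z (snd z) (snd z)"
proof -
  assume z: "z \<in> slit"
  have "g_inner L z (snd z) (snd z) = (\<Sum>i\<in>UNIV. snd z $ i * (\<Sum>j\<in>UNIV. g_low L i j z * snd z $ j))"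
    unfolding g_inner_def by (simp add: sum_distrib_left mult_ac)
  also have "\<dots> = energy z"
    using energy_contract[OF z] by (simp add: g_contract'[OF z] sum_divide_distrib[symmetric])
  finally show ?thesis by simp
qed

lemma L_pos: "p \<in> U \<Longrightarrow> y \<noteq> 0 \<Longrightarrow> 0 < L (p, y)"
  using energy_eq[of "(p, y)"] g_pos[of p y y] L_nonneg[of p y]
  by (simp add: slit_def) (metis less_eq_real_def less_numeral_extra(3) power_zero_numeral)

lemma L_pos': "z \<in> slit \<Longrightarrow> 0 < L z"
  using L_pos by (cases z) (auto simp: slit_def)

lemma cartan_contract: "z \<in> slit \<Longrightarrow> (\<Sum>k\<in>UNIV. snd z $ k * d_y k (g_low L i j) z) = 0"
  using euler[OF smooth_g homogeneous_g] by simp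

lemma g_quadratic: "g_inner L z v v = (\<Sum>i\<in>UNIV. v $ i * (\<Sum>j\<in>UNIV. g_low L i j z * v $ j))"
  unfolding g_inner_def by (simp add: sum_distrib_left mult_ac)

lemma g_nondegenerate:
  assumes "z \<in> slit" "\<And>i. (\<Sum>j\<in>UNIV. g_low L i j z * v j) = 0"
  shows "v j = 0"
proof -
  have "g_inner L z (\<chi> j. v j) (\<chi> j. v j) = 0"
    using assms(2) by (simp add: g_quadratic)
  then have "(\<chi> j. v j) = 0"
    using g_pos[of "fst z" "snd z" "\<chi> j. v j"] assms(1) by (auto simp: slit_iff)
  then show ?thesis by (simp add: vec_eq_iff)
qed

lemma g_invertible: "z \<in> slit \<Longrightarrow> invertible (\<chi> a b. g_low L a b z)"
proof -
  assume z: "z \<in> slit"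
  have "x = 0" if "(\<chi> a b. g_low L a b z) *v x = 0" for x
    using that g_nondegenerate[OF z, of "($) x"] by (simp add: matrix_vector_mult_def vec_eq_iff)
  then show ?thesis
    using invertible_left_inverse matrix_left_invertible_ker by metis
qed

lemma g_up_g_low: "z \<in> slit \<Longrightarrow> (\<Sum>l\<in>UNIV. g_up L i l z * g_low L l j z) = (if i = j then 1 else 0)"
  using matrix_inv(2)[OF g_invertible]
  by (simp add: g_up_def matrix_matrix_mult_def vec_eq_iff mat_def)

lemma g_low_g_up: "z \<in> slit \<Longrightarrow> (\<Sum>l\<in>UNIV. g_low L i l z * g_up L l j z) = (if i = j then 1 else 0)"
  using matrix_inv(1)[OF g_invertible]
  by (simp add: g_up_def matrix_matrix_mult_def vec_eq_iff mat_def)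

lemma lower_raise: "z \<in> slit \<Longrightarrow> (\<Sum>i\<in>UNIV. g_low L s i z * (\<Sum>l\<in>UNIV. g_up L i l z * T l)) = T s"
proof -
  assume z: "z \<in> slit"
  have "(\<Sum>i\<in>UNIV. g_low L s i z * (\<Sum>l\<in>UNIV. g_up L i l z * T l)) =
      (\<Sum>l\<in>UNIV. (\<Sum>i\<in>UNIV. g_low L s i z * g_up L i l z) * T l)"
    unfolding sum_distrib_left sum_distrib_right by (subst sum.swap) (simp add: mult.assoc)
  also have "\<dots> = T s"
    by (simp add: g_low_g_up[OF z] if_distrib[of "\<lambda>x. x * _"] cong: if_cong)
  finally show ?thesis .
qed

lemma raise_lower: "z \<in> slit \<Longrightarrow> (\<Sum>l\<in>UNIV. g_up L s l z * (\<Sum>i\<in>UNIV. g_low L l i z * T i)) = T s"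
proof -
  assume z: "z \<in> slit"
  have "(\<Sum>i\<in>UNIV. g_up L s i z * (\<Sum>l\<in>UNIV. g_low L i l z * T l)) =
      (\<Sum>l\<in>UNIV. (\<Sum>i\<in>UNIV. g_up L s i z * g_low L i l z) * T l)"
    unfolding sum_distrib_left sum_distrib_right by (subst sum.swap) (simp add: mult.assoc)
  also have "\<dots> = T s"
    by (simp add: g_up_g_low[OF z] if_distrib[of "\<lambda>x. x * _"] cong: if_cong)
  finally show ?thesis .
qed

section \<open>Existence and uniqueness of the Chern connection\<close>

text \<open>The horizontal derivative of g_ij along \<delta>/\<delta>x^k.\<close>

definition delta_g where
  "delta_g k i j z = d_x k (g_low L i j) z - (\<Sum>m\<in>UNIV. nonlinear_conn L m k z * d_y m (g_low L i j) z)"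

text \<open>Christoffel symbols of the first kind with \<partial>/\<partial>x^k replaced by
  \<delta>/\<delta>x^k; raising \<open>s\<close> will give the coefficients of the Chern
  connection.\<close>

definition T_low where
  "T_low s j k z = 1 / 2 * (delta_g k s j z + delta_g j s k z - delta_g s j k z)"

definition coeff where
  "coeff i j k z = (\<Sum>s\<in>UNIV. g_up L i s z * T_low s j k z)"

lemma delta_g_sym: "z \<in> slit \<Longrightarrow> delta_g k i j z = delta_g k j i z"
  unfolding delta_g_def using d_x_g_sym d_y_g_sym by simp

lemma T_low_sym: "z \<in> slit \<Longrightarrow> T_low s j k z = T_low s k j z"
  unfolding T_low_def using delta_g_sym[of z s j k] by simp

lemma T_low_sum: "z \<in> slit \<Longrightarrow> T_low i j k z + T_low j i k z = delta_g k i j z"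
  unfolding T_low_def using delta_g_sym[of z k i j] delta_g_sym[of z j i k] delta_g_sym[of z i j k]
  by (simp add: field_simps)

lemma lower_coeff: "z \<in> slit \<Longrightarrow> (\<Sum>i\<in>UNIV. g_low L s i z * coeff i j k z) = T_low s j k z"
  unfolding coeff_def by (rule lower_raise)

lemma chern_rhs:
  assumes z: "z \<in> slit"
  shows "2 * (\<Sum>k\<in>UNIV. A_low L i j k z * delta_y L z k u / L z) =
    (\<Sum>k\<in>UNIV. snd u $ k * d_y k (g_low L i j) z) +
    (\<Sum>l\<in>UNIV. fst u $ l * (\<Sum>k\<in>UNIV. nonlinear_conn L k l z * d_y k (g_low L i j) z))"
proof -
  have "2 * (\<Sum>k\<in>UNIV. A_low L i j k z * delta_y L z k u / L z) = (\<Sum>k\<in>UNIV. d_y k (g_low L i j) z * delta_y L z k u)"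
    unfolding sum_distrib_left by (rule sum.cong) (use L_pos'[OF z] in \<open>auto simp: A_low_def\<close>)
  also have "\<dots> = (\<Sum>k\<in>UNIV. snd u $ k * d_y k (g_low L i j) z) +
      (\<Sum>k\<in>UNIV. \<Sum>l\<in>UNIV. fst u $ l * (nonlinear_conn L k l z * d_y k (g_low L i j) z))"
    by (simp add: delta_y_def algebra_simps sum.distrib sum_distrib_left)
  also have "(\<Sum>k\<in>UNIV. \<Sum>l\<in>UNIV. fst u $ l * (nonlinear_conn L k l z * d_y k (g_low L i j) z)) =
      (\<Sum>l\<in>UNIV. fst u $ l * (\<Sum>k\<in>UNIV. nonlinear_conn L k l z * d_y k (g_low L i j) z))"
    by (subst sum.swap) (simp add: sum_distrib_left)
  finally show ?thesis .
qed

text \<open>The vertical part of dg_ij is exactly the Cartan term prescribed in the metric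
  condition; subtracting it leaves horizontal derivatives paired with dx^k.\<close>

lemma chern_third:
  assumes z: "z \<in> slit"
  shows "frechet_derivative (g_low L i j) (at z) u - 2 * (\<Sum>k\<in>UNIV. A_low L i j k z * delta_y L z k u / L z) =
    (\<Sum>k\<in>UNIV. fst u $ k * delta_g k i j z)"
  unfolding chern_rhs[OF z] frechet_derivative_split[OF differentiable_g[OF z]] delta_g_def
  by (simp add: right_diff_distrib sum_subtractf)

text \<open>Symmetry of \<open>coeff\<close> in its lower indices gives the torsion condition; the
  metric condition, once indices are lowered, is \<open>T_low_sum\<close>.\<close>

lemma chern_equations_coeff:
  assumes z: "z \<in> slit"
  shows "chern_equations L z (\<lambda>i j u. \<Sum>k\<in>UNIV. coeff i j k z * fst u $ k)"
  unfolding chern_equations_def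
proof (intro conjI allI)
  fix i j :: 'n
  show "linear (\<lambda>u :: (real^'n) \<times> (real^'n). \<Sum>k\<in>UNIV. coeff i j k z * fst u $ k)"
    by (rule linearI) (simp_all add: algebra_simps sum.distrib sum_distrib_left)
next
  fix i and u w :: "(real^'n) \<times> (real^'n)"
  have c: "coeff i j k z = coeff i k j z" for j k
    unfolding coeff_def using T_low_sym[OF z] by simp
  have "(\<Sum>j\<in>UNIV. fst w $ j * (\<Sum>k\<in>UNIV. coeff i j k z * fst u $ k)) =
      (\<Sum>k\<in>UNIV. \<Sum>j\<in>UNIV. fst w $ j * (coeff i j k z * fst u $ k))"
    unfolding sum_distrib_left by (rule sum.swap)
  also have "\<dots> = (\<Sum>k\<in>UNIV. \<Sum>j\<in>UNIV. fst w $ j * (coeff i k j z * fst u $ k))"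
    by (intro sum.cong refl, subst c, rule refl)
  finally have "(\<Sum>j\<in>UNIV. fst w $ j * (\<Sum>k\<in>UNIV. coeff i j k z * fst u $ k)) =
      (\<Sum>j\<in>UNIV. fst u $ j * (\<Sum>k\<in>UNIV. coeff i j k z * fst w $ k))"
    by (simp add: sum_distrib_left mult_ac)
  then show "(\<Sum>j\<in>UNIV. fst u $ j * (\<Sum>k\<in>UNIV. coeff i j k z * fst w $ k) - fst w $ j * (\<Sum>k\<in>UNIV. coeff i j k z * fst u $ k)) = 0"
    by (simp only: sum_subtractf)
next
  fix i j and u :: "(real^'n) \<times> (real^'n)"
  have l: "(\<Sum>k\<in>UNIV. g_low L a k z * (\<Sum>m\<in>UNIV. coeff k b m z * fst u $ m)) = (\<Sum>m\<in>UNIV. fst u $ m * T_low a b m z)" for a b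
  proof -
    have "(\<Sum>k\<in>UNIV. g_low L a k z * (\<Sum>m\<in>UNIV. coeff k b m z * fst u $ m)) =
        (\<Sum>m\<in>UNIV. fst u $ m * (\<Sum>k\<in>UNIV. g_low L a k z * coeff k b m z))"
      unfolding sum_distrib_left by (subst sum.swap) (simp add: mult_ac)
    then show ?thesis by (simp add: lower_coeff[OF z])
  qed
  have l': "(\<Sum>k\<in>UNIV. g_low L k j z * (\<Sum>m\<in>UNIV. coeff k i m z * fst u $ m)) = (\<Sum>m\<in>UNIV. fst u $ m * T_low j i m z)"
    using l[of j i] g_sym[OF z] by simp
  have "(\<Sum>k\<in>UNIV. fst u $ k * delta_g k i j z) = (\<Sum>m\<in>UNIV. fst u $ m * T_low i j m z) + (\<Sum>m\<in>UNIV. fst u $ m * T_low j i m z)"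
    by (simp add: T_low_sum[OF z, symmetric] sum.distrib[symmetric] distrib_left)
  then show "frechet_derivative (g_low L i j) (at z) u
      - (\<Sum>k\<in>UNIV. g_low L k j z * (\<Sum>m\<in>UNIV. coeff k i m z * fst u $ m))
      - (\<Sum>k\<in>UNIV. g_low L i k z * (\<Sum>m\<in>UNIV. coeff k j m z * fst u $ m))
      = 2 * (\<Sum>k\<in>UNIV. A_low L i j k z * delta_y L z k u / L z)"
    unfolding l l' using chern_third[OF z, of i j u] by linarith
qed

text \<open>The torsion condition leaves only coefficients symmetric in the lower indices, and the
  metric condition determines these as in the Levi-Civita case. With existence, this makes the
  definite description in \<open>chern_form\<close> meaningful.\<close>

lemma chern_equations_unique:
  assumes z: "z \<in> slit" and ce: "chern_equations L z \<omega>"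
  shows "\<omega> = (\<lambda>i j u. \<Sum>k\<in>UNIV. coeff i j k z * fst u $ k)"
proof (intro ext)
  fix i j u
  have lin: "linear (\<omega> i j)" for i j using ce by (simp add: chern_equations_def)
  have tors: "(\<Sum>j\<in>UNIV. fst u $ j * \<omega> i j w - fst w $ j * \<omega> i j u) = 0" for i u w
    using ce by (simp only: chern_equations_def)
  have metr: "frechet_derivative (g_low L i j) (at z) u
         - (\<Sum>k\<in>UNIV. g_low L k j z * \<omega> k i u) - (\<Sum>k\<in>UNIV. g_low L i k z * \<omega> k j u)
       = 2 * (\<Sum>k\<in>UNIV. A_low L i j k z * delta_y L z k u / L z)" for i j u
    using ce by (simp only: chern_equations_def)
  have axis_sum: "(\<Sum>j\<in>UNIV. axis k 1 $ j * f j) = f k" for k :: 'n and f :: "'n \<Rightarrow> real"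
    by (simp add: axis_def if_distrib[of "\<lambda>x. x * _"] cong: if_cong)
  \<comment> \<open>Evaluated on a coordinate vector and a vertical vector, the torsion condition
    retains a single term: the forms have no dy-part.\<close>
  have vert: "\<omega> i j (0, v) = 0" for i j v
    using tors[of "(axis j 1, 0)" i "(0, v)"] by (simp add: axis_sum)
  define \<Gamma> where "\<Gamma> i j k = \<omega> i j (axis k 1, 0)" for i j k
  have sym: "\<Gamma> i j k = \<Gamma> i k j" for i j k
    using tors[of "(axis j 1, 0)" i "(axis k 1, 0)"] by (simp add: sum_subtractf axis_sum \<Gamma>_def)
  have \<omega>: "\<omega> i j u = (\<Sum>k\<in>UNIV. \<Gamma> i j k * fst u $ k)" for i j u
  proof -
    interpret linear "\<omega> i j" by (rule lin)
    have "u = (\<Sum>k\<in>UNIV. (fst u $ k) *\<^sub>R (axis k 1, 0)) + (0, snd u)"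
      by (simp add: prod_eq_iff fst_sum snd_sum vec_expand)
    then have "\<omega> i j u = \<omega> i j ((\<Sum>k\<in>UNIV. (fst u $ k) *\<^sub>R (axis k 1, 0)) + (0, snd u))"
      by simp
    then show ?thesis
      by (simp only: add sum scale vert) (simp add: \<Gamma>_def mult.commute)
  qed
  define T where "T i j k = (\<Sum>m\<in>UNIV. g_low L i m z * \<Gamma> m j k)" for i j k
  have Tsym: "T i j k = T i k j" for i j k
    unfolding T_def using sym by simp
  have D: "T j i k + T i j k = delta_g k i j z" for i j k
    using metr[of i j "(axis k 1, 0)"] chern_third[OF z, of i j "(axis k 1, 0)"] g_sym[OF z]
    by (simp add: T_def \<Gamma>_def axis_sum)
  \<comment> \<open>Koszul's trick: three cyclic metric equations, combined by symmetry in the last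
    two indices, isolate one lowered coefficient.\<close>
  have "T i j k = T_low i j k z" for i j k
    unfolding T_low_def
    using D[of j i k] D[of k i j] D[of k j i]
      Tsym[of i j k] Tsym[of j i k] Tsym[of k i j]
    by (simp add: field_simps)
  then have "\<Gamma> i j k = coeff i j k z" for i j k
    using raise_lower[OF z, of i "\<lambda>m. \<Gamma> m j k"] by (simp add: coeff_def T_def)
  then show "\<omega> i j u = (\<Sum>k\<in>UNIV. coeff i j k z * fst u $ k)"
    by (simp add: \<omega>)
qed

lemma chern_form_eq: "z \<in> slit \<Longrightarrow> chern_form L z i j u = (\<Sum>k\<in>UNIV. coeff i j k z * fst u $ k)"
  unfolding chern_form_def using the_equality[of "chern_equations L z", OF chern_equations_coeff chern_equations_unique]
  by simp

lemma chern_coeff_eq: "z \<in> slit \<Longrightarrow> chern_coeff L i j k z = coeff i j k z"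
  by (simp add: chern_coeff_def chern_form_eq axis_def if_distrib cong: if_cong)

section \<open>Contraction of the connection with y and the energy identity\<close>

text \<open>Lowering the index removes the inverse matrix from later comparisons. The factor F in
  \<open>A_low\<close> cancels the 1/F in the definition of N, so the Cartan term becomes half of
  \<partial>g_sk/\<partial>y^m times \<gamma>^m_rq y^r y^q.\<close>

lemma lower_nonlinear_conn:
  assumes z: "z \<in> slit"
  shows "(\<Sum>i\<in>UNIV. g_low L s i z * nonlinear_conn L i k z) =
    (\<Sum>j\<in>UNIV. 1 / 2 * (d_x j (g_low L s k) z - d_x s (g_low L k j) z + d_x k (g_low L s j) z) * snd z $ j)
    - (\<Sum>m\<in>UNIV. 1 / 2 * d_y m (g_low L s k) z * (\<Sum>r\<in>UNIV. \<Sum>q\<in>UNIV. formal_christoffel L m r q z * (snd z $ r * snd z $ q)))"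
proof -
  let ?\<gamma> = "\<lambda>l k j. 1 / 2 * (d_x j (g_low L l k) z - d_x l (g_low L k j) z + d_x k (g_low L l j) z)"
  let ?G = "\<lambda>m. \<Sum>r\<in>UNIV. \<Sum>q\<in>UNIV. formal_christoffel L m r q z * (snd z $ r * snd z $ q)"
  have "nonlinear_conn L i k z = (\<Sum>l\<in>UNIV. g_up L i l z *
      ((\<Sum>j\<in>UNIV. ?\<gamma> l k j * snd z $ j) - (\<Sum>m\<in>UNIV. 1 / 2 * d_y m (g_low L l k) z * ?G m)))" for i
  proof -
    have 1: "(\<Sum>j\<in>UNIV. formal_christoffel L i k j z * snd z $ j) = (\<Sum>l\<in>UNIV. g_up L i l z * (\<Sum>j\<in>UNIV. ?\<gamma> l k j * snd z $ j))"
      unfolding formal_christoffel_def sum_distrib_left sum_distrib_right by (subst sum.swap) (simp add: mult_ac)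
    have "(\<Sum>m\<in>UNIV. \<Sum>r\<in>UNIV. \<Sum>q\<in>UNIV. A_up L i k m z * formal_christoffel L m r q z * (snd z $ r * snd z $ q / L z)) =
        (\<Sum>m\<in>UNIV. (A_up L i k m z / L z) * ?G m)"
      by (simp add: sum_distrib_left mult_ac)
    also have "\<dots> = (\<Sum>m\<in>UNIV. \<Sum>l\<in>UNIV. g_up L i l z * (1 / 2 * d_y m (g_low L l k) z * ?G m))"
    proof (rule sum.cong[OF refl])
      fix m
      have "A_up L i k m z / L z = (\<Sum>l\<in>UNIV. g_up L i l z * (1 / 2 * d_y m (g_low L l k) z))"
        unfolding A_up_def A_low_def sum_divide_distrib
        by (rule sum.cong) (use L_pos'[OF z] in auto)
      then show "A_up L i k m z / L z * ?G m = (\<Sum>l\<in>UNIV. g_up L i l z * (1 / 2 * d_y m (g_low L l k) z * ?G m))"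
        by (simp add: sum_distrib_right mult.assoc)
    qed
    also have "\<dots> = (\<Sum>l\<in>UNIV. g_up L i l z * (\<Sum>m\<in>UNIV. 1 / 2 * d_y m (g_low L l k) z * ?G m))"
      by (subst sum.swap) (simp add: sum_distrib_left)
    finally show ?thesis
      unfolding nonlinear_conn_def 1 by (simp only: right_diff_distrib sum_subtractf)
  qed
  then show ?thesis
    by (simp only: lower_raise[OF z])
qed

text \<open>The Cartan term drops out: it is totally symmetric and, since g is homogeneous of degree
  0, it is annihilated by y. What remains is the spray \<gamma>^m_rq y^r y^q.\<close>

lemma nonlinear_conn_contract:
  assumes z: "z \<in> slit"
  shows "(\<Sum>k\<in>UNIV. nonlinear_conn L m k z * snd z $ k) = (\<Sum>r\<in>UNIV. \<Sum>q\<in>UNIV. formal_christoffel L m r q z * (snd z $ r * snd z $ q))"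
proof -
  have A: "(\<Sum>k\<in>UNIV. A_up L m k l z * snd z $ k) = 0" for l
  proof -
    have "(\<Sum>k\<in>UNIV. A_low L a k l z * snd z $ k) = 0" for a
      using cartan_contract[OF z, of a l] cartan_sym2[OF z, of l a]
      by (simp add: A_low_def mult.assoc sum_distrib_left[symmetric] sum_divide_distrib[symmetric] mult.commute[of _ "snd z $ _"] mult.left_commute)
    moreover have "(\<Sum>k\<in>UNIV. A_up L m k l z * snd z $ k) = (\<Sum>a\<in>UNIV. g_up L m a z * (\<Sum>k\<in>UNIV. A_low L a k l z * snd z $ k))"
      unfolding A_up_def sum_distrib_left sum_distrib_right by (subst sum.swap) (simp add: mult.assoc)
    ultimately show ?thesis by simp
  qed
  have 0: "(\<Sum>k\<in>UNIV. (\<Sum>l\<in>UNIV. \<Sum>r\<in>UNIV. \<Sum>s\<in>UNIV. A_up L m k l z * formal_christoffel L l r s z * (snd z $ r * snd z $ s / L z)) * snd z $ k) =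
    (\<Sum>l\<in>UNIV. (\<Sum>k\<in>UNIV. A_up L m k l z * snd z $ k) * (\<Sum>r\<in>UNIV. \<Sum>s\<in>UNIV. formal_christoffel L l r s z * (snd z $ r * snd z $ s / L z)))"
  proof -
    have "(\<Sum>k\<in>UNIV. (\<Sum>l\<in>UNIV. \<Sum>r\<in>UNIV. \<Sum>s\<in>UNIV. A_up L m k l z * formal_christoffel L l r s z * (snd z $ r * snd z $ s / L z)) * snd z $ k) =
      (\<Sum>k\<in>UNIV. \<Sum>l\<in>UNIV. (A_up L m k l z * snd z $ k) * (\<Sum>r\<in>UNIV. \<Sum>s\<in>UNIV. formal_christoffel L l r s z * (snd z $ r * snd z $ s / L z)))"
      by (simp add: sum_distrib_left sum_distrib_right mult_ac)
    then show ?thesis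
      by (subst (asm) sum.swap) (simp only: sum_distrib_right)
  qed
  have "(\<Sum>k\<in>UNIV. nonlinear_conn L m k z * snd z $ k) =
      (\<Sum>k\<in>UNIV. (\<Sum>j\<in>UNIV. formal_christoffel L m k j z * snd z $ j) * snd z $ k)"
    unfolding nonlinear_conn_def left_diff_distrib sum_subtractf 0 A by simp
  then show ?thesis
    by (simp add: sum_distrib_left sum_distrib_right mult_ac)
qed

lemma cartan_contract':
  assumes z: "z \<in> slit"
  shows "(\<Sum>j\<in>UNIV. snd z $ j * d_y m (g_low L s j) z) = 0"
  using cartan_contract[OF z, of s m] cartan_sym2[OF z, of m s] by simp

text \<open>Contracted with y, the two vertical corrections of \<open>T_low\<close> in which y meets
  an index of g vanish; the third one yields the spray and reproduces the Cartan term of N.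
  Nondegeneracy of g then removes the lowering.\<close>

lemma coeff_contract:
  assumes z: "z \<in> slit"
  shows "(\<Sum>j\<in>UNIV. coeff i j k z * snd z $ j) = nonlinear_conn L i k z"
proof -
  have *: "(\<Sum>j\<in>UNIV. T_low s j k z * snd z $ j) = (\<Sum>i\<in>UNIV. g_low L s i z * nonlinear_conn L i k z)" for s
  proof -
    have v: "(\<Sum>j\<in>UNIV. (\<Sum>m\<in>UNIV. nonlinear_conn L m b z * d_y m (g_low L a j) z) * snd z $ j) = 0" for a b
    proof -
      have "(\<Sum>j\<in>UNIV. (\<Sum>m\<in>UNIV. nonlinear_conn L m b z * d_y m (g_low L a j) z) * snd z $ j) =
          (\<Sum>m\<in>UNIV. nonlinear_conn L m b z * (\<Sum>j\<in>UNIV. snd z $ j * d_y m (g_low L a j) z))"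
        unfolding sum_distrib_left sum_distrib_right by (subst sum.swap) (simp add: mult_ac)
      then show ?thesis by (simp add: cartan_contract'[OF z])
    qed
    have w: "(\<Sum>j\<in>UNIV. (\<Sum>m\<in>UNIV. nonlinear_conn L m j z * d_y m (g_low L s k) z) * snd z $ j) =
        (\<Sum>m\<in>UNIV. d_y m (g_low L s k) z * (\<Sum>r\<in>UNIV. \<Sum>q\<in>UNIV. formal_christoffel L m r q z * (snd z $ r * snd z $ q)))"
    proof -
      have "(\<Sum>j\<in>UNIV. (\<Sum>m\<in>UNIV. nonlinear_conn L m j z * d_y m (g_low L s k) z) * snd z $ j) =
          (\<Sum>m\<in>UNIV. d_y m (g_low L s k) z * (\<Sum>j\<in>UNIV. nonlinear_conn L m j z * snd z $ j))"
        unfolding sum_distrib_left sum_distrib_right by (subst sum.swap) (simp add: mult_ac)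
      then show ?thesis by (simp add: nonlinear_conn_contract[OF z])
    qed
    have "(\<Sum>j\<in>UNIV. T_low s j k z * snd z $ j) =
        (\<Sum>j\<in>UNIV. 1 / 2 * (d_x j (g_low L s k) z - d_x s (g_low L k j) z + d_x k (g_low L s j) z) * snd z $ j)
        - 1 / 2 * (\<Sum>j\<in>UNIV. (\<Sum>m\<in>UNIV. nonlinear_conn L m k z * d_y m (g_low L s j) z) * snd z $ j)
        - 1 / 2 * (\<Sum>j\<in>UNIV. (\<Sum>m\<in>UNIV. nonlinear_conn L m j z * d_y m (g_low L s k) z) * snd z $ j)
        + 1 / 2 * (\<Sum>j\<in>UNIV. (\<Sum>m\<in>UNIV. nonlinear_conn L m s z * d_y m (g_low L k j) z) * snd z $ j)"
      unfolding sum_distrib_left[of "1/2"] sum_subtractf[symmetric] sum.distrib[symmetric]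
    proof (rule sum.cong[OF refl])
      fix j
      show "T_low s j k z * snd z $ j =
        1 / 2 * (d_x j (g_low L s k) z - d_x s (g_low L k j) z + d_x k (g_low L s j) z) * snd z $ j
        - 1 / 2 * ((\<Sum>m\<in>UNIV. nonlinear_conn L m k z * d_y m (g_low L s j) z) * snd z $ j)
        - 1 / 2 * ((\<Sum>m\<in>UNIV. nonlinear_conn L m j z * d_y m (g_low L s k) z) * snd z $ j)
        + 1 / 2 * ((\<Sum>m\<in>UNIV. nonlinear_conn L m s z * d_y m (g_low L k j) z) * snd z $ j)"
        unfolding T_low_def delta_g_sym[OF z, of s j k] unfolding delta_g_def
        by (simp add: field_simps)
    qed
    then show ?thesis
      unfolding v w lower_nonlinear_conn[OF z] by (simp add: sum_distrib_left sum_divide_distrib)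
  qed
  have "(\<Sum>i\<in>UNIV. g_low L s i z * (\<Sum>j\<in>UNIV. coeff i j k z * snd z $ j)) =
      (\<Sum>i\<in>UNIV. g_low L s i z * nonlinear_conn L i k z)" for s
  proof -
    have "(\<Sum>i\<in>UNIV. g_low L s i z * (\<Sum>j\<in>UNIV. coeff i j k z * snd z $ j)) =
        (\<Sum>j\<in>UNIV. (\<Sum>i\<in>UNIV. g_low L s i z * coeff i j k z) * snd z $ j)"
      unfolding sum_distrib_left sum_distrib_right by (subst sum.swap) (simp add: mult.assoc)
    then show ?thesis by (simp add: lower_coeff[OF z] *)
  qed
  then have "(\<Sum>j\<in>UNIV. coeff i j k z * snd z $ j) - nonlinear_conn L i k z = 0"
    using g_nondegenerate[OF z, of "\<lambda>i. (\<Sum>j\<in>UNIV. coeff i j k z * snd z $ j) - nonlinear_conn L i k z" i]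
    by (simp only: right_diff_distrib sum_subtractf diff_self)
  then show ?thesis by simp
qed

text \<open>Differentiate F^2 = g_ij y^i y^j in x and split \<partial>g_ij/\<partial>x^k into two
  \<open>T_low\<close> terms and a vertical correction. The correction dies against y; each
  \<open>T_low\<close> term becomes N^m_k times g_im y^i, which is half of N^m_k
  \<partial>F^2/\<partial>y^m.\<close>

lemma horizontal_energy_nonlinear:
  assumes z: "z \<in> slit"
  shows "d_x k energy z = (\<Sum>m\<in>UNIV. nonlinear_conn L m k z * d_y m energy z)"
proof -
  let ?y = "snd z"
  have der: "((\<lambda>w. \<Sum>i\<in>UNIV. \<Sum>j\<in>UNIV. g_low L i j w * snd w $ i * snd w $ j) has_derivative
     (\<lambda>u. \<Sum>i\<in>UNIV. \<Sum>j\<in>UNIV. (g_low L i j z * ?y $ i) * snd u $ j + (g_low L i j z * snd u $ i + frechet_derivative (g_low L i j) (at z) u * ?y $ i) * ?y $ j)) (at z)"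
    by (intro has_derivative_sum has_derivative_mult smooth_on_has_derivative[OF smooth_g z]
        bounded_linear_imp_has_derivative bounded_linear_compose[OF bounded_linear_vec_nth bounded_linear_snd])
  have "(energy has_derivative
     (\<lambda>u. \<Sum>i\<in>UNIV. \<Sum>j\<in>UNIV. (g_low L i j z * ?y $ i) * snd u $ j + (g_low L i j z * snd u $ i + frechet_derivative (g_low L i j) (at z) u * ?y $ i) * ?y $ j)) (at z)"
    by (rule has_derivative_transform_within_open[OF der open_slit z])
      (simp add: energy_eq g_inner_def)
  from frechet_derivative_eqI[OF this]
  have 1: "d_x k energy z = (\<Sum>i\<in>UNIV. \<Sum>j\<in>UNIV. d_x k (g_low L i j) z * ?y $ i * ?y $ j)"
    by (simp add: d_x_def)
  have 2: "(\<Sum>i\<in>UNIV. \<Sum>j\<in>UNIV. (\<Sum>m\<in>UNIV. nonlinear_conn L m k z * d_y m (g_low L i j) z) * ?y $ i * ?y $ j) = 0"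
  proof -
    have "(\<Sum>j\<in>UNIV. (\<Sum>m\<in>UNIV. nonlinear_conn L m k z * d_y m (g_low L i j) z) * ?y $ i * ?y $ j) = 
        (\<Sum>m\<in>UNIV. nonlinear_conn L m k z * ?y $ i * (\<Sum>j\<in>UNIV. ?y $ j * d_y m (g_low L i j) z))" for i
      unfolding sum_distrib_left sum_distrib_right by (subst sum.swap) (simp add: mult_ac)
    then show ?thesis by (simp add: cartan_contract'[OF z])
  qed
  have T: "(\<Sum>i\<in>UNIV. \<Sum>j\<in>UNIV. T_low i j k z * ?y $ i * ?y $ j) = 1 / 2 * (\<Sum>m\<in>UNIV. nonlinear_conn L m k z * d_y m energy z)"
  proof -
    have "(\<Sum>i\<in>UNIV. \<Sum>j\<in>UNIV. T_low i j k z * ?y $ i * ?y $ j) =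
        (\<Sum>i\<in>UNIV. (\<Sum>j\<in>UNIV. (\<Sum>m\<in>UNIV. g_low L i m z * coeff m j k z) * ?y $ j) * ?y $ i)"
      by (simp add: lower_coeff[OF z] sum_distrib_left sum_distrib_right mult_ac)
    also have "\<dots> = (\<Sum>i\<in>UNIV. (\<Sum>m\<in>UNIV. g_low L i m z * nonlinear_conn L m k z) * ?y $ i)"
    proof (rule sum.cong[OF refl])
      fix i
      have "(\<Sum>j\<in>UNIV. (\<Sum>m\<in>UNIV. g_low L i m z * coeff m j k z) * ?y $ j) = (\<Sum>m\<in>UNIV. g_low L i m z * (\<Sum>j\<in>UNIV. coeff m j k z * ?y $ j))"
        unfolding sum_distrib_left sum_distrib_right by (subst sum.swap) (simp add: mult.assoc)
      then show "(\<Sum>j\<in>UNIV. (\<Sum>m\<in>UNIV. g_low L i m z * coeff m j k z) * ?y $ j) * ?y $ i = (\<Sum>m\<in>UNIV. g_low L i m z * nonlinear_conn L m k z) * ?y $ i"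
        by (simp add: coeff_contract[OF z])
    qed
    also have "\<dots> = (\<Sum>m\<in>UNIV. nonlinear_conn L m k z * (\<Sum>i\<in>UNIV. g_low L i m z * ?y $ i))"
      unfolding sum_distrib_left sum_distrib_right by (subst sum.swap) (simp add: mult_ac)
    also have "\<dots> = 1 / 2 * (\<Sum>m\<in>UNIV. nonlinear_conn L m k z * d_y m energy z)"
      by (simp add: g_contract[OF z] sum_divide_distrib)
    finally show ?thesis .
  qed
  have T': "(\<Sum>i\<in>UNIV. \<Sum>j\<in>UNIV. T_low j i k z * ?y $ i * ?y $ j) = (\<Sum>i\<in>UNIV. \<Sum>j\<in>UNIV. T_low i j k z * ?y $ i * ?y $ j)"
    by (subst sum.swap) (simp add: mult_ac)
  have "d_x k (g_low L i j) z * ?y $ i * ?y $ j = T_low i j k z * ?y $ i * ?y $ j + T_low j i k z * ?y $ i * ?y $ j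
      + (\<Sum>m\<in>UNIV. nonlinear_conn L m k z * d_y m (g_low L i j) z) * ?y $ i * ?y $ j" for i j
  proof -
    have "d_x k (g_low L i j) z = T_low i j k z + T_low j i k z + (\<Sum>m\<in>UNIV. nonlinear_conn L m k z * d_y m (g_low L i j) z)"
      using T_low_sum[OF z, of i j k] unfolding delta_g_def by linarith
    then show ?thesis by (simp only: distrib_right)
  qed
  then have "d_x k energy z = (\<Sum>i\<in>UNIV. \<Sum>j\<in>UNIV. T_low i j k z * ?y $ i * ?y $ j) + (\<Sum>i\<in>UNIV. \<Sum>j\<in>UNIV. T_low j i k z * ?y $ i * ?y $ j)
     + (\<Sum>i\<in>UNIV. \<Sum>j\<in>UNIV. (\<Sum>m\<in>UNIV. nonlinear_conn L m k z * d_y m (g_low L i j) z) * ?y $ i * ?y $ j)"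
    unfolding 1 by (simp add: sum.distrib)
  then show ?thesis
    unfolding T' 2 T by simp
qed

text \<open>N^i_k is written as \<Gamma>^i_jk y^j because in this form the coefficients can be
  replaced by the averaged ones.\<close>

theorem horizontal_energy:
  assumes "z \<in> slit"
  shows "d_x k energy z = (\<Sum>i\<in>UNIV. (\<Sum>j\<in>UNIV. chern_coeff L i j k z * snd z $ j) * d_y i energy z)"
  using horizontal_energy_nonlinear[OF assms] coeff_contract[OF assms] chern_coeff_eq[OF assms] by simp

text \<open>If \<open>L\<close> does not depend on x, neither do its fibre derivatives, in
  particular g. So the x-derivatives of g vanish, hence \<gamma>, hence N, hence every term of
  \<open>coeff\<close>.\<close>

lemma chern_coeff_minkowski:
  assumes "\<And>p p' y. p \<in> U \<Longrightarrow> p' \<in> U \<Longrightarrow> L (p, y) = L (p', y)" and z: "z \<in> slit"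
  shows "chern_coeff L i j k z = 0"
proof -
  define indep where "indep G \<longleftrightarrow> (\<forall>p p' y. p \<in> U \<longrightarrow> p' \<in> U \<longrightarrow> y \<noteq> 0 \<longrightarrow> G (p, y) = G (p', y))" for G :: "(real^'n) \<times> (real^'n) \<Rightarrow> real"
  have indep_D: "frechet_derivative G (at (p, y)) = frechet_derivative G (at (p', y))"
    if G: "smooth_on slit G" "indep G" and p: "p \<in> U" "p' \<in> U" "y \<noteq> 0" for G p p' y
  proof -
    \<comment> \<open>Translation in x by \<open>p' - p\<close> compares the germs of
      \<open>G\<close> at the two points; it is used only where a point and its translate both lie
      in \<open>slit\<close>, which is an open set.\<close>
    let ?m = "\<lambda>w :: (real^'n) \<times> (real^'n). (fst w + (p' - p), snd w)"
    have m: "(?m has_derivative (\<lambda>u. u)) (at (p, y))"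
      by (rule has_derivative_eq_rhs, (rule derivative_intros)+) simp
    have "((\<lambda>w. G (?m w)) has_derivative frechet_derivative G (at (p', y))) (at (p, y))"
      using has_derivative_compose[OF m, of G "frechet_derivative G (at (p', y))"]
        smooth_on_has_derivative[OF G(1), of "(p', y)"] p by (simp add: slit_def)
    moreover have "open (slit \<inter> ?m -` slit)"
      by (intro open_Int open_slit open_vimage continuous_intros)
    ultimately have "(G has_derivative frechet_derivative G (at (p', y))) (at (p, y))"
    proof (rule has_derivative_transform_within_open)
      show "(p, y) \<in> slit \<inter> ?m -` slit"
        using p by (simp add: slit_iff)
      fix w assume "w \<in> slit \<inter> ?m -` slit"
      then have "fst w \<in> U" "fst w + (p' - p) \<in> U" "snd w \<noteq> 0"
        by (auto simp: slit_iff)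
      then have "G (fst w + (p' - p), snd w) = G (fst w, snd w)"
        using G(2) unfolding indep_def by blast
      then show "G (?m w) = G w" by simp
    qed
    then show ?thesis by (rule frechet_derivative_eqI)
  qed
  have "indep energy" using assms(1) unfolding indep_def by metis
  then have "indep (d_y a energy)" for a
    unfolding indep_def[of "d_y a energy"] d_y_def using indep_D[OF smooth_energy] by metis
  then have "indep (d_y b (d_y a energy))" for a b
    unfolding indep_def[of "d_y b (d_y a energy)"] d_y_def[of b] using indep_D[OF smooth_d_y[OF smooth_energy]] by metis
  then have ig: "indep (g_low L a b)" for a b
    unfolding indep_def g_low_def by metis
  have dx: "d_x k (g_low L a b) z = 0" for k a b
  proof -
    have "(((\<lambda>w. g_low L a b (fst z, snd w)) has_derivative (\<lambda>u. frechet_derivative (g_low L a b) (at z) (0, snd u))) (at z))"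
    proof -
      have "((\<lambda>w :: (real^'n) \<times> (real^'n). (fst z, snd w)) has_derivative (\<lambda>u. (0, snd u))) (at z)"
        by (rule has_derivative_eq_rhs, (rule derivative_intros)+) simp
      from has_derivative_compose[OF this, of "g_low L a b" "frechet_derivative (g_low L a b) (at z)"]
      show ?thesis using smooth_on_has_derivative[OF smooth_g z, of a b] by simp
    qed
    then have "(g_low L a b has_derivative (\<lambda>u. frechet_derivative (g_low L a b) (at z) (0, snd u))) (at z)"
    proof (rule has_derivative_transform_within_open[OF _ open_slit z])
      fix w assume "w \<in> slit"
      then have "g_low L a b (fst z, snd w) = g_low L a b (fst w, snd w)"
        using ig[of a b] z unfolding indep_def slit_iff by blast
      then show "g_low L a b (fst z, snd w) = g_low L a b w" by simp
    qed
    from frechet_derivative_eqI[OF this] have "d_x k (g_low L a b) z = frechet_derivative (g_low L a b) (at z) (0, 0)"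
      unfolding d_x_def by (metis snd_conv)
    then show ?thesis
      using linear_0[OF linear_frechet_derivative[OF differentiable_g[OF z]]] by (simp add: zero_prod_def)
  qed
  then have "formal_christoffel L a b c z = 0" for a b c
    by (simp add: formal_christoffel_def)
  then have "nonlinear_conn L a b z = 0" for a b
    by (simp add: nonlinear_conn_def)
  then show ?thesis
    by (simp add: chern_coeff_eq[OF z] coeff_def T_low_def delta_g_def dx)
qed

end

section \<open>The averaged connection\<close>

lemma continuous_on_det:
  fixes A :: "'a::topological_space \<Rightarrow> real^'n::finite^'n"
  assumes "\<And>i j. continuous_on S (\<lambda>x. A x $ i $ j)"
  shows "continuous_on S (\<lambda>x. det (A x))"
  unfolding det_def by (intro continuous_intros assms)

text \<open>On the segment from the identity matrix to \<open>A\<close> the determinant does not vanish.\<close>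

lemma det_pos_if_pos_def:
  fixes A :: "real^'n::finite^'n"
  assumes pd: "\<And>v. v \<noteq> 0 \<Longrightarrow> 0 < v \<bullet> (A *v v)"
  shows "0 < det A"
proof -
  define B where "B t = (1 - t) *\<^sub>R mat 1 + t *\<^sub>R A" for t
  have nz: "det (B t) \<noteq> 0" if "0 \<le> t" "t \<le> 1" for t
  proof -
    have "v = 0" if "B t *v v = 0" for v
    proof (rule ccontr)
      assume "v \<noteq> 0"
      have "v \<bullet> (B t *v v) = (1 - t) * (v \<bullet> v) + t * (v \<bullet> (A *v v))"
        by (simp add: B_def matrix_vector_mult_add_rdistrib scaleR_matrix_vector_assoc[symmetric] inner_add_right)
      moreover have "0 < v \<bullet> v" "0 < v \<bullet> (A *v v)"
        using pd \<open>v \<noteq> 0\<close> by auto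
      ultimately have "0 < v \<bullet> (B t *v v)"
        using \<open>0 \<le> t\<close> \<open>t \<le> 1\<close> by (cases "t = 0") (auto intro!: add_nonneg_pos)
      then show False using that by simp
    qed
    then show ?thesis
      using matrix_left_invertible_ker invertible_left_inverse invertible_det_nz by metis
  qed
  have cont: "continuous_on {0..1} (\<lambda>t. det (B t))"
    by (rule continuous_on_det) (auto simp: B_def intro!: continuous_intros)
  show ?thesis
  proof (rule ccontr)
    assume "\<not> 0 < det A"
    then have "\<exists>t\<ge>0. t \<le> 1 \<and> det (B t) = 0"
      using cont by (intro IVT2') (auto simp: B_def)
    with nz show False by blast
  qed
qed

context local_finsler
begin

section \<open>Volume of the indicatrix\<close>

lemma smooth_fiber: "p \<in> U \<Longrightarrow> smooth_on (- {0}) (\<lambda>y. L (p, y))"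
  by (rule smooth_on_compose[OF _ open_slit smooth_L[folded slit_def]])
    (auto simp: smooth_on_def slit_def intro!: C_on_Pair C_on_const C_on_ident)

lemma smooth_radial: "p \<in> U \<Longrightarrow> smooth_on (- {0}) (radial L p)"
  unfolding smooth_on_def radial_def
  by (intro allI C_on_scaleR C_on_divide C_on_const C_on_ident smooth_on_C_on[OF smooth_fiber] L_pos) auto

text \<open>A dilation plus a component along \<open>w\<close>. The value of \<open>c\<close> is
  left open, since the direction \<open>w\<close> is transversal to the face anyway.\<close>

lemma radial_has_derivative:
  assumes "p \<in> U" "w \<noteq> 0"
  shows "\<exists>c. \<forall>u. frechet_derivative (radial L p) (at w) u = (1 / L (p, w)) *\<^sub>R u + c u *\<^sub>R w"
proof -
  let ?D = "frechet_derivative (\<lambda>y. L (p, y)) (at w)"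
  have d: "((\<lambda>y. L (p, y)) has_derivative ?D) (at w)"
    using smooth_on_has_derivative[OF smooth_fiber[OF assms(1)]] assms(2) by simp
  have "((\<lambda>y. inverse (L (p, y)) *\<^sub>R y) has_derivative
      (\<lambda>u. inverse (L (p, w)) *\<^sub>R u + (- (inverse (L (p, w)) * ?D u * inverse (L (p, w)))) *\<^sub>R w)) (at w)"
    by (rule has_derivative_scaleR[OF Deriv.has_derivative_inverse[OF _ d] has_derivative_ident])
      (use L_pos[OF assms] in simp)
  moreover have "radial L p = (\<lambda>y. inverse (L (p, y)) *\<^sub>R y)"
    by (simp add: radial_def fun_eq_iff divide_inverse)
  ultimately have "frechet_derivative (radial L p) (at w) =
      (\<lambda>u. inverse (L (p, w)) *\<^sub>R u + (- (inverse (L (p, w)) * ?D u * inverse (L (p, w)))) *\<^sub>R w)"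
    by (simp add: frechet_derivative_eqI)
  then show ?thesis
    by (intro exI[of _ "\<lambda>u. - (inverse (L (p, w)) * ?D u * inverse (L (p, w)))"]) (simp add: divide_inverse)
qed

lemma radial_nonzero: "p \<in> U \<Longrightarrow> w \<noteq> 0 \<Longrightarrow> radial L p w \<noteq> 0"
  using L_pos by (simp add: radial_def) (metis less_irrefl)

lemma g_inner_matrix: "g_inner L z v w = v \<bullet> ((\<chi> a b. g_low L a b z) *v w)"
  by (simp add: g_inner_def inner_vec_def matrix_vector_mult_def sum_distrib_left mult_ac)

lemma g_inner_sum:
  "g_inner L z (\<Sum>a\<in>UNIV. x a *\<^sub>R R a) (\<Sum>b\<in>UNIV. x b *\<^sub>R R b) =
    (\<Sum>a\<in>UNIV. \<Sum>b\<in>UNIV. x a * x b * g_inner L z (R a) (R b))"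
  unfolding g_inner_matrix
  by (simp add: linear_sum[OF matrix_vector_mul_linear] linear_cmul[OF matrix_vector_mul_linear]
      inner_sum_left inner_sum_right sum_distrib_left mult_ac)
    (subst sum.swap, simp add: mult.left_commute)

text \<open>Bordering by the identity makes the quadratic form of the matrix equal to v_m^2 + g(R X,
  R X), where \<open>X\<close> is \<open>v\<close> without its coordinate \<open>m\<close> and R is
  the derivative of the radial projection. The two summands vanish together only for v = 0.\<close>

lemma volume_density_pos:
  assumes p: "p \<in> U" and w: "w $ m \<noteq> 0"
  shows "0 < volume_density L p m w"
  unfolding volume_density_def real_sqrt_gt_0_iff
proof (rule det_pos_if_pos_def)
  have w0: "w \<noteq> 0" using w by auto
  let ?R = "frechet_derivative (radial L p) (at w)" and ?z = "(p, radial L p w)"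
  let ?K = "\<chi> a b. if a = m \<or> b = m then if a = b then 1 else 0
    else g_inner L ?z (?R (axis a 1)) (?R (axis b 1))"
  interpret R: linear ?R
    using smooth_on_has_derivative[OF smooth_radial[OF p]] w0 by (auto intro!: has_derivative_linear)
  obtain c where c: "\<And>u. ?R u = (1 / L (p, w)) *\<^sub>R u + c u *\<^sub>R w"
    using radial_has_derivative[OF p w0] by blast
  fix v :: "real^'n" assume "v \<noteq> 0"
  define x where "x a = (if a = m then 0 else v $ a)" for a
  define X where "X = (\<chi> a. x a)"
  have entry: "v $ a * (?K $ a $ b * v $ b) = (if a = m then if b = m then v $ m * v $ m else 0 else 0)
      + x a * x b * g_inner L ?z (?R (axis a 1)) (?R (axis b 1))" for a b
    by (auto simp: x_def)
  have "v \<bullet> (?K *v v) = (\<Sum>a\<in>UNIV. \<Sum>b\<in>UNIV. v $ a * (?K $ a $ b * v $ b))"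
    by (simp add: inner_vec_def matrix_vector_mult_def sum_distrib_left)
  also have "\<dots> = v $ m * v $ m + (\<Sum>a\<in>UNIV. \<Sum>b\<in>UNIV. x a * x b * g_inner L ?z (?R (axis a 1)) (?R (axis b 1)))"
    unfolding entry sum.distrib by (simp add: if_distribR sum.If_cases cong: if_cong)
  also have "(\<Sum>a\<in>UNIV. \<Sum>b\<in>UNIV. x a * x b * g_inner L ?z (?R (axis a 1)) (?R (axis b 1))) = g_inner L ?z (?R X) (?R X)"
  proof -
    have "X = (\<Sum>a\<in>UNIV. x a *\<^sub>R axis a 1)"
      using vec_expand[of X] by (simp add: X_def)
    then have "?R X = (\<Sum>a\<in>UNIV. x a *\<^sub>R ?R (axis a 1))"
      by (simp add: R.sum R.scale)
    then show ?thesis by (simp add: g_inner_sum)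
  qed
  finally have eq: "v \<bullet> (?K *v v) = v $ m * v $ m + g_inner L ?z (?R X) (?R X)" .
  show "0 < v \<bullet> (?K *v v)"
  proof (cases "X = 0")
    case True
    then have "v $ a = 0" if "a \<noteq> m" for a
      using that by (simp add: X_def x_def vec_eq_iff split: if_splits) metis
    with \<open>v \<noteq> 0\<close> have "v $ m \<noteq> 0"
      by (metis vec_eq_iff zero_index)
    moreover have "g_inner L ?z (?R X) (?R X) = 0"
      unfolding True R.zero by (simp add: g_inner_def)
    ultimately show ?thesis
      unfolding eq by (simp add: zero_less_mult_iff) linarith
  next
    case False
    \<comment> \<open>R X is a nonzero multiple of \<open>X\<close> plus a multiple of
      \<open>w\<close>. Coordinate \<open>m\<close> of \<open>X\<close> is zero and that of
      \<open>w\<close> is not, so R X = 0 forces both multiples to vanish.\<close>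
    have "?R X \<noteq> 0"
    proof
      assume 0: "?R X = 0"
      have "(?R X) $ m = c X * w $ m"
        by (simp add: c X_def x_def)
      with 0 w have "c X = 0" by simp
      with 0 have "(1 / L (p, w)) *\<^sub>R X = 0" by (simp add: c)
      with False L_pos[OF p w0] show False by simp
    qed
    then have "0 < g_inner L ?z (?R X) (?R X)"
      by (rule g_pos[OF p radial_nonzero[OF p w0]])
    then show ?thesis unfolding eq by (simp add: add_nonneg_pos)
  qed
qed

lemma continuous_volume_density:
  assumes p: "p \<in> U"
  shows "continuous_on (- {0}) (volume_density L p m)"
proof -
  let ?R = "\<lambda>w. frechet_derivative (radial L p) (at w)"
  have R: "continuous_on (- {0}) (\<lambda>w. ?R w u)" for u
    by (rule smooth_on_continuous[OF smooth_on_frechet[OF smooth_radial[OF p]]])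
  have g: "continuous_on (- {0}) (\<lambda>w. g_low L i j (p, radial L p w))" for i j
  proof (rule continuous_on_compose2[OF smooth_on_continuous[OF smooth_g]])
    show "continuous_on (- {0}) (\<lambda>w. (p, radial L p w))"
      by (intro continuous_intros smooth_on_continuous[OF smooth_radial[OF p]])
    show "(\<lambda>w. (p, radial L p w)) ` (- {0}) \<subseteq> slit"
      using p radial_nonzero by (auto simp: slit_def)
  qed
  have "continuous_on (- {0}) (\<lambda>w. g_inner L (p, radial L p w) (?R w u) (?R w v))" for u v
    unfolding g_inner_def by (intro continuous_intros g R)
  then show ?thesis
    unfolding volume_density_def
  proof (intro continuous_on_real_sqrt continuous_on_det)
    fix i j
    show "continuous_on (- {0}) (\<lambda>w. (\<chi> a b. if a = m \<or> b = m then (if a = b then 1 else 0)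
        else g_inner L (p, radial L p w) (?R w (axis a 1)) (?R w (axis b 1))) $ i $ j)"
      using \<open>\<And>v u. continuous_on (- {0}) (\<lambda>w. g_inner L (p, radial L p w) (?R w u) (?R w v))\<close>
      by (cases "i = m \<or> j = m") (simp_all add: continuous_on_const)
  qed
qed

text \<open>Guards the average against default values: a non-integrable density would integrate to
  0, and division by a zero volume would give 0. Only with both facts does averaging a constant
  return it.\<close>

lemma face_integrals:
  fixes m :: 'n
  assumes p: "p \<in> U" and s: "s \<noteq> 0"
  defines "M \<equiv> \<Pi>\<^sub>M a\<in>UNIV - {m}. (lborel :: real measure)" and "A \<equiv> \<Pi>\<^sub>E a\<in>UNIV - {m}. {-1<..<1::real}"
  shows "set_integrable M A (\<lambda>\<zeta>. volume_density L p m (face_point m s \<zeta>))"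
    and "0 < set_lebesgue_integral M A (\<lambda>\<zeta>. volume_density L p m (face_point m s \<zeta>))"
proof -
  interpret product_sigma_finite "\<lambda>_::'n. lborel :: real measure" ..
  have A: "A \<in> sets M"
    unfolding A_def M_def by (rule sets_PiM_I_finite) auto
  have eA: "emeasure M A = (\<Prod>i\<in>UNIV - {m}. emeasure lborel {-1<..<1::real})"
    unfolding A_def M_def by (rule emeasure_PiM) auto
  \<comment> \<open>In dimension one the index set is empty, the face is a single point and its
    measure is 1, so positivity holds there as well.\<close>
  then have eA: "emeasure M A = 2 ^ (CARD('n) - 1)"
    by (simp add: card_Diff_singleton)
  let ?f = "face_point m s"
  have nz: "?f \<zeta> $ m \<noteq> 0" "?f \<zeta> \<noteq> 0" for \<zeta>
  proof -
    show "?f \<zeta> $ m \<noteq> 0" using s by (simp add: face_point_def)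
    then show "?f \<zeta> \<noteq> 0" by auto
  qed
  have f: "?f \<in> borel_measurable M"
  proof (subst borel_measurable_euclidean_space, rule ballI)
    fix b :: "real^'n" assume "b \<in> Basis"
    then obtain i where b: "b = axis i 1" by (auto simp: Basis_vec_def)
    show "(\<lambda>\<zeta>. ?f \<zeta> \<bullet> b) \<in> borel_measurable M"
      unfolding b inner_axis M_def face_point_def
      by (cases "i = m") (auto intro!: measurable_component_singleton)
  qed
  let ?d = "\<lambda>\<zeta>. volume_density L p m (?f \<zeta>)"
  have "(\<lambda>w. indicator (- {0}) w *\<^sub>R volume_density L p m w) \<in> borel_measurable borel"
    by (intro borel_measurable_continuous_on_indicator continuous_volume_density p) auto
  from measurable_compose[OF f this] have d: "?d \<in> borel_measurable M"
    using nz by simp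
  \<comment> \<open>A compact set off the origin containing the face, so the continuous density is
    bounded on the face; the maximum with the absolute value of \<open>s\<close> accommodates
    coordinate \<open>m\<close>.\<close>
  define K where "K = {w :: real^'n. (\<forall>a. \<bar>w $ a\<bar> \<le> max 1 \<bar>s\<bar>) \<and> w $ m = s}"
  have K: "compact K"
  proof -
    have "closed K"
      unfolding K_def by (intro closed_Collect_conj closed_Collect_all closed_Collect_le closed_Collect_eq continuous_intros)
    moreover have "bounded K"
    proof (rule boundedI)
      fix w assume "w \<in> K"
      then have "(\<Sum>a\<in>UNIV. \<bar>w $ a\<bar>) \<le> of_nat CARD('n) * max 1 \<bar>s\<bar>"
        by (intro sum_bounded_above) (simp add: K_def)
      then show "norm w \<le> of_nat CARD('n) * max 1 \<bar>s\<bar>"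
        using norm_le_l1_cart[of w] by linarith
    qed
    ultimately show ?thesis by (simp add: compact_eq_bounded_closed)
  qed
  have "K \<subseteq> - {0}" using s by (auto simp: K_def)
  then have "bounded (volume_density L p m ` K)"
    using K by (intro compact_imp_bounded compact_continuous_image continuous_on_subset[OF continuous_volume_density[OF p]])
  then obtain B where B: "\<And>w. w \<in> K \<Longrightarrow> norm (volume_density L p m w) \<le> B"
    by (auto simp: bounded_iff)
  have "?f \<zeta> \<in> K" if "\<zeta> \<in> A" for \<zeta>
    using that by (auto simp: K_def A_def face_point_def PiE_iff abs_le_iff less_imp_le le_max_iff_disj)
  then have bd: "norm (?d \<zeta>) \<le> B" if "\<zeta> \<in> A" for \<zeta>
    using that B by blast
  show int: "set_integrable M A ?d"
    unfolding set_integrable_def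
    by (rule integrableI_bounded_set_indicator[OF A d]) (use bd in \<open>auto simp: eA power_less_top_ennreal\<close>)
  show "0 < set_lebesgue_integral M A ?d"
  proof (rule ccontr)
    assume "\<not> 0 < set_lebesgue_integral M A ?d"
    moreover have nonneg: "0 \<le> indicator A \<zeta> *\<^sub>R ?d \<zeta>" for \<zeta>
      using volume_density_pos[OF p nz(1)] by (simp add: less_imp_le)
    then have "0 \<le> set_lebesgue_integral M A ?d"
      unfolding set_lebesgue_integral_def by (intro integral_nonneg_AE) simp
    ultimately have "(\<integral>\<zeta>. indicator A \<zeta> *\<^sub>R ?d \<zeta> \<partial>M) = 0"
      unfolding set_lebesgue_integral_def by linarith
    then have "AE \<zeta> in M. indicator A \<zeta> *\<^sub>R ?d \<zeta> = 0"
      using integral_nonneg_eq_0_iff_AE[OF int[unfolded set_integrable_def]] nonneg by simp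
    then have "AE \<zeta> in M. \<zeta> \<notin> A"
      by eventually_elim (use volume_density_pos[OF p nz(1)] in \<open>auto simp: less_le indicator_def split: if_splits\<close>)
    then have "A \<in> null_sets M"
      using AE_iff_null_sets[OF A] by blast
    then have "emeasure M A = 0"
      by (rule null_setsD1)
    then show False using eA by simp
  qed
qed

lemma indicatrix_volume_pos: "p \<in> U \<Longrightarrow> 0 < indicatrix_volume L p"
  unfolding indicatrix_volume_def indicatrix_integral_def
  by (intro sum_pos) (auto simp: face_integrals)

lemma indicatrix_integral_const:
  fixes v :: "'b::{banach, second_countable_topology}"
  assumes p: "p \<in> U" and f: "\<And>y. y \<noteq> 0 \<Longrightarrow> f y = v"
  shows "indicatrix_integral L p f = indicatrix_volume L p *\<^sub>R v"
  unfolding indicatrix_volume_def indicatrix_integral_def scaleR_sum_left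
proof (intro sum.cong refl)
  fix m :: 'n and s :: real assume s: "s \<in> {-1, 1}"
  let ?M = "\<Pi>\<^sub>M a\<in>UNIV - {m}. (lborel :: real measure)" and ?A = "\<Pi>\<^sub>E a\<in>UNIV - {m}. {-1<..<1::real}"
  have "face_point m s \<zeta> $ m \<noteq> 0" for \<zeta>
    using s by (auto simp: face_point_def)
  then have "face_point m s \<zeta> \<noteq> 0" for \<zeta>
    by (metis zero_index)
  then have fv: "f (radial L p (face_point m s \<zeta>)) = v" for \<zeta>
    using f radial_nonzero[OF p] by blast
  have "s \<noteq> 0" using s by auto
  let ?d = "\<lambda>\<zeta>. volume_density L p m (face_point m s \<zeta>)"
  have int: "integrable ?M (\<lambda>\<zeta>. indicator ?A \<zeta> *\<^sub>R ?d \<zeta> *\<^sub>R (1::real))"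
    using face_integrals(1)[OF p \<open>s \<noteq> 0\<close>, of m] by (simp add: set_integrable_def)
  have "set_lebesgue_integral ?M ?A (\<lambda>\<zeta>. ?d \<zeta> *\<^sub>R f (radial L p (face_point m s \<zeta>))) =
      (\<integral>\<zeta>. (indicator ?A \<zeta> *\<^sub>R ?d \<zeta> *\<^sub>R (1::real)) *\<^sub>R v \<partial>?M)"
    unfolding fv set_lebesgue_integral_def by simp
  also have "\<dots> = set_lebesgue_integral ?M ?A (\<lambda>\<zeta>. ?d \<zeta> *\<^sub>R 1) *\<^sub>R v"
    unfolding set_lebesgue_integral_def by (rule integral_scaleR_left) (rule int)
  finally show "set_lebesgue_integral ?M ?A (\<lambda>\<zeta>. ?d \<zeta> *\<^sub>R f (radial L p (face_point m s \<zeta>))) =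
      set_lebesgue_integral ?M ?A (\<lambda>\<zeta>. ?d \<zeta> *\<^sub>R 1) *\<^sub>R v" .
qed

text \<open>The Chern forms ignore the vertical part of the horizontal lift, and the differentiated
  section is constant. So the integrand is a constant vector, and division by the volume returns
  it.\<close>

lemma averaged_coeff_eq:
  assumes p: "p \<in> U" and y: "y \<noteq> 0"
    and const: "\<And>y' i j k. y' \<noteq> 0 \<Longrightarrow> chern_coeff L i j k (p, y') = chern_coeff L i j k (p, y)"
  shows "averaged_coeff L i j k p = chern_coeff L i j k (p, y)"
proof -
  have "chern_deriv L (p, y') (horizontal_lift L (p, y') (axis k 1)) (\<lambda>z. axis j 1) = (\<chi> i. chern_coeff L i j k (p, y))"
    if "y' \<noteq> 0" for y'
  proof -
    have z: "(p, y') \<in> slit" using p that by (simp add: slit_def)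
    have "chern_form L (p, y') i b (horizontal_lift L (p, y') (axis k 1)) = chern_coeff L i b k (p, y)" for i b
      using const[OF that, of i b k]
      by (simp add: chern_form_eq[OF z] chern_coeff_def horizontal_lift_def)
    then show ?thesis
      by (simp add: chern_deriv_def vec_eq_iff axis_def if_distrib[of "\<lambda>x. x * _"] cong: if_cong)
  qed
  then have "indicatrix_integral L p (\<lambda>y'. chern_deriv L (p, y') (horizontal_lift L (p, y') (axis k 1)) (\<lambda>z. axis j 1)) =
      indicatrix_volume L p *\<^sub>R (\<chi> i. chern_coeff L i j k (p, y))"
    by (rule indicatrix_integral_const[OF p])
  then show ?thesis
    using indicatrix_volume_pos[OF p] by (simp add: averaged_coeff_def averaged_deriv_def)
qed

end

section \<open>Charts and tangent spaces\<close>

locale manifold =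
  fixes \<A> :: "('m::{t2_space, second_countable_topology}, 'n::finite) chart set"
  assumes manifold: "smooth_manifold \<A>"
begin

lemma charts_atD: "\<kappa> \<in> charts_at \<A> x \<Longrightarrow> \<kappa> \<in> \<A>" "\<kappa> \<in> charts_at \<A> x \<Longrightarrow> x \<in> fst \<kappa>"
  by (auto simp: charts_at_def)

lemma points_charts_at: "x \<in> points \<A> \<longleftrightarrow> (\<exists>\<kappa>. \<kappa> \<in> charts_at \<A> x)"
  unfolding points_def charts_at_def by blast

text \<open>The inverse homeomorphism of a chart is only asserted to exist; \<open>chart_inv\<close>
  agrees with it on the image and so inherits its continuity.\<close>

lemma chart:
  assumes "\<kappa> \<in> \<A>"
  shows "open (fst \<kappa>)" "open (snd \<kappa> ` fst \<kappa>)" "inj_on (snd \<kappa>) (fst \<kappa>)"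
    and "continuous_on (fst \<kappa>) (snd \<kappa>)" "continuous_on (snd \<kappa> ` fst \<kappa>) (chart_inv \<kappa>)"
proof -
  have "is_chart \<kappa>"
    using manifold assms by (simp add: smooth_manifold_def)
  then obtain \<psi> where \<psi>: "homeomorphism (fst \<kappa>) (snd \<kappa> ` fst \<kappa>) (snd \<kappa>) \<psi>"
    and 1: "open (fst \<kappa>)" "open (snd \<kappa> ` fst \<kappa>)"
    by (auto simp: is_chart_def)
  have left: "\<psi> (snd \<kappa> x) = x" if "x \<in> fst \<kappa>" for x
    using \<psi> that by (simp add: homeomorphism_def)
  then have inj: "inj_on (snd \<kappa>) (fst \<kappa>)"
    by (rule inj_on_inverseI)
  have "continuous_on (snd \<kappa> ` fst \<kappa>) \<psi>"
    using \<psi> by (simp add: homeomorphism_def)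
  then have "continuous_on (snd \<kappa> ` fst \<kappa>) (chart_inv \<kappa>)"
    by (rule continuous_on_eq) (auto simp: chart_inv_def left inj)
  with 1 inj \<psi> show "open (fst \<kappa>)" "open (snd \<kappa> ` fst \<kappa>)" "inj_on (snd \<kappa>) (fst \<kappa>)"
    "continuous_on (fst \<kappa>) (snd \<kappa>)" "continuous_on (snd \<kappa> ` fst \<kappa>) (chart_inv \<kappa>)"
    by (auto simp: homeomorphism_def)
qed

lemma chart_inv_left: "\<kappa> \<in> \<A> \<Longrightarrow> x \<in> fst \<kappa> \<Longrightarrow> chart_inv \<kappa> (snd \<kappa> x) = x"
  by (simp add: chart_inv_def chart(3))

lemma chart_inv_right: "p \<in> snd \<kappa> ` fst \<kappa> \<Longrightarrow> snd \<kappa> (chart_inv \<kappa> p) = p"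
  by (simp add: chart_inv_def f_inv_into_f)

lemma chart_inv_in: "p \<in> snd \<kappa> ` fst \<kappa> \<Longrightarrow> chart_inv \<kappa> p \<in> fst \<kappa>"
  by (simp add: chart_inv_def inv_into_into)

lemma charts_at_inv: "\<kappa> \<in> \<A> \<Longrightarrow> p \<in> snd \<kappa> ` fst \<kappa> \<Longrightarrow> \<kappa> \<in> charts_at \<A> (chart_inv \<kappa> p)"
  by (simp add: charts_at_def chart_inv_in)

lemma open_chart_image:
  assumes "\<kappa> \<in> \<A>" "open W"
  shows "open (snd \<kappa> ` (fst \<kappa> \<inter> W))"
proof -
  have "snd \<kappa> ` (fst \<kappa> \<inter> W) = snd \<kappa> ` fst \<kappa> \<inter> chart_inv \<kappa> -` W"
    using chart_inv_left[OF assms(1)] by (auto simp: image_iff)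
  then show ?thesis
    using continuous_open_preimage[OF chart(5,2)[OF assms(1)] assms(2)] by simp
qed

definition jac where
  "jac x \<kappa> \<kappa>' = frechet_derivative (transition \<kappa> \<kappa>') (at (snd \<kappa> x))"

lemma smooth_transition:
  "\<kappa> \<in> \<A> \<Longrightarrow> \<kappa>' \<in> \<A> \<Longrightarrow> smooth_on (snd \<kappa> ` (fst \<kappa> \<inter> fst \<kappa>')) (transition \<kappa> \<kappa>')"
  using manifold by (simp add: smooth_manifold_def compatible_charts_def)

lemma jac_has_derivative:
  assumes "\<kappa> \<in> charts_at \<A> x" "\<kappa>' \<in> charts_at \<A> x"
  shows "(transition \<kappa> \<kappa>' has_derivative jac x \<kappa> \<kappa>') (at (snd \<kappa> x))"
  unfolding jac_def
  by (rule smooth_on_has_derivative[OF smooth_transition]) (use assms charts_atD in blast)+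

lemma linear_jac: "\<kappa> \<in> charts_at \<A> x \<Longrightarrow> \<kappa>' \<in> charts_at \<A> x \<Longrightarrow> linear (jac x \<kappa> \<kappa>')"
  by (rule has_derivative_linear[OF jac_has_derivative])

lemma transition_eq: "\<kappa> \<in> charts_at \<A> x \<Longrightarrow> transition \<kappa> \<kappa>' (snd \<kappa> x) = snd \<kappa>' x"
  by (simp add: transition_def chart_inv_left charts_atD)

lemma jac_id:
  assumes "\<kappa> \<in> charts_at \<A> x"
  shows "jac x \<kappa> \<kappa> = (\<lambda>v. v)"
  unfolding jac_def
proof (rule frechet_derivative_eqI)
  show "(transition \<kappa> \<kappa> has_derivative (\<lambda>v. v)) (at (snd \<kappa> x))"
    by (rule has_derivative_transform_within_open[OF has_derivative_ident chart(2)[OF charts_atD(1)[OF assms]]])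
      (use assms charts_atD[OF assms] in \<open>auto simp: transition_def chart_inv_left\<close>)
qed

lemma jac_comp:
  assumes "\<kappa> \<in> charts_at \<A> x" "\<kappa>' \<in> charts_at \<A> x" "\<kappa>'' \<in> charts_at \<A> x"
  shows "jac x \<kappa>' \<kappa>'' (jac x \<kappa> \<kappa>' v) = jac x \<kappa> \<kappa>'' v"
proof -
  have "((\<lambda>p. transition \<kappa>' \<kappa>'' (transition \<kappa> \<kappa>' p)) has_derivative (\<lambda>v. jac x \<kappa>' \<kappa>'' (jac x \<kappa> \<kappa>' v))) (at (snd \<kappa> x))"
    using has_derivative_compose[OF jac_has_derivative[OF assms(1,2)], of "transition \<kappa>' \<kappa>''"]
      jac_has_derivative[OF assms(2,3)] transition_eq[OF assms(1), of \<kappa>'] by simp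
  then have "(transition \<kappa> \<kappa>'' has_derivative (\<lambda>v. jac x \<kappa>' \<kappa>'' (jac x \<kappa> \<kappa>' v))) (at (snd \<kappa> x))"
  proof (rule has_derivative_transform_within_open)
    show "open (snd \<kappa> ` (fst \<kappa> \<inter> fst \<kappa>'))"
      using assms by (intro open_chart_image chart charts_atD)
    show "snd \<kappa> x \<in> snd \<kappa> ` (fst \<kappa> \<inter> fst \<kappa>')"
      using assms charts_atD by blast
    fix p assume "p \<in> snd \<kappa> ` (fst \<kappa> \<inter> fst \<kappa>')"
    then show "transition \<kappa>' \<kappa>'' (transition \<kappa> \<kappa>' p) = transition \<kappa> \<kappa>'' p"
      using charts_atD[OF assms(1)] charts_atD[OF assms(2)] by (auto simp: transition_def chart_inv_left)
  qed
  from has_derivative_unique[OF this jac_has_derivative[OF assms(1,3)]]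
  show ?thesis by (rule fun_cong)
qed

lemma tangent_jac:
  "v \<in> tangent_space \<A> x \<Longrightarrow> \<kappa> \<in> charts_at \<A> x \<Longrightarrow> \<kappa>' \<in> charts_at \<A> x \<Longrightarrow> v \<kappa>' = jac x \<kappa> \<kappa>' (v \<kappa>)"
  unfolding tangent_space_def jac_def by blast

lemma tangent_outside: "v \<in> tangent_space \<A> x \<Longrightarrow> \<kappa> \<notin> charts_at \<A> x \<Longrightarrow> v \<kappa> = 0"
  unfolding tangent_space_def by blast

lemma tangentI:
  "(\<And>\<kappa> \<kappa>'. \<kappa> \<in> charts_at \<A> x \<Longrightarrow> \<kappa>' \<in> charts_at \<A> x \<Longrightarrow> v \<kappa>' = jac x \<kappa> \<kappa>' (v \<kappa>)) \<Longrightarrow>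
    (\<And>\<kappa>. \<kappa> \<notin> charts_at \<A> x \<Longrightarrow> v \<kappa> = 0) \<Longrightarrow> v \<in> tangent_space \<A> x"
  unfolding tangent_space_def jac_def by blast

lemma tvec_of_eq: "tvec_of \<A> \<kappa> x y = (\<lambda>\<kappa>'. if \<kappa>' \<in> charts_at \<A> x then jac x \<kappa> \<kappa>' y else 0)"
  unfolding tvec_of_def jac_def ..

lemma tvec_of_tangent: "\<kappa> \<in> charts_at \<A> x \<Longrightarrow> tvec_of \<A> \<kappa> x y \<in> tangent_space \<A> x"
  by (rule tangentI) (auto simp: tvec_of_eq jac_comp)

lemma tvec_of_self: "\<kappa> \<in> charts_at \<A> x \<Longrightarrow> tvec_of \<A> \<kappa> x y \<kappa> = y"
  by (simp add: tvec_of_eq jac_id)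

lemma tvec_of_component: "v \<in> tangent_space \<A> x \<Longrightarrow> \<kappa> \<in> charts_at \<A> x \<Longrightarrow> tvec_of \<A> \<kappa> x (v \<kappa>) = v"
  by (auto simp: tvec_of_eq fun_eq_iff tangent_outside intro: tangent_jac[symmetric])

lemma tvec_of_change:
  "\<kappa> \<in> charts_at \<A> x \<Longrightarrow> \<kappa>' \<in> charts_at \<A> x \<Longrightarrow> tvec_of \<A> \<kappa>' x (jac x \<kappa> \<kappa>' y) = tvec_of \<A> \<kappa> x y"
  by (auto simp: tvec_of_eq fun_eq_iff jac_comp)

lemma tvec_of_lincomb:
  assumes "\<kappa> \<in> charts_at \<A> x"
  shows "tvec_of \<A> \<kappa> x (a *\<^sub>R u + b *\<^sub>R v) = (\<lambda>\<kappa>'. a *\<^sub>R tvec_of \<A> \<kappa> x u \<kappa>' + b *\<^sub>R tvec_of \<A> \<kappa> x v \<kappa>')"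
  using linear_jac[OF assms] by (auto simp: tvec_of_eq fun_eq_iff linear_add linear_cmul)

lemma tvec_of_scale:
  assumes "\<kappa> \<in> charts_at \<A> x"
  shows "tvec_of \<A> \<kappa> x (a *\<^sub>R u) = (\<lambda>\<kappa>'. a *\<^sub>R tvec_of \<A> \<kappa> x u \<kappa>')"
  using tvec_of_lincomb[OF assms, of a u 0 u] by simp

lemma tangent_lincomb:
  assumes "u \<in> tangent_space \<A> x" "v \<in> tangent_space \<A> x"
  shows "(\<lambda>\<kappa>. a *\<^sub>R u \<kappa> + b *\<^sub>R v \<kappa>) \<in> tangent_space \<A> x"
proof (rule tangentI)
  fix \<kappa> \<kappa>' assume *: "\<kappa> \<in> charts_at \<A> x" "\<kappa>' \<in> charts_at \<A> x"
  then show "a *\<^sub>R u \<kappa>' + b *\<^sub>R v \<kappa>' = jac x \<kappa> \<kappa>' (a *\<^sub>R u \<kappa> + b *\<^sub>R v \<kappa>)"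
    using linear_jac[OF *] tangent_jac[OF assms(1) *] tangent_jac[OF assms(2) *]
    by (simp add: linear_add linear_cmul)
qed (simp add: tangent_outside[OF assms(1)] tangent_outside[OF assms(2)])

lemma tangent_eqI:
  assumes "u \<in> tangent_space \<A> x" "v \<in> tangent_space \<A> x" "\<kappa> \<in> charts_at \<A> x" "u \<kappa> = v \<kappa>"
  shows "u = v"
  using tvec_of_component[OF assms(1,3)] tvec_of_component[OF assms(2,3)] assms(4) by metis

lemma zero_tangent: "(\<lambda>\<kappa>. 0) \<in> tangent_space \<A> x"
proof (rule tangentI)
  fix \<kappa> \<kappa>' assume "\<kappa> \<in> charts_at \<A> x" "\<kappa>' \<in> charts_at \<A> x"
  then show "0 = jac x \<kappa> \<kappa>' 0"
    using linear_0[OF linear_jac] by simp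
qed simp

end

locale finsler_manifold = manifold \<A> for \<A> :: "('m::{t2_space, second_countable_topology}, 'n::finite) chart set" +
  fixes F :: "'m \<Rightarrow> ('m, 'n) tvec \<Rightarrow> real"
  assumes finsler: "finsler_structure \<A> F"
begin

abbreviation "Lrep \<equiv> local_rep \<A> F"

lemma F_Lrep: "v \<in> tangent_space \<A> x \<Longrightarrow> \<kappa> \<in> charts_at \<A> x \<Longrightarrow> F x v = Lrep \<kappa> (snd \<kappa> x, v \<kappa>)"
  by (simp add: local_rep_def chart_inv_left charts_atD tvec_of_component)

lemma Lrep_at: "\<kappa> \<in> charts_at \<A> x \<Longrightarrow> Lrep \<kappa> (snd \<kappa> x, y) = F x (tvec_of \<A> \<kappa> x y)"
  by (simp add: local_rep_def chart_inv_left charts_atD)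

lemma local_finsler:
  assumes "\<kappa> \<in> \<A>"
  shows "local_finsler (Lrep \<kappa>) (snd \<kappa> ` fst \<kappa>)"
proof
  show "open (snd \<kappa> ` fst \<kappa>)" by (rule chart(2)[OF assms])
  show "smooth_on (snd \<kappa> ` fst \<kappa> \<times> - {0}) (Lrep \<kappa>)"
    using finsler assms by (simp add: finsler_structure_def)
  show "0 < g_inner (Lrep \<kappa>) (p, y) v v" if "p \<in> snd \<kappa> ` fst \<kappa>" "y \<noteq> 0" "v \<noteq> 0" for p y v
    using finsler assms that unfolding finsler_structure_def by blast
  fix p y assume p: "p \<in> snd \<kappa> ` fst \<kappa>"
  let ?x = "chart_inv \<kappa> p"
  have \<kappa>: "\<kappa> \<in> charts_at \<A> ?x"
    using charts_at_inv[OF assms p] .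
  then have x: "?x \<in> points \<A>"
    using points_charts_at by blast
  note t = tvec_of_tangent[OF \<kappa>, of y]
  show "0 \<le> Lrep \<kappa> (p, y)"
    using finsler x t unfolding finsler_structure_def local_rep_def by simp
  fix c :: real assume "0 < c"
  then have "F ?x (\<lambda>\<kappa>'. c *\<^sub>R tvec_of \<A> \<kappa> ?x y \<kappa>') = c * F ?x (tvec_of \<A> \<kappa> ?x y)"
    using finsler x t unfolding finsler_structure_def by blast
  then show "Lrep \<kappa> (p, c *\<^sub>R y) = c * Lrep \<kappa> (p, y)"
    by (simp add: local_rep_def tvec_of_scale[OF \<kappa>])
qed

end

section \<open>Parallel transport\<close>

context local_finsler
begin

text \<open>Extrema over a compact neighbourhood times the unit sphere, extended by homogeneity.
  That one pair of constants serves all base points near \<open>p\<close> is what controls F^2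
  around the zero section and gives nearby bumps a common support.\<close>

lemma L_bounds:
  assumes p: "p \<in> U"
  shows "\<exists>r c C. 0 < r \<and> 0 < c \<and> 0 < C \<and> ball p r \<subseteq> U \<and>
    (\<forall>q\<in>ball p r. \<forall>y. c * norm y \<le> L (q, y) \<and> L (q, y) \<le> C * norm y)"
proof -
  obtain r where r: "0 < r" "cball p r \<subseteq> U"
    using open_U p open_contains_cball by blast
  let ?K = "cball p r \<times> sphere (0::real^'n) 1"
  have K: "compact ?K" "?K \<noteq> {}" "?K \<subseteq> slit"
  proof -
    show "compact ?K" by (intro compact_Times) auto
    have "(p, axis undefined 1) \<in> ?K" using r by (simp add: norm_axis_1)
    then show "?K \<noteq> {}" by blast
    show "?K \<subseteq> slit" using r by (auto simp: slit_def)
  qed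
  have cont: "continuous_on ?K L"
    using smooth_on_continuous[OF smooth_L] K(3) continuous_on_subset unfolding slit_def by blast
  obtain z where z: "z \<in> ?K" "\<And>w. w \<in> ?K \<Longrightarrow> L z \<le> L w"
    using continuous_attains_inf[OF K(1,2) cont] by blast
  obtain z' where z': "z' \<in> ?K" "\<And>w. w \<in> ?K \<Longrightarrow> L w \<le> L z'"
    using continuous_attains_sup[OF K(1,2) cont] by blast
  have pos: "0 < L z" "0 < L z'" using L_pos' z(1) z'(1) K(3) by blast+
  have "L z * norm y \<le> L (q, y) \<and> L (q, y) \<le> L z' * norm y" if q: "q \<in> ball p r" for q y
  proof (cases "y = 0")
    case True
    then show ?thesis using r q by (simp add: L_zero subset_eq)
  next
    case False
    have "q \<in> U" using r q by auto
    then have "L (q, norm y *\<^sub>R sgn y) = norm y * L (q, sgn y)"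
      using hom_L[of q "norm y" "sgn y"] False by simp
    then have "L (q, y) = norm y * L (q, sgn y)"
      using False by (simp add: sgn_div_norm)
    moreover have "(q, sgn y) \<in> ?K" using q False by (simp add: norm_sgn)
    then have "L z \<le> L (q, sgn y)" "L (q, sgn y) \<le> L z'" using z(2) z'(2) by blast+
    ultimately show ?thesis by (simp add: mult.commute[of _ "norm y"] mult_left_mono)
  qed
  then show ?thesis
    using r pos by (intro exI[of _ r] exI[of _ "L z"] exI[of _ "L z'"]) auto
qed

text \<open>The bound F^2 \<le> C^2 |y|^2, uniform in the base point, forces derivative zero. Thus
  the energy can be followed along a parallel field even through a zero of the field.\<close>

lemma energy_has_derivative_zero:
  assumes p: "p \<in> U"
  shows "(energy has_derivative (\<lambda>_. 0)) (at (p, 0))"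
proof -
  obtain r c C where r: "0 < r" "0 < c" "0 < C" "ball p r \<subseteq> U"
    and b: "\<forall>q\<in>ball p r. \<forall>y. c * norm y \<le> L (q, y) \<and> L (q, y) \<le> C * norm y"
    using L_bounds[OF p] by (elim exE conjE)
  show ?thesis
  proof (rule has_derivativeI_sandwich[where H = "\<lambda>w. C\<^sup>2 * norm (w - (p, 0))" and e = r])
    fix w :: "(real^'n) \<times> (real^'n)" assume w: "w \<noteq> (p, 0)" "dist w (p, 0) < r"
    obtain q y where qy: "w = (q, y)" by (cases w)
    have "dist q p \<le> dist w (p, 0)"
      using dist_fst_le[of w "(p, 0)"] by (simp add: qy)
    then have q: "q \<in> ball p r" using w by (simp add: dist_commute)
    have y: "norm y \<le> norm (w - (p, 0))"
      using norm_snd_le[of y "q - p"] by (simp add: qy)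
    have "L (q, y) \<le> C * norm (w - (p, 0))"
      using b q y r(3) by (meson mult_left_mono order_trans less_imp_le)
    then have "energy w \<le> (C * norm (w - (p, 0)))\<^sup>2"
      unfolding qy using q r(4) L_nonneg[of q y] by (intro power_mono) auto
    then have "energy w / norm (w - (p, 0)) \<le> C\<^sup>2 * norm (w - (p, 0))"
      using w(1) by (simp add: divide_le_eq power2_eq_square mult_ac)
    then show "norm (energy w - energy (p, 0) - 0) / norm (w - (p, 0)) \<le> C\<^sup>2 * norm (w - (p, 0))"
      using p by (simp add: L_zero)
  next
    show "((\<lambda>w. C\<^sup>2 * norm (w - (p, 0))) \<longlongrightarrow> 0) (at (p, 0))"
      by (rule tendsto_eq_intros tendsto_mult tendsto_norm tendsto_diff tendsto_const tendsto_ident_at refl | simp)+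
  qed (use r in auto)
qed

lemma energy_has_derivative:
  assumes "p \<in> U"
  shows "(energy has_derivative (\<lambda>u. (\<Sum>k\<in>UNIV. fst u $ k * d_x k energy (p, y)) + (\<Sum>k\<in>UNIV. snd u $ k * d_y k energy (p, y)))) (at (p, y))"
proof -
  have diff: "energy differentiable (at (p, y))"
  proof (cases "y = 0")
    case True
    then show ?thesis
      using energy_has_derivative_zero[OF assms] by (auto simp: differentiable_def)
  next
    case False
    then show ?thesis
      using assms by (intro differentiable_energy) (simp add: slit_def)
  qed
  then show ?thesis
    using frechet_derivative_works frechet_derivative_split[OF diff] by (metis (no_types, lifting) ext)
qed

text \<open>The Berwald condition in a single chart, under which averaging reproduces the Chern
  coefficients.\<close>

definition averaged_berwald where
  "averaged_berwald \<longleftrightarrow> (\<forall>p\<in>U. \<forall>y y'. y \<noteq> 0 \<longrightarrow> y' \<noteq> 0 \<longrightarrow>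
    (\<forall>i j k. chern_coeff L i j k (p, y) = chern_coeff L i j k (p, y')))"

lemma horizontal_averaged:
  assumes ab: "averaged_berwald" and p: "p \<in> U"
  shows "d_x k energy (p, y) = (\<Sum>i\<in>UNIV. (\<Sum>j\<in>UNIV. averaged_coeff L i j k p * y $ j) * d_y i energy (p, y))"
proof (cases "y = 0")
  case True
  have "frechet_derivative energy (at (p, 0)) = (\<lambda>_. 0)"
    by (rule frechet_derivative_eqI[OF energy_has_derivative_zero[OF p]])
  then show ?thesis
    using True by (simp add: d_x_def)
next
  case False
  have "averaged_coeff L i j k p = chern_coeff L i j k (p, y)" for i j
    using ab p False unfolding averaged_berwald_def by (intro averaged_coeff_eq[OF p False]) blast
  then show ?thesis
    using horizontal_energy[of "(p, y)" k] p False by (simp add: slit_def)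
qed

text \<open>By the chain rule the energy changes at the rate p'^k (\<partial>F^2/\<partial>x^k -
  \<Gamma>^i_jk y^j \<partial>F^2/\<partial>y^i) with averaged \<Gamma>, and the bracket is zero by
  \<open>horizontal_averaged\<close>.\<close>

lemma energy_parallel:
  assumes ab: "averaged_berwald" and p: "p t \<in> U"
    and dp: "(p has_vector_derivative p') (at t within T)"
    and dy: "(y has_vector_derivative
       - (\<chi> i. \<Sum>j\<in>UNIV. \<Sum>k\<in>UNIV. averaged_coeff L i j k (p t) * y t $ j * p' $ k)) (at t within T)"
  shows "((\<lambda>s. energy (p s, y s)) has_vector_derivative 0) (at t within T)"
proof -
  let ?y' = "- (\<chi> i. \<Sum>j\<in>UNIV. \<Sum>k\<in>UNIV. averaged_coeff L i j k (p t) * y t $ j * p' $ k)"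
  have "((\<lambda>s. (p s, y s)) has_derivative (\<lambda>h. (h *\<^sub>R p', h *\<^sub>R ?y'))) (at t within T)"
    using dp dy unfolding has_vector_derivative_def by (rule has_derivative_Pair)
  from has_derivative_compose[OF this energy_has_derivative[OF p]]
  have "((\<lambda>s. energy (p s, y s)) has_derivative (\<lambda>h. h * ((\<Sum>k\<in>UNIV. p' $ k * d_x k energy (p t, y t)) + (\<Sum>k\<in>UNIV. ?y' $ k * d_y k energy (p t, y t))))) (at t within T)"
    by (rule has_derivative_eq_rhs) (simp add: fun_eq_iff sum_distrib_left distrib_left mult_ac)
  moreover have "(\<Sum>k\<in>UNIV. p' $ k * d_x k energy (p t, y t)) =
      - (\<Sum>i\<in>UNIV. ?y' $ i * d_y i energy (p t, y t))"
  proof -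
    have "(\<Sum>k\<in>UNIV. p' $ k * d_x k energy (p t, y t)) =
        (\<Sum>k\<in>UNIV. \<Sum>i\<in>UNIV. p' $ k * ((\<Sum>j\<in>UNIV. averaged_coeff L i j k (p t) * y t $ j) * d_y i energy (p t, y t)))"
      by (simp add: horizontal_averaged[OF ab p] sum_distrib_left)
    also have "\<dots> = (\<Sum>i\<in>UNIV. \<Sum>k\<in>UNIV. p' $ k * ((\<Sum>j\<in>UNIV. averaged_coeff L i j k (p t) * y t $ j) * d_y i energy (p t, y t)))"
      by (rule sum.swap)
    also have "\<dots> = (\<Sum>i\<in>UNIV. (\<Sum>k\<in>UNIV. \<Sum>j\<in>UNIV. averaged_coeff L i j k (p t) * y t $ j * p' $ k) * d_y i energy (p t, y t))"
      by (simp add: sum_distrib_left sum_distrib_right mult_ac)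
    also have "\<dots> = (\<Sum>i\<in>UNIV. (\<Sum>j\<in>UNIV. \<Sum>k\<in>UNIV. averaged_coeff L i j k (p t) * y t $ j * p' $ k) * d_y i energy (p t, y t))"
      by (subst sum.swap) simp
    finally show ?thesis by (simp add: sum_negf)
  qed
  ultimately show ?thesis
    by (simp add: has_vector_derivative_def)
qed

end

section \<open>Parallel fields and transports on the manifold\<close>

context finsler_manifold
begin

lemma F_nonneg: "x \<in> points \<A> \<Longrightarrow> v \<in> tangent_space \<A> x \<Longrightarrow> 0 \<le> F x v"
  using finsler unfolding finsler_structure_def by blast

lemma F_hom: "x \<in> points \<A> \<Longrightarrow> v \<in> tangent_space \<A> x \<Longrightarrow> 0 < c \<Longrightarrow> F x (\<lambda>\<kappa>. c *\<^sub>R v \<kappa>) = c * F x v"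
  using finsler unfolding finsler_structure_def by blast

lemma F_zero: "x \<in> points \<A> \<Longrightarrow> F x (\<lambda>\<kappa>. 0) = 0"
  using F_hom[OF _ zero_tangent, of x 2] by simp

lemma F_eq_0:
  assumes "x \<in> points \<A>" "v \<in> tangent_space \<A> x" "F x v = 0"
  shows "v = (\<lambda>\<kappa>. 0)"
proof -
  obtain \<kappa> where \<kappa>: "\<kappa> \<in> charts_at \<A> x" using assms(1) points_charts_at by blast
  interpret local_finsler "Lrep \<kappa>" "snd \<kappa> ` fst \<kappa>"
    by (rule local_finsler[OF charts_atD(1)[OF \<kappa>]])
  have "v \<kappa> = 0"
    using L_pos[of "snd \<kappa> x" "v \<kappa>"] assms(3) F_Lrep[OF assms(2) \<kappa>] charts_atD(2)[OF \<kappa>] by force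
  then show ?thesis
    using tangent_eqI[OF assms(2) zero_tangent \<kappa>] by simp
qed

lemma smooth_arc_points: "smooth_arc \<A> \<gamma> \<Longrightarrow> t \<in> {0..1} \<Longrightarrow> \<gamma> t \<in> points \<A>"
  unfolding smooth_arc_def by blast

text \<open>One good chart around each point, not every chart: this covers Berwald spaces and also
  locally Minkowski spaces, where only special coordinates are provided.\<close>

definition locally_berwald where
  "locally_berwald \<longleftrightarrow> (\<forall>x\<in>points \<A>. \<exists>\<kappa>\<in>charts_at \<A> x. local_finsler.averaged_berwald (Lrep \<kappa>) (snd \<kappa> ` fst \<kappa>))"

lemma parallel_energy_derivative:
  assumes lb: "locally_berwald" and arc: "smooth_arc \<A> \<gamma>" and par: "parallel_along \<A> F \<gamma> V" and t: "t \<in> {0..1}"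
  shows "((\<lambda>t. (F (\<gamma> t) (V t))\<^sup>2) has_vector_derivative 0) (at t within {0..1})"
proof -
  obtain \<kappa> where \<kappa>: "\<kappa> \<in> charts_at \<A> (\<gamma> t)"
    and ab: "local_finsler.averaged_berwald (Lrep \<kappa>) (snd \<kappa> ` fst \<kappa>)"
    using lb smooth_arc_points[OF arc t] unfolding locally_berwald_def by blast
  interpret local_finsler "Lrep \<kappa>" "snd \<kappa> ` fst \<kappa>"
    by (rule local_finsler[OF charts_atD(1)[OF \<kappa>]])
  obtain J where J: "open J" "{0..1} \<subseteq> J" "continuous_on J \<gamma>"
    and sm: "smooth_on {t\<in>J. \<gamma> t \<in> fst \<kappa>} (snd \<kappa> \<circ> \<gamma>)"
    using arc charts_atD(1)[OF \<kappa>] unfolding smooth_arc_def by blast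
  have "open (J \<inter> \<gamma> -` fst \<kappa>)"
    by (rule continuous_open_preimage[OF J(3,1) chart(1)[OF charts_atD(1)[OF \<kappa>]]])
  moreover have tJ: "t \<in> J \<inter> \<gamma> -` fst \<kappa>"
    using t J charts_atD(2)[OF \<kappa>] by auto
  \<comment> \<open>Within distance \<open>d\<close> of \<open>t\<close> the curve stays in the
    domain of \<kappa>, so there F along V can be read in this one chart.\<close>
  ultimately obtain d where d: "0 < d" "ball t d \<subseteq> J \<inter> \<gamma> -` fst \<kappa>"
    using openE by blast
  have dp: "((snd \<kappa> \<circ> \<gamma>) has_vector_derivative vector_derivative (snd \<kappa> \<circ> \<gamma>) (at t)) (at t within {0..1})"
  proof -
    have "(snd \<kappa> \<circ> \<gamma>) differentiable (at t)"
      using smooth_on_has_derivative[OF sm, of t] tJ by (auto simp: differentiable_def)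
    then show ?thesis
      using vector_derivative_works has_vector_derivative_at_within by blast
  qed
  have dy: "((\<lambda>s. V s \<kappa>) has_vector_derivative
       - (\<chi> i. \<Sum>j\<in>UNIV. \<Sum>k\<in>UNIV. averaged_coeff (Lrep \<kappa>) i j k ((snd \<kappa> \<circ> \<gamma>) t) * V t \<kappa> $ j *
          vector_derivative (snd \<kappa> \<circ> \<gamma>) (at t) $ k)) (at t within {0..1})"
    using par t \<kappa> unfolding parallel_along_def by simp
  have "((\<lambda>s. energy ((snd \<kappa> \<circ> \<gamma>) s, V s \<kappa>)) has_vector_derivative 0) (at t within {0..1})"
    by (rule energy_parallel[OF ab _ dp dy]) (use charts_atD(2)[OF \<kappa>] in simp)
  then show ?thesis
  proof (rule has_vector_derivative_transform_within[OF _ d(1) t])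
    fix s assume s: "s \<in> {0..1}" "dist s t < d"
    then have "s \<in> ball t d" by (simp add: dist_commute)
    then have "\<kappa> \<in> charts_at \<A> (\<gamma> s)"
      using d(2) charts_atD(1)[OF \<kappa>] by (auto simp: charts_at_def)
    moreover have "V s \<in> tangent_space \<A> (\<gamma> s)"
      using par s unfolding parallel_along_def by blast
    ultimately show "energy ((snd \<kappa> \<circ> \<gamma>) s, V s \<kappa>) = (F (\<gamma> s) (V s))\<^sup>2"
      by (simp add: F_Lrep)
  qed
qed

lemma parallel_norm:
  assumes "locally_berwald" "smooth_arc \<A> \<gamma>" "parallel_along \<A> F \<gamma> V"
  shows "F (\<gamma> 1) (V 1) = F (\<gamma> 0) (V 0)"
proof -
  have "\<exists>c. \<forall>t\<in>{0..1}. (F (\<gamma> t) (V t))\<^sup>2 = c"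
    by (rule has_derivative_zero_constant)
      (use parallel_energy_derivative[OF assms] in \<open>auto simp: has_vector_derivative_def\<close>)
  then have "(F (\<gamma> 1) (V 1))\<^sup>2 = (F (\<gamma> 0) (V 0))\<^sup>2"
    by auto
  moreover have "0 \<le> F (\<gamma> t) (V t)" if "t \<in> {0..1}" for t
    using that assms smooth_arc_points[OF assms(2)] by (intro F_nonneg) (auto simp: parallel_along_def)
  ultimately show ?thesis by (simp add: power2_eq_iff_nonneg)
qed

lemma parallel_lincomb:
  assumes "parallel_along \<A> F \<gamma> U" "parallel_along \<A> F \<gamma> V"
  shows "parallel_along \<A> F \<gamma> (\<lambda>t \<kappa>. a *\<^sub>R U t \<kappa> + b *\<^sub>R V t \<kappa>)"
  unfolding parallel_along_def
proof (intro conjI ballI)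
  fix t :: real assume t: "t \<in> {0..1}"
  show "(\<lambda>\<kappa>. a *\<^sub>R U t \<kappa> + b *\<^sub>R V t \<kappa>) \<in> tangent_space \<A> (\<gamma> t)"
    using assms t unfolding parallel_along_def by (intro tangent_lincomb) auto
  fix \<kappa> assume \<kappa>: "\<kappa> \<in> charts_at \<A> (\<gamma> t)"
  let ?c = "\<lambda>i j k. averaged_coeff (Lrep \<kappa>) i j k (snd \<kappa> (\<gamma> t))"
  let ?g = "\<lambda>k. vector_derivative (snd \<kappa> \<circ> \<gamma>) (at t) $ k"
  have "((\<lambda>s. a *\<^sub>R U s \<kappa> + b *\<^sub>R V s \<kappa>) has_vector_derivative
      (a *\<^sub>R (- (\<chi> i. \<Sum>j\<in>UNIV. \<Sum>k\<in>UNIV. ?c i j k * U t \<kappa> $ j * ?g k)) +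
       b *\<^sub>R (- (\<chi> i. \<Sum>j\<in>UNIV. \<Sum>k\<in>UNIV. ?c i j k * V t \<kappa> $ j * ?g k)))) (at t within {0..1})"
    using assms t \<kappa> unfolding parallel_along_def
    by (intro has_vector_derivative_add bounded_linear.has_vector_derivative[OF bounded_linear_scaleR_right]) auto
  moreover have "a *\<^sub>R (- (\<chi> i. \<Sum>j\<in>UNIV. \<Sum>k\<in>UNIV. ?c i j k * U t \<kappa> $ j * ?g k)) +
       b *\<^sub>R (- (\<chi> i. \<Sum>j\<in>UNIV. \<Sum>k\<in>UNIV. ?c i j k * V t \<kappa> $ j * ?g k)) =
      - (\<chi> i. \<Sum>j\<in>UNIV. \<Sum>k\<in>UNIV. ?c i j k * (a *\<^sub>R U t \<kappa> + b *\<^sub>R V t \<kappa>) $ j * ?g k)"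
    by (simp add: vec_eq_iff algebra_simps sum.distrib sum_distrib_left)
  ultimately show "((\<lambda>s. a *\<^sub>R U s \<kappa> + b *\<^sub>R V s \<kappa>) has_vector_derivative
      - (\<chi> i. \<Sum>j\<in>UNIV. \<Sum>k\<in>UNIV. ?c i j k * (a *\<^sub>R U t \<kappa> + b *\<^sub>R V t \<kappa>) $ j * ?g k)) (at t within {0..1})"
    by simp
qed

definition linear_isometry where
  "linear_isometry x y P \<longleftrightarrow> P \<in> tangent_space \<A> x \<rightarrow> tangent_space \<A> y \<and>
    (\<forall>v\<in>tangent_space \<A> x. F y (P v) = F x v) \<and>
    (\<forall>u\<in>tangent_space \<A> x. \<forall>v\<in>tangent_space \<A> x. \<forall>a b.
       P (\<lambda>\<kappa>. a *\<^sub>R u \<kappa> + b *\<^sub>R v \<kappa>) = (\<lambda>\<kappa>. a *\<^sub>R P u \<kappa> + b *\<^sub>R P v \<kappa>))"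

text \<open>Linearity needs no uniqueness theorem for differential equations: the defect of linearity is a
  parallel field which vanishes at \<open>0\<close>, and its norm is constant.\<close>

lemma parallel_transport_isometry:
  assumes lb: "locally_berwald" and arc: "smooth_arc \<A> \<gamma>" and Q: "parallel_transport \<A> F \<gamma> Q"
  shows "linear_isometry (\<gamma> 0) (\<gamma> 1) Q"
proof -
  have V: "\<exists>V. parallel_along \<A> F \<gamma> V \<and> V 0 = v \<and> V 1 = Q v" if "v \<in> tangent_space \<A> (\<gamma> 0)" for v
    using Q that unfolding parallel_transport_def by blast
  have "Q \<in> tangent_space \<A> (\<gamma> 0) \<rightarrow> tangent_space \<A> (\<gamma> 1)"
    using Q unfolding parallel_transport_def by auto
  moreover have "F (\<gamma> 1) (Q v) = F (\<gamma> 0) v" if v: "v \<in> tangent_space \<A> (\<gamma> 0)" for v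
  proof -
    obtain X where "parallel_along \<A> F \<gamma> X" "X 0 = v" "X 1 = Q v" using V[OF v] by blast
    then show ?thesis using parallel_norm[OF lb arc, of X] by simp
  qed
  moreover have "Q (\<lambda>\<kappa>. a *\<^sub>R u \<kappa> + b *\<^sub>R v \<kappa>) = (\<lambda>\<kappa>. a *\<^sub>R Q u \<kappa> + b *\<^sub>R Q v \<kappa>)"
    if u: "u \<in> tangent_space \<A> (\<gamma> 0)" and v: "v \<in> tangent_space \<A> (\<gamma> 0)" for u v a b
  proof -
    let ?w = "\<lambda>\<kappa>. a *\<^sub>R u \<kappa> + b *\<^sub>R v \<kappa>"
    obtain X where X: "parallel_along \<A> F \<gamma> X" "X 0 = u" "X 1 = Q u" using V[OF u] by blast
    obtain Y where Y: "parallel_along \<A> F \<gamma> Y" "Y 0 = v" "Y 1 = Q v" using V[OF v] by blast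
    obtain Z where Z: "parallel_along \<A> F \<gamma> Z" "Z 0 = ?w" "Z 1 = Q ?w"
      using V[OF tangent_lincomb[OF u v]] by blast
    \<comment> \<open>The coefficients 1 and -1 are written out to give the shape required by
      \<open>parallel_lincomb\<close>.\<close>
    define D where "D t \<kappa> = 1 *\<^sub>R Z t \<kappa> + (- 1) *\<^sub>R (a *\<^sub>R X t \<kappa> + b *\<^sub>R Y t \<kappa>)" for t \<kappa>
    have D: "parallel_along \<A> F \<gamma> D"
      using parallel_lincomb[OF Z(1) parallel_lincomb[OF X(1) Y(1)]] unfolding D_def[abs_def] .
    have "D 0 = (\<lambda>\<kappa>. 0)"
      using X Y Z by (simp add: D_def fun_eq_iff)
    then have "F (\<gamma> 1) (D 1) = 0"
      using parallel_norm[OF lb arc D] F_zero smooth_arc_points[OF arc, of 0] by simp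
    then have "D 1 = (\<lambda>\<kappa>. 0)"
      using D smooth_arc_points[OF arc, of 1] by (intro F_eq_0) (auto simp: parallel_along_def)
    then have 0: "D 1 \<kappa> = 0" for \<kappa> by (rule fun_cong)
    show ?thesis
    proof
      show "Q ?w \<kappa> = a *\<^sub>R Q u \<kappa> + b *\<^sub>R Q v \<kappa>" for \<kappa>
        using 0[of \<kappa>] by (simp only: D_def scaleR_one scaleR_minus1_left add_uminus_conv_diff right_minus_eq X Y Z)
    qed
  qed
  ultimately show ?thesis
    unfolding linear_isometry_def by blast
qed

lemma piecewise_transport_isometry:
  assumes lb: "locally_berwald"
  shows "piecewise_transport \<A> F x y P \<Longrightarrow> linear_isometry x y P"
proof (induction rule: piecewise_transport.induct)
  case trivial_path
  show ?case
    unfolding linear_isometry_def by (simp add: tangent_lincomb)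
next
  case (append_arc \<gamma> P Q)
  note P = append_arc.IH
  note Q = parallel_transport_isometry[OF lb append_arc.hyps(2,3)]
  have PT: "P v \<in> tangent_space \<A> (\<gamma> 0)" if "v \<in> tangent_space \<A> x" for v
    using P that unfolding linear_isometry_def by blast
  show ?case
    unfolding linear_isometry_def
  proof (intro conjI ballI allI)
    show "compose (tangent_space \<A> x) Q P \<in> tangent_space \<A> x \<rightarrow> tangent_space \<A> (\<gamma> 1)"
      using Q PT unfolding linear_isometry_def by (auto simp: compose_eq)
    show "F (\<gamma> 1) (compose (tangent_space \<A> x) Q P v) = F x v" if "v \<in> tangent_space \<A> x" for v
      using P Q PT that unfolding linear_isometry_def by (simp add: compose_eq)
    show "compose (tangent_space \<A> x) Q P (\<lambda>\<kappa>. a *\<^sub>R u \<kappa> + b *\<^sub>R v \<kappa>) =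
        (\<lambda>\<kappa>. a *\<^sub>R compose (tangent_space \<A> x) Q P u \<kappa> + b *\<^sub>R compose (tangent_space \<A> x) Q P v \<kappa>)"
      if "u \<in> tangent_space \<A> x" "v \<in> tangent_space \<A> x" for u v a b
      using P Q PT that tangent_lincomb[OF that, of a b] unfolding linear_isometry_def
      by (simp add: compose_eq)
  qed
qed

end

section \<open>A Riemannian metric invariant under the isometries of F\<close>

text \<open>A box, not a ball, because parameter integrals are differentiated over boxes.\<close>

definition supp_box :: "real \<Rightarrow> 'a::euclidean_space set" where
  "supp_box R = cbox (- (R *\<^sub>R One)) (R *\<^sub>R One)"

lemma supp_boxI: "norm y \<le> R \<Longrightarrow> y \<in> supp_box R"
  unfolding supp_box_def mem_box
  by (auto simp: inner_simps) (meson Basis_le_norm abs_le_D1 abs_le_D2 minus_le_iff order_trans)+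

text \<open>Two integrals are in use: the Lebesgue integral for linear substitutions and the gauge
  integral over a fixed box for differentiation in a parameter. On continuous functions of compact
  support they agree.\<close>

lemma
  fixes g :: "'a::euclidean_space \<Rightarrow> real"
  assumes g: "continuous_on UNIV g" and R: "\<And>y. R < norm y \<Longrightarrow> g y = 0"
  shows integrable_compact_support: "integrable lborel g"
    and integral_compact_support: "integral UNIV g = (LINT y|lborel. g y)"
    and integrable_on_compact_support: "g integrable_on UNIV"
    and integral_supp_box: "integral UNIV g = integral (supp_box R) g"
    and integral_pos_compact_support: "(\<And>y. 0 \<le> g y) \<Longrightarrow> g y0 \<noteq> 0 \<Longrightarrow> 0 < integral UNIV g"
proof -
  have out: "g y = 0" if "y \<notin> supp_box R" for y
    using R[of y] supp_boxI[of y R] that by fastforce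
  have "integrable lborel (\<lambda>y. indicator (supp_box R) y *\<^sub>R g y)"
    unfolding supp_box_def by (intro borel_integrable_compact continuous_on_subset[OF g]) auto
  moreover have "(\<lambda>y. indicator (supp_box R) y *\<^sub>R g y) = g"
    using out by (auto simp: indicator_def fun_eq_iff)
  ultimately show int: "integrable lborel g" by simp
  from has_integral_integral_lborel[OF this]
  show "integral UNIV g = (LINT y|lborel. g y)" "g integrable_on UNIV"
    by (auto simp: integral_unique integrable_on_def)
  have gb: "(g has_integral integral (supp_box R) g) (supp_box R)"
    unfolding supp_box_def by (intro integrable_integral integrable_continuous continuous_on_subset[OF g]) auto
  from has_integral_on_superset[OF this out]
  show eq: "integral UNIV g = integral (supp_box R) g"
    by (intro integral_unique) auto
  assume nonneg: "\<And>y. 0 \<le> g y" and y0: "g y0 \<noteq> 0"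
  have "norm y0 \<le> R" using R y0 not_le by blast
  \<comment> \<open>The box must have interior points. For \<open>R = 0\<close> the open set where
    \<open>g\<close> is nonzero would be the single point 0.\<close>
  moreover have "R \<noteq> 0"
  proof
    assume "R = 0"
    have "open {y. g y \<noteq> 0}"
      by (intro open_Collect_neq g continuous_on_const)
    moreover have "{y. g y \<noteq> 0} = {0}"
      using R y0 \<open>R = 0\<close> by (metis (mono_tags, lifting) Collect_cong norm_le_zero_iff not_le singleton_conv)
    ultimately show False by (simp add: not_open_singleton)
  qed
  ultimately have "R > 0" using norm_ge_zero[of y0] by linarith
  have "integral (supp_box R) g \<noteq> 0"
  proof
    assume "integral (supp_box R) g = 0"
    then have "(g has_integral 0) (cbox (- (R *\<^sub>R One)) (R *\<^sub>R One))"
      using gb by (simp add: supp_box_def)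
    from has_integral_0_cbox_imp_0[OF continuous_on_subset[OF g] nonneg this, of y0]
    show False
      using supp_boxI[OF \<open>norm y0 \<le> R\<close>] y0 \<open>R > 0\<close> by (auto simp: supp_box_def box_ne_empty inner_simps)
  qed
  moreover have "0 \<le> integral (supp_box R) g"
    by (rule has_integral_nonneg[OF gb nonneg])
  ultimately show "0 < integral UNIV g" using eq by simp
qed

section \<open>Normalised Dirichlet forms\<close>

definition weight :: "('a::euclidean_space \<Rightarrow> real) \<Rightarrow> real \<Rightarrow> bool" where
  "weight f R \<longleftrightarrow> C_on 1 UNIV f \<and> (\<forall>y. 0 \<le> f y) \<and> (\<forall>y. R < norm y \<longrightarrow> f y = 0) \<and> (\<exists>y. f y \<noteq> 0)"

text \<open>The polarised Dirichlet energy of \<open>f\<close>, divided by its integral so that the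
  volume factor of a linear substitution cancels.\<close>

definition dirichlet :: "('a::euclidean_space \<Rightarrow> real) \<Rightarrow> 'a \<Rightarrow> 'a \<Rightarrow> real" where
  "dirichlet f a b = integral UNIV (\<lambda>y. frechet_derivative f (at y) a * frechet_derivative f (at y) b) / integral UNIV f"

lemma dirichlet_sym: "dirichlet f a b = dirichlet f b a"
  by (simp add: dirichlet_def mult.commute)

context
  fixes f :: "'a::euclidean_space \<Rightarrow> real" and R :: real
  assumes f: "weight f R"
begin

lemma weight_has_derivative: "(f has_derivative frechet_derivative f (at y)) (at y)"
  using f by (auto simp: weight_def intro!: C_on_has_derivative[of 0 UNIV])

lemma weight_derivative_continuous: "continuous_on UNIV (\<lambda>y. frechet_derivative f (at y) a)"
  using f by (simp add: weight_def)

lemma weight_derivative_outside: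
  assumes "R < norm y"
  shows "frechet_derivative f (at y) a = 0"
proof -
  have "open {y :: 'a. R < norm y}"
    by (intro open_Collect_less continuous_intros)
  from has_derivative_transform_within_open[OF has_derivative_const this, of y "0::real" f]
  have "(f has_derivative (\<lambda>_. 0)) (at y)"
    using assms f by (simp add: weight_def)
  then show ?thesis by (simp add: frechet_derivative_eqI)
qed

lemma dirichlet_integrand:
  "continuous_on UNIV (\<lambda>y. frechet_derivative f (at y) a * frechet_derivative f (at y) b)"
  "R < norm y \<Longrightarrow> frechet_derivative f (at y) a * frechet_derivative f (at y) b = 0"
  by (auto intro!: continuous_intros weight_derivative_continuous simp: weight_derivative_outside)

lemma weight_continuous: "continuous_on UNIV f"
  using f C_on_continuous unfolding weight_def by blast

lemma weight_outside: "R < norm y \<Longrightarrow> f y = 0"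
  using f unfolding weight_def by blast

lemma weight_integral_pos: "0 < integral UNIV f"
  using f integral_pos_compact_support[OF weight_continuous weight_outside]
  unfolding weight_def by blast

lemma dirichlet_lincomb: "dirichlet f (s *\<^sub>R a + t *\<^sub>R b) c = s * dirichlet f a c + t * dirichlet f b c"
proof -
  have lin: "frechet_derivative f (at y) (s *\<^sub>R a + t *\<^sub>R b) =
      s * frechet_derivative f (at y) a + t * frechet_derivative f (at y) b" for y
    using has_derivative_linear[OF weight_has_derivative] by (simp add: linear_add linear_cmul)
  have int: "(\<lambda>y. frechet_derivative f (at y) a * frechet_derivative f (at y) b) integrable_on UNIV" for a b
    by (rule integrable_on_compact_support[OF dirichlet_integrand])
  have "integral UNIV (\<lambda>y. frechet_derivative f (at y) (s *\<^sub>R a + t *\<^sub>R b) * frechet_derivative f (at y) c) =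
      integral UNIV (\<lambda>y. s * (frechet_derivative f (at y) a * frechet_derivative f (at y) c) +
        t * (frechet_derivative f (at y) b * frechet_derivative f (at y) c))"
    by (simp add: lin algebra_simps)
  also have "\<dots> = s * integral UNIV (\<lambda>y. frechet_derivative f (at y) a * frechet_derivative f (at y) c) +
        t * integral UNIV (\<lambda>y. frechet_derivative f (at y) b * frechet_derivative f (at y) c)"
    using int by (simp add: Henstock_Kurzweil_Integration.integral_add integrable_on_mult_right)
  finally show ?thesis by (simp add: dirichlet_def add_divide_distrib)
qed

text \<open>If the form vanished on \<open>a\<close>, then \<open>f\<close> would be constant in the direction \<open>a\<close>, against its
  compact support.\<close>

lemma dirichlet_pos:
  assumes a: "a \<noteq> 0"
  shows "0 < dirichlet f a a"
proof -
  obtain y0 where y0: "f y0 \<noteq> 0" using f by (auto simp: weight_def)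
  have "\<exists>y. frechet_derivative f (at y) a \<noteq> 0"
  proof (rule ccontr)
    assume "\<not> ?thesis"
    then have 0: "frechet_derivative f (at y) a = 0" for y by blast
    have "((\<lambda>t. f (y0 + t *\<^sub>R a)) has_derivative (\<lambda>h. 0)) (at t within UNIV)" for t
    proof -
      have "((\<lambda>t. y0 + t *\<^sub>R a) has_derivative (\<lambda>h. h *\<^sub>R a)) (at t)"
        by (rule has_derivative_eq_rhs, (rule derivative_intros)+) simp
      from has_derivative_compose[OF this weight_has_derivative]
      show ?thesis
        using 0 linear_cmul[OF has_derivative_linear[OF weight_has_derivative]] by simp
    qed
    then obtain c where c: "\<And>t. f (y0 + t *\<^sub>R a) = c"
      using has_derivative_zero_constant[OF convex_UNIV, of "\<lambda>t. f (y0 + t *\<^sub>R a)"] by blast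
    define t where "t = (\<bar>R\<bar> + norm y0 + 1) / norm a"
    have "norm (t *\<^sub>R a) = \<bar>R\<bar> + norm y0 + 1"
      using a by (simp add: t_def)
    then have "R < norm (y0 + t *\<^sub>R a)"
      using norm_diff_ineq[of "t *\<^sub>R a" y0] by (simp add: add.commute)
    then have "f (y0 + t *\<^sub>R a) = 0" by (rule weight_outside)
    with c[of t] c[of 0] y0 show False by simp
  qed
  then obtain y where "frechet_derivative f (at y) a \<noteq> 0" by blast
  then have "0 < integral UNIV (\<lambda>y. frechet_derivative f (at y) a * frechet_derivative f (at y) a)"
    by (intro integral_pos_compact_support[OF dirichlet_integrand]) auto
  then show ?thesis
    using weight_integral_pos by (simp add: dirichlet_def)
qed

lemma bounded_bilinear_dirichlet: "bounded_bilinear (dirichlet f)"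
proof -
  have scale: "dirichlet f (s *\<^sub>R a) b = s * dirichlet f a b" for s a b
    using dirichlet_lincomb[of s a 0 a b] by simp
  have add: "dirichlet f (a + b) c = dirichlet f a c + dirichlet f b c" for a b c
    using dirichlet_lincomb[of 1 a 1 b c] by simp
  have scale': "dirichlet f b (s *\<^sub>R a) = s * dirichlet f b a" for s a b
    by (simp add: dirichlet_sym[of f b] scale)
  have add': "dirichlet f c (a + b) = dirichlet f c a + dirichlet f c b" for a b c
    by (simp add: dirichlet_sym[of f c] add)
  have "bilinear (dirichlet f)"
    unfolding bilinear_def
    by (intro conjI allI linearI) (simp_all add: add scale add' scale')
  then show ?thesis
    by (simp only: bilinear_conv_bounded_bilinear)
qed

text \<open>The form has a positive minimum on the unit sphere, and homogeneity of degree 2 does the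
  rest. This bound determines how far the metric must be scaled to exceed F.\<close>

lemma dirichlet_coercive: "\<exists>q>0. \<forall>y. q * (norm y)\<^sup>2 \<le> dirichlet f y y"
proof -
  interpret bounded_bilinear "dirichlet f" by (rule bounded_bilinear_dirichlet)
  have cont: "continuous_on (sphere 0 1) (\<lambda>y. dirichlet f y y)"
    by (rule continuous_on[OF continuous_on_id continuous_on_id])
  obtain b :: 'a where b: "b \<in> Basis" using nonempty_Basis by blast
  have "compact (sphere (0::'a) 1)" "sphere (0::'a) 1 \<noteq> {}"
    using norm_Basis[OF b] by (simp_all del: sphere_eq_empty) (metis dist_0_norm empty_iff mem_sphere)
  from continuous_attains_inf[OF this cont] obtain z :: 'a where z: "norm z = 1"
    and min: "\<And>y. norm y = 1 \<Longrightarrow> dirichlet f z z \<le> dirichlet f y y"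
    by auto
  have "dirichlet f z z * (norm y)\<^sup>2 \<le> dirichlet f y y" for y
  proof (cases "y = 0")
    case True
    then show ?thesis by (simp add: zero_left)
  next
    case False
    have "dirichlet f y y = dirichlet f (norm y *\<^sub>R sgn y) (norm y *\<^sub>R sgn y)"
      using False by (simp add: sgn_div_norm)
    also have "\<dots> = (norm y)\<^sup>2 * dirichlet f (sgn y) (sgn y)"
      by (simp only: scaleR_left scaleR_right real_scaleR_def mult.assoc power2_eq_square)
    finally show ?thesis
      using min[of "sgn y"] False by (simp add: norm_sgn mult.commute mult_right_mono)
  qed
  moreover have "0 < dirichlet f z z" using z by (intro dirichlet_pos) auto
  ultimately show ?thesis by blast
qed

end

text \<open>By the chain rule the integrand on the left is the one on the right at
  \<open>J y\<close>, so numerator and denominator change by the same factor. \<open>J\<close> will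
  be a change of chart on one occasion and the coordinate form of an isometry on the other.\<close>

lemma dirichlet_linear_comp:
  fixes J :: "'b::euclidean_space \<Rightarrow> 'a::euclidean_space"
  assumes f: "weight f R" and fJ: "weight (\<lambda>y. f (J y)) R'" and J: "linear J" "surj J"
  shows "dirichlet (\<lambda>y. f (J y)) a b = dirichlet f (J a) (J b)"
proof -
  have "frechet_derivative (\<lambda>y. f (J y)) (at y) a = frechet_derivative f (at (J y)) (J a)" for y a
    using frechet_derivative_eqI[OF has_derivative_compose[OF linear_imp_has_derivative[OF J(1)] weight_has_derivative[OF f]]]
    by simp
  note D = this
  let ?g = "\<lambda>y. frechet_derivative f (at y) (J a) * frechet_derivative f (at y) (J b)"
  have gJ: "continuous_on UNIV (\<lambda>y. ?g (J y))"
    using dirichlet_integrand(1)[OF fJ, of a b] by (simp only: D)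
  have gJ': "?g (J y) = 0" if "R' < norm y" for y
    using dirichlet_integrand(2)[OF fJ that, of a b] by (simp only: D)
  have "(LINT x|lborel. f x) * (LINT y|lborel. ?g (J y)) = (LINT y|lborel. f (J y)) * (LINT x|lborel. ?g x)"
    by (rule lebesgue_integral_linear_proportional[OF J])
      (use f in \<open>auto simp: weight_def
        intro: integrable_compact_support[OF weight_continuous[OF f] weight_outside[OF f]]
          integrable_compact_support[OF weight_continuous[OF fJ] weight_outside[OF fJ]]
          integrable_compact_support[OF dirichlet_integrand[OF f]] integrable_compact_support[OF gJ gJ']\<close>)
  then have "integral UNIV f * integral UNIV (\<lambda>y. ?g (J y)) = integral UNIV (\<lambda>y. f (J y)) * integral UNIV ?g"
    by (simp add: integral_compact_support[OF weight_continuous[OF f] weight_outside[OF f]]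
        integral_compact_support[OF weight_continuous[OF fJ] weight_outside[OF fJ]]
        integral_compact_support[OF dirichlet_integrand[OF f]] integral_compact_support[OF gJ gJ'])
  then show ?thesis
    using weight_integral_pos[OF f] weight_integral_pos[OF fJ]
    by (simp add: dirichlet_def D field_simps)
qed

section \<open>Smooth dependence on the base point\<close>

context local_finsler
begin

text \<open>Near a point of the zero section the upper bound in \<open>L_bounds\<close> keeps
  \<open>L\<close> below 1, where \<open>bump\<close> vanishes; elsewhere this is a composite of
  smooth maps.\<close>

lemma C_on_bump_L: "C_on k (U \<times> UNIV) (\<lambda>z. bump (L z))"
proof (rule C_on_locally)
  fix z assume z: "z \<in> U \<times> (UNIV :: (real^'n) set)"
  obtain p y where py: "z = (p, y)" "p \<in> U" using z by auto
  show "\<exists>V. open V \<and> z \<in> V \<and> C_on k V (\<lambda>z. bump (L z))"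
  proof (cases "y = 0")
    case False
    have "C_on k slit (\<lambda>z. bump (L z))"
      by (rule C_on_compose[OF open_slit open_UNIV C_on_bump])
        (use smooth_on_C_on[OF smooth_L] in \<open>auto simp: slit_def\<close>)
    then show ?thesis
      using open_slit py False by (intro exI[of _ slit]) (auto simp: slit_def)
  next
    case True
    obtain r c C where r: "0 < r" "0 < c" "0 < C" "ball p r \<subseteq> U"
      and b: "\<forall>q\<in>ball p r. \<forall>y. c * norm y \<le> L (q, y) \<and> L (q, y) \<le> C * norm y"
      using L_bounds[OF py(2)] by (elim exE conjE)
    let ?V = "ball p r \<times> ball (0::real^'n) (1 / C)"
    have op: "open ?V" by (intro open_Times) auto
    have "bump (L w) = 0" if w: "w \<in> ?V" for w
    proof -
      obtain q v where w': "w = (q, v)" "q \<in> ball p r" "norm v < 1 / C" using w by auto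
      have "L (q, v) \<le> C * norm v" using b w' by blast
      also have "\<dots> < 1" using w'(3) r by (simp add: field_simps)
      finally show ?thesis by (simp add: w' bump_eq_0)
    qed
    then have "C_on k ?V (\<lambda>z. bump (L z))"
      using C_on_cong[OF op, of "\<lambda>z. bump (L z)" "\<lambda>_. 0"] C_on_const by blast
    then show ?thesis
      using op py True r by (intro exI[of _ ?V]) auto
  qed
qed

lemma weight_bump_L:
  assumes p: "p \<in> U" and c: "0 < c" "\<And>y. c * norm y \<le> L (p, y)"
  shows "weight (\<lambda>y. bump (L (p, y))) (2 / c)"
  unfolding weight_def
proof (intro conjI allI impI)
  have "open (U \<times> (UNIV :: (real^'n) set))" by (intro open_Times open_U open_UNIV)
  then show "C_on 1 UNIV (\<lambda>y. bump (L (p, y)))"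
    by (rule C_on_compose[OF open_UNIV _ C_on_bump_L C_on_Pair[OF open_UNIV C_on_const C_on_ident[OF open_UNIV]]])
      (use p in auto)
  show "0 \<le> bump (L (p, y))" for y by (rule bump_nonneg)
  show "bump (L (p, y)) = 0" if "2 / c < norm y" for y
  proof -
    have "2 < c * norm y" using that c(1) by (simp add: field_simps)
    then show ?thesis using c(2)[of y] by (simp add: bump_eq_0)
  qed
  define e where "e = (axis undefined 1 :: real^'n)"
  have "e \<noteq> 0" by (simp add: e_def axis_eq_0_iff)
  then have pos: "0 < L (p, e)" by (rule L_pos[OF p])
  \<comment> \<open>Rescaled to the level 3/2, inside the interval (1, 2) on which
    \<open>bump\<close> is positive.\<close>
  then have "L (p, (3 / 2 / L (p, e)) *\<^sub>R e) = 3 / 2"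
    using hom_L[OF p, of "3 / 2 / L (p, e)" e] by simp
  then show "\<exists>y. bump (L (p, y)) \<noteq> 0"
    by (intro exI[of _ "(3 / 2 / L (p, e)) *\<^sub>R e"]) (simp add: bump_eq_0)
qed

lemma weight_bump_L': "p \<in> U \<Longrightarrow> \<exists>R. weight (\<lambda>y. bump (L (p, y))) R"
proof -
  assume p: "p \<in> U"
  obtain r c C where r: "0 < r" "0 < c"
    and b: "\<forall>q\<in>ball p r. \<forall>y. c * norm y \<le> L (q, y) \<and> L (q, y) \<le> C * norm y"
    using L_bounds[OF p] by (elim exE conjE)
  have "c * norm y \<le> L (p, y)" for y using b r(1) by simp
  from weight_bump_L[OF p r(2) this] show ?thesis by blast
qed

text \<open>A lower bound for L uniform near \<open>p\<close> puts the supports in one box, so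
  numerator and denominator are parameter integrals over a fixed domain.\<close>

lemma smooth_dirichlet: "smooth_on U (\<lambda>p. dirichlet (\<lambda>y. bump (L (p, y))) a b)"
  unfolding smooth_on_def
proof (intro allI C_on_locally)
  fix k p assume p: "p \<in> U"
  obtain r c C where r: "0 < r" "0 < c" "ball p r \<subseteq> U"
    and b: "\<forall>q\<in>ball p r. \<forall>y. c * norm y \<le> L (q, y) \<and> L (q, y) \<le> C * norm y"
    using L_bounds[OF p] by (elim exE conjE)
  let ?\<Phi> = "\<lambda>z. bump (L z)" and ?B = "ball p r"
  have open_B: "open (?B \<times> (UNIV :: (real^'n) set))" by (intro open_Times) auto
  have \<Phi>: "C_on k (?B \<times> UNIV) ?\<Phi>" for k
    by (rule C_on_subset[OF C_on_bump_L]) (use r in auto)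
  have w: "weight (\<lambda>y. ?\<Phi> (q, y)) (2 / c)" if "q \<in> ?B" for q
    using that r b by (intro weight_bump_L) auto
  \<comment> \<open>The fibre derivative is a partial derivative of one function on the product; its
    joint regularity in base point and fibre can then be used.\<close>
  have D: "frechet_derivative (\<lambda>y. ?\<Phi> (q, y)) (at y) v = frechet_derivative ?\<Phi> (at (q, y)) (0, v)"
    if q: "q \<in> ?B" for q y v
  proof -
    have "((\<lambda>y. (q, y)) has_derivative (\<lambda>v. (0, v))) (at y)"
      by (rule has_derivative_eq_rhs, (rule derivative_intros)+) simp
    from has_derivative_compose[OF this, of ?\<Phi> "frechet_derivative ?\<Phi> (at (q, y))"]
      C_on_has_derivative[OF \<Phi>[of "Suc 0"], of "(q, y)"] q
    have "((\<lambda>y. ?\<Phi> (q, y)) has_derivative (\<lambda>v. frechet_derivative ?\<Phi> (at (q, y)) (0, v))) (at y)"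
      by simp
    then show ?thesis by (simp add: frechet_derivative_eqI)
  qed
  let ?box = "supp_box (2 / c) :: (real^'n) set"
  have eq: "dirichlet (\<lambda>y. ?\<Phi> (q, y)) a b =
      integral ?box (\<lambda>y. frechet_derivative ?\<Phi> (at (q, y)) (0, a) * frechet_derivative ?\<Phi> (at (q, y)) (0, b)) /
      integral ?box (\<lambda>y. ?\<Phi> (q, y))" if q: "q \<in> ?B" for q
    using integral_supp_box[OF dirichlet_integrand(1)[OF w[OF q], of a b] dirichlet_integrand(2)[OF w[OF q], of _ a b]]
      integral_supp_box[OF weight_continuous[OF w[OF q]] weight_outside[OF w[OF q]]]
    by (simp add: dirichlet_def D[OF q])
  have "C_on k ?B (\<lambda>q. integral ?box (\<lambda>y. frechet_derivative ?\<Phi> (at (q, y)) (0, a) * frechet_derivative ?\<Phi> (at (q, y)) (0, b)) /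
      integral ?box (\<lambda>y. ?\<Phi> (q, y)))"
  proof (rule C_on_divide)
    show "C_on k ?B (\<lambda>q. integral ?box (\<lambda>y. frechet_derivative ?\<Phi> (at (q, y)) (0, a) * frechet_derivative ?\<Phi> (at (q, y)) (0, b)))"
      unfolding supp_box_def
      by (rule C_on_integral[OF open_ball, where G = "\<lambda>z. frechet_derivative ?\<Phi> (at z) (0, a) * frechet_derivative ?\<Phi> (at z) (0, b)"])
        (intro C_on_mult open_B C_on_frechet \<Phi>)
    show "C_on k ?B (\<lambda>q. integral ?box (\<lambda>y. ?\<Phi> (q, y)))"
      unfolding supp_box_def by (rule C_on_integral[OF open_ball \<Phi>])
    show "0 < integral ?box (\<lambda>y. ?\<Phi> (q, y))" if "q \<in> ?B" for q
      using weight_integral_pos[OF w[OF that]]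
        integral_supp_box[OF weight_continuous[OF w[OF that]] weight_outside[OF w[OF that]]] by simp
  qed simp
  then have "C_on k ?B (\<lambda>q. dirichlet (\<lambda>y. ?\<Phi> (q, y)) a b)"
    using C_on_cong[where f = "\<lambda>q. dirichlet (\<lambda>y. ?\<Phi> (q, y)) a b", OF open_ball eq] by blast
  then show "\<exists>V. open V \<and> p \<in> V \<and> C_on k V (\<lambda>p. dirichlet (\<lambda>y. bump (L (p, y))) a b)"
    using r(1) by (intro exI[of _ ?B]) simp
qed

end

section \<open>The metric on the manifold\<close>

context finsler_manifold
begin

definition bumpF where
  "bumpF x \<kappa> y = bump (F x (tvec_of \<A> \<kappa> x y))"

text \<open>Some chart has to be picked to evaluate the form; by
  \<open>dirichlet_linear_comp\<close> every chart at \<open>x\<close> gives the same value. The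
  factor \<open>c\<close> leaves room for scaling.\<close>

definition averaged_metric where
  "averaged_metric c x u v = (let \<kappa> = SOME \<kappa>. \<kappa> \<in> charts_at \<A> x in c * dirichlet (bumpF x \<kappa>) (u \<kappa>) (v \<kappa>))"

lemma bumpF_Lrep: "\<kappa> \<in> charts_at \<A> x \<Longrightarrow> bumpF x \<kappa> = (\<lambda>y. bump (Lrep \<kappa> (snd \<kappa> x, y)))"
  by (simp add: bumpF_def fun_eq_iff Lrep_at)

lemma weight_bumpF: "\<kappa> \<in> charts_at \<A> x \<Longrightarrow> \<exists>R. weight (bumpF x \<kappa>) R"
  unfolding bumpF_Lrep
  by (rule local_finsler.weight_bump_L'[OF local_finsler]) (auto dest: charts_atD)

lemma surj_jac: "\<kappa> \<in> charts_at \<A> x \<Longrightarrow> \<kappa>' \<in> charts_at \<A> x \<Longrightarrow> surj (jac x \<kappa> \<kappa>')"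
  by (rule surjI[of _ "jac x \<kappa>' \<kappa>"]) (simp add: jac_comp jac_id)

lemma averaged_metric_eq:
  assumes \<kappa>: "\<kappa> \<in> charts_at \<A> x" and uv: "u \<in> tangent_space \<A> x" "v \<in> tangent_space \<A> x"
  shows "averaged_metric c x u v = c * dirichlet (bumpF x \<kappa>) (u \<kappa>) (v \<kappa>)"
proof -
  define \<kappa>' where "\<kappa>' = (SOME \<kappa>. \<kappa> \<in> charts_at \<A> x)"
  have \<kappa>': "\<kappa>' \<in> charts_at \<A> x" unfolding \<kappa>'_def using \<kappa> by (rule someI)
  let ?J = "jac x \<kappa> \<kappa>'"
  have eq: "bumpF x \<kappa> = (\<lambda>y. bumpF x \<kappa>' (?J y))"
    by (rule ext) (simp add: bumpF_def tvec_of_change[OF \<kappa> \<kappa>'])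
  obtain R R' where "weight (bumpF x \<kappa>') R" "weight (\<lambda>y. bumpF x \<kappa>' (?J y)) R'"
    using weight_bumpF[OF \<kappa>] weight_bumpF[OF \<kappa>'] eq by auto
  from dirichlet_linear_comp[OF this linear_jac[OF \<kappa> \<kappa>'] surj_jac[OF \<kappa> \<kappa>'], of "u \<kappa>" "v \<kappa>"]
  have "dirichlet (bumpF x \<kappa>) (u \<kappa>) (v \<kappa>) = dirichlet (bumpF x \<kappa>') (u \<kappa>') (v \<kappa>')"
    using tangent_jac[OF uv(1) \<kappa> \<kappa>'] tangent_jac[OF uv(2) \<kappa> \<kappa>'] eq by simp
  then show ?thesis
    by (simp add: averaged_metric_def \<kappa>'_def[symmetric])
qed

lemma riemannian_averaged_metric:
  assumes c: "0 < c"
  shows "riemannian_metric \<A> (averaged_metric c)"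
  unfolding riemannian_metric_def
proof (intro conjI ballI allI impI)
  fix x u v assume x: "x \<in> points \<A>" and u: "u \<in> tangent_space \<A> x" and v: "v \<in> tangent_space \<A> x"
  obtain \<kappa> where \<kappa>: "\<kappa> \<in> charts_at \<A> x" using x points_charts_at by blast
  obtain R where R: "weight (bumpF x \<kappa>) R" using weight_bumpF[OF \<kappa>] by blast
  show "averaged_metric c x u v = averaged_metric c x v u"
    using averaged_metric_eq[OF \<kappa> u v, of c] averaged_metric_eq[OF \<kappa> v u, of c] dirichlet_sym by metis
  show "averaged_metric c x (\<lambda>\<kappa>. a *\<^sub>R u \<kappa> + b *\<^sub>R v \<kappa>) w = a * averaged_metric c x u w + b * averaged_metric c x v w"
    if w: "w \<in> tangent_space \<A> x" for w a b
    by (simp add: averaged_metric_eq[OF \<kappa> tangent_lincomb[OF u v] w] averaged_metric_eq[OF \<kappa> u w]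
        averaged_metric_eq[OF \<kappa> v w] dirichlet_lincomb[OF R] algebra_simps)
next
  fix x v assume x: "x \<in> points \<A>" and v: "v \<in> tangent_space \<A> x" and nz: "v \<noteq> (\<lambda>\<kappa>. 0)"
  obtain \<kappa> where \<kappa>: "\<kappa> \<in> charts_at \<A> x" using x points_charts_at by blast
  obtain R where R: "weight (bumpF x \<kappa>) R" using weight_bumpF[OF \<kappa>] by blast
  have "v \<kappa> \<noteq> 0" using tangent_eqI[OF v zero_tangent \<kappa>] nz by auto
  then show "0 < averaged_metric c x v v"
    using c dirichlet_pos[OF R] by (simp add: averaged_metric_eq[OF \<kappa> v v])
next
  fix \<kappa> i j assume \<kappa>: "\<kappa> \<in> \<A>"
  interpret local_finsler "Lrep \<kappa>" "snd \<kappa> ` fst \<kappa>" by (rule local_finsler[OF \<kappa>])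
  let ?f = "\<lambda>p. averaged_metric c (chart_inv \<kappa> p) (tvec_of \<A> \<kappa> (chart_inv \<kappa> p) (axis i 1)) (tvec_of \<A> \<kappa> (chart_inv \<kappa> p) (axis j 1))"
  have eq: "?f p = c * dirichlet (\<lambda>y. bump (Lrep \<kappa> (p, y))) (axis i 1) (axis j 1)" if p: "p \<in> snd \<kappa> ` fst \<kappa>" for p
  proof -
    have k: "\<kappa> \<in> charts_at \<A> (chart_inv \<kappa> p)" by (rule charts_at_inv[OF \<kappa> p])
    show ?thesis
      by (simp add: averaged_metric_eq[OF k tvec_of_tangent[OF k] tvec_of_tangent[OF k]] tvec_of_self[OF k]
          bumpF_Lrep[OF k] chart_inv_right[OF p])
  qed
  have "smooth_on (snd \<kappa> ` fst \<kappa>) (\<lambda>p. c * dirichlet (\<lambda>y. bump (Lrep \<kappa> (p, y))) (axis i 1) (axis j 1))"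
    by (intro smooth_on_mult open_U smooth_on_const smooth_dirichlet)
  then show "smooth_on (snd \<kappa> ` fst \<kappa>) ?f"
    unfolding smooth_on_def using C_on_cong[where f = ?f, OF open_U eq] by blast
qed

text \<open>In coordinates \<open>P\<close> is a linear map that leaves \<open>bumpF\<close>
  unchanged, so the transformation rule of \<open>dirichlet\<close> yields invariance. The map is
  injective because F vanishes only at the zero vector, hence onto by dimension.\<close>

lemma isometry_averaged_metric:
  assumes P: "linear_isometry x x P" and x: "x \<in> points \<A>"
    and uv: "u \<in> tangent_space \<A> x" "v \<in> tangent_space \<A> x"
  shows "averaged_metric c x (P u) (P v) = averaged_metric c x u v"
proof -
  obtain \<kappa> where \<kappa>: "\<kappa> \<in> charts_at \<A> x" using x points_charts_at by blast
  have PT: "P v \<in> tangent_space \<A> x" if "v \<in> tangent_space \<A> x" for v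
    using P that unfolding linear_isometry_def by blast
  have PF: "F x (P v) = F x v" if "v \<in> tangent_space \<A> x" for v
    using P that unfolding linear_isometry_def by blast
  have Plin: "P (\<lambda>\<kappa>. a *\<^sub>R u \<kappa> + b *\<^sub>R v \<kappa>) = (\<lambda>\<kappa>. a *\<^sub>R P u \<kappa> + b *\<^sub>R P v \<kappa>)"
    if "u \<in> tangent_space \<A> x" "v \<in> tangent_space \<A> x" for u v a b
    using P that unfolding linear_isometry_def by blast
  define J where "J y = P (tvec_of \<A> \<kappa> x y) \<kappa>" for y
  note t = tvec_of_tangent[OF \<kappa>]
  have tJ: "tvec_of \<A> \<kappa> x (J y) = P (tvec_of \<A> \<kappa> x y)" for y
    unfolding J_def by (rule tvec_of_component[OF PT[OF t] \<kappa>])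
  have lincomb: "J (a *\<^sub>R y + b *\<^sub>R z) = a *\<^sub>R J y + b *\<^sub>R J z" for a b y z
    unfolding J_def tvec_of_lincomb[OF \<kappa>] Plin[OF t t] ..
  have lin: "linear J"
    using lincomb[of 1 _ 1] lincomb[of _ _ 0 0] by (intro linearI) simp_all
  have "y = 0" if "J y = 0" for y
  proof -
    have "tvec_of \<A> \<kappa> x (0 *\<^sub>R y) = (\<lambda>\<kappa>'. 0 *\<^sub>R tvec_of \<A> \<kappa> x y \<kappa>')"
      by (rule tvec_of_scale[OF \<kappa>])
    then have t0: "tvec_of \<A> \<kappa> x 0 = (\<lambda>\<kappa>. 0)" by simp
    then have "F x (tvec_of \<A> \<kappa> x y) = 0"
      using tJ[of y] that PF[OF t, of y] F_zero[OF x] by simp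
    then have "tvec_of \<A> \<kappa> x y = (\<lambda>\<kappa>. 0)"
      by (rule F_eq_0[OF x t])
    then show ?thesis using tvec_of_self[OF \<kappa>, of y] by simp
  qed
  then have "inj J" using lin by (simp add: linear_injective_0)
  then have surj: "surj J" using lin linear_injective_imp_surjective by blast
  have eq: "(\<lambda>y. bumpF x \<kappa> (J y)) = bumpF x \<kappa>"
    by (rule ext) (simp add: bumpF_def tJ PF[OF t])
  obtain R where R: "weight (bumpF x \<kappa>) R" using weight_bumpF[OF \<kappa>] by blast
  have "weight (\<lambda>y. bumpF x \<kappa> (J y)) R" using R by (simp add: eq)
  from dirichlet_linear_comp[OF R this lin surj]
  have "dirichlet (bumpF x \<kappa>) (J (u \<kappa>)) (J (v \<kappa>)) = dirichlet (bumpF x \<kappa>) (u \<kappa>) (v \<kappa>)"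
    by (simp add: eq)
  then show ?thesis
    by (simp add: averaged_metric_eq[OF \<kappa> PT[OF uv(1)] PT[OF uv(2)]] averaged_metric_eq[OF \<kappa> uv]
        J_def tvec_of_component[OF uv(1) \<kappa>] tvec_of_component[OF uv(2) \<kappa>])
qed

end

section \<open>Shells between two indicatrices\<close>

text \<open>The properties shared by F on one tangent space and by the norm of the metric there;
  nothing is required at the origin.\<close>

definition gauge_fun :: "(real^'n::finite \<Rightarrow> real) \<Rightarrow> bool" where
  "gauge_fun N \<longleftrightarrow> smooth_on (- {0}) N \<and> (\<forall>y. y \<noteq> 0 \<longrightarrow> 0 < N y) \<and>
    (\<forall>c y. 0 < c \<longrightarrow> y \<noteq> 0 \<longrightarrow> N (c *\<^sub>R y) = c * N y)"

lemma gauge_fun_bounds: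
  assumes "gauge_fun N"
  shows "\<exists>c C. 0 < c \<and> 0 < C \<and> (\<forall>y. y \<noteq> 0 \<longrightarrow> c * norm y \<le> N y \<and> N y \<le> C * norm y)"
proof -
  let ?K = "sphere (0::real^'a) 1"
  have "axis undefined 1 \<in> ?K" by (simp add: norm_axis_1)
  then have K: "compact ?K" "?K \<noteq> {}" using compact_sphere by blast+
  have cont: "continuous_on ?K N"
    by (rule continuous_on_subset[OF smooth_on_continuous[of "- {0}"]]) (use assms in \<open>auto simp: gauge_fun_def\<close>)
  obtain z where z: "z \<in> ?K" "\<And>w. w \<in> ?K \<Longrightarrow> N z \<le> N w"
    using continuous_attains_inf[OF K cont] by blast
  obtain z' where z': "z' \<in> ?K" "\<And>w. w \<in> ?K \<Longrightarrow> N w \<le> N z'"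
    using continuous_attains_sup[OF K cont] by blast
  have "z \<noteq> 0" "z' \<noteq> 0" using z(1) z'(1) by auto
  then have pos: "0 < N z" "0 < N z'" using assms unfolding gauge_fun_def by blast+
  have "N z * norm y \<le> N y \<and> N y \<le> N z' * norm y" if y: "y \<noteq> 0" for y
  proof -
    have "N (norm y *\<^sub>R sgn y) = norm y * N (sgn y)"
      using assms y unfolding gauge_fun_def by (simp add: sgn_zero_iff)
    then have "N y = norm y * N (sgn y)"
      using y by (simp add: sgn_div_norm)
    moreover have "sgn y \<in> ?K" using y by (simp add: norm_sgn)
    then have "N z \<le> N (sgn y)" "N (sgn y) \<le> N z'" using z(2) z'(2) by blast+
    ultimately show ?thesis by (simp add: mult.commute[of _ "norm y"] mult_left_mono)
  qed
  then show ?thesis using pos by blast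
qed

text \<open>Near \<open>q\<close> with \<open>q\<^sub>m \<noteq> 0\<close> the level sets of \<open>N\<close> are flattened by the homogeneous coordinates
  \<open>y\<^sub>a / \<bar>y\<^sub>m\<bar>\<close> together with \<open>N\<close>; by homogeneity the inverse map is explicit.\<close>

lemma flatten_level_set:
  fixes N :: "real^'n::finite \<Rightarrow> real"
  assumes N: "gauge_fun N" and \<epsilon>: "\<epsilon> * \<epsilon> = 1" and G: "open G" "q \<in> G" "0 \<notin> G"
  shows "\<exists>W \<Phi> m. q \<in> W \<and> W \<subseteq> G \<and> open W \<and> open (\<Phi> ` W) \<and> inj_on \<Phi> W \<and>
     smooth_on W \<Phi> \<and> smooth_on (\<Phi> ` W) (inv_into W \<Phi>) \<and>
     (\<forall>y\<in>W. (\<Phi> y :: real^'n) $ m = \<epsilon> * (N y - 1))"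
proof -
  have smN: "smooth_on (- {0}) N" and posN: "\<And>y. y \<noteq> 0 \<Longrightarrow> 0 < N y"
    and homN: "\<And>c y. 0 < c \<Longrightarrow> y \<noteq> 0 \<Longrightarrow> N (c *\<^sub>R y) = c * N y"
    using N by (auto simp: gauge_fun_def)
  have "q \<noteq> 0" using G by blast
  then obtain m where m: "q $ m \<noteq> 0" by (auto simp: vec_eq_iff)
  define s where "s = sgn (q $ m)"
  have ss: "s * s = 1" and s0: "s \<noteq> 0" using m by (auto simp: s_def sgn_if)
  define H where "H = {y :: real^'n. 0 < s * y $ m}"
  define W where "W = G \<inter> H"
  \<comment> \<open>The sign \<epsilon> chooses the side: for 1 the half space describes N \<ge> 1,
    for -1 it describes N \<le> 1.\<close>
  define \<Phi> where "\<Phi> y = (\<chi> a. if a = m then \<epsilon> * (N y - 1) else y $ a / (s * y $ m))" for y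
  define w where "w z = (\<chi> a. if a = m then s else z $ a)" for z :: "real^'n"
  define Z where "Z = {z :: real^'n. 0 < 1 + \<epsilon> * z $ m}"
  \<comment> \<open>On each ray \<open>w z\<close> is the point whose coordinate \<open>m\<close>
    equals \<open>s\<close>; the scalar factor is fixed by the demand that N take the value
    \<open>1 + \<epsilon> * z $ m\<close>.\<close>
  define \<Psi> where "\<Psi> z = ((1 + \<epsilon> * z $ m) / N (w z)) *\<^sub>R w z" for z
  have oH: "open H" unfolding H_def by (intro open_Collect_less continuous_intros)
  have oZ: "open Z" unfolding Z_def by (intro open_Collect_less continuous_intros)
  have oW: "open W" unfolding W_def using G oH by blast
  have H0: "y \<noteq> 0" if "y \<in> H" for y using that by (auto simp: H_def)
  have w0: "w z \<noteq> 0" for z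
  proof
    assume "w z = 0"
    then have "w z $ m = 0" by simp
    then show False using s0 by (simp add: w_def)
  qed
  have \<Psi>\<Phi>: "\<Psi> (\<Phi> y) = y" if y: "y \<in> H" for y
  proof -
    let ?r = "s * y $ m"
    have r: "0 < ?r" using y by (simp add: H_def)
    have "w (\<Phi> y) = (1 / ?r) *\<^sub>R y"
      using r ss s0 by (auto simp: w_def \<Phi>_def vec_eq_iff field_simps)
    moreover have "1 + \<epsilon> * \<Phi> y $ m = N y"
      using \<epsilon> by (simp add: \<Phi>_def flip: mult.assoc)
    moreover have "N ((1 / ?r) *\<^sub>R y) = N y / ?r"
      using homN[of "1 / ?r" y] r H0[OF y] by simp
    ultimately show ?thesis
      using r posN[OF H0[OF y]] s0 by (auto simp: \<Psi>_def)
  qed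
  have \<Phi>\<Psi>: "\<Phi> (\<Psi> z) = z" if z: "z \<in> Z" for z
  proof -
    define r where "r = (1 + \<epsilon> * z $ m) / N (w z)"
    have r: "0 < r" using z posN[OF w0[of z]] by (simp add: r_def Z_def)
    have y: "\<Psi> z = r *\<^sub>R w z" by (simp add: \<Psi>_def r_def)
    have "s * \<Psi> z $ m = r" using ss by (simp add: y w_def)
    moreover have "N (\<Psi> z) = 1 + \<epsilon> * z $ m"
      unfolding y homN[OF r w0] using posN[OF w0[of z]] by (simp add: r_def)
    ultimately show ?thesis
      using r \<epsilon> by (auto simp: \<Phi>_def vec_eq_iff y w_def simp flip: mult.assoc)
  qed
  have \<Phi>Z: "\<Phi> y \<in> Z" if y: "y \<in> H" for y
    using \<epsilon> posN[OF H0[OF y]] by (simp add: Z_def \<Phi>_def flip: mult.assoc)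
  have smw: "C_on k Z w" for k
  proof (rule C_on_vec[OF oZ])
    show "C_on k Z (\<lambda>z. w z $ i)" for i
      by (cases "i = m") (simp_all add: w_def C_on_const C_on_nth[OF oZ C_on_ident[OF oZ]])
  qed
  have smNw: "C_on k Z (\<lambda>z. N (w z))" for k
    by (rule C_on_compose[OF oZ _ smooth_on_C_on[OF smN] smw]) (use w0 in auto)
  have sm\<Psi>: "C_on k Z \<Psi>" for k
    unfolding \<Psi>_def
    by (intro C_on_scaleR C_on_divide C_on_add C_on_mult C_on_const oZ smNw smw posN w0 C_on_nth C_on_ident)
  have sm\<Phi>: "C_on k H \<Phi>" for k
  proof (rule C_on_vec[OF oH])
    fix i
    show "C_on k H (\<lambda>y. \<Phi> y $ i)"
    proof (cases "i = m")
      case True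
      have "C_on k H (\<lambda>y. \<epsilon> * (N y - 1))"
        by (intro C_on_mult C_on_diff C_on_const oH C_on_subset[OF smooth_on_C_on[OF smN]]) (use H0 in auto)
      then show ?thesis using True by (simp add: \<Phi>_def)
    next
      case False
      have "C_on k H (\<lambda>y. y $ i / (s * y $ m))"
        by (intro C_on_divide C_on_mult C_on_const oH C_on_nth C_on_ident) (simp add: H_def)
      then show ?thesis using False by (simp add: \<Phi>_def)
    qed
  qed
  have WH: "W \<subseteq> H" by (auto simp: W_def)
  have inj: "inj_on \<Phi> W"
    by (rule inj_on_inverseI[of _ \<Psi>]) (use WH \<Psi>\<Phi> in blast)
  have img: "\<Phi> ` W = Z \<inter> \<Psi> -` W"
  proof
    show "\<Phi> ` W \<subseteq> Z \<inter> \<Psi> -` W" using WH \<Psi>\<Phi> \<Phi>Z by auto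
    show "Z \<inter> \<Psi> -` W \<subseteq> \<Phi> ` W"
    proof
      fix z assume "z \<in> Z \<inter> \<Psi> -` W"
      then have "z = \<Phi> (\<Psi> z)" "\<Psi> z \<in> W" using \<Phi>\<Psi> by auto
      then show "z \<in> \<Phi> ` W" by blast
    qed
  qed
  have oimg: "open (\<Phi> ` W)"
    unfolding img by (rule continuous_open_preimage[OF C_on_continuous[OF sm\<Psi>] oZ oW])
  have inv: "inv_into W \<Phi> z = \<Psi> z" if z: "z \<in> \<Phi> ` W" for z
  proof -
    obtain y where y: "y \<in> W" "z = \<Phi> y" using z by blast
    then have "\<Psi> z = y" using WH \<Psi>\<Phi> by blast
    then show ?thesis using inv_into_f_f[OF inj y(1)] y(2) by simp
  qed
  have "smooth_on (\<Phi> ` W) (inv_into W \<Phi>)"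
    unfolding smooth_on_def
  proof
    fix k
    have "C_on k (\<Phi> ` W) \<Psi>"
      by (rule C_on_subset[OF sm\<Psi>]) (simp add: img)
    then show "C_on k (\<Phi> ` W) (inv_into W \<Phi>)"
      using C_on_cong[where f = "inv_into W \<Phi>", OF oimg inv] by blast
  qed
  moreover have "smooth_on W \<Phi>"
    unfolding smooth_on_def using C_on_subset[OF sm\<Phi> WH] by blast
  moreover have "q \<in> W"
    using G m by (auto simp: W_def H_def s_def sgn_if)
  moreover have "\<forall>y\<in>W. \<Phi> y $ m = \<epsilon> * (N y - 1)"
    by (simp add: \<Phi>_def)
  ultimately show ?thesis
    using inj oimg oW by (intro exI[of _ W] exI[of _ \<Phi>] exI[of _ m]) (auto simp: W_def)
qed

lemma open_gauge_less:
  assumes "gauge_fun N"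
  shows "open {y. y \<noteq> 0 \<and> N y < c}" "open {y. y \<noteq> 0 \<and> c < N y}"
proof -
  have c: "continuous_on (- {0}) N"
    using assms smooth_on_continuous unfolding gauge_fun_def by blast
  have "open (- {0} \<inter> N -` {..<c})" "open (- {0} \<inter> N -` {c<..})"
    by (intro continuous_open_preimage[OF c] open_lessThan open_greaterThan; auto)+
  moreover have "- {0} \<inter> N -` {..<c} = {y. y \<noteq> 0 \<and> N y < c}" "- {0} \<inter> N -` {c<..} = {y. y \<noteq> 0 \<and> c < N y}"
    by auto
  ultimately show "open {y. y \<noteq> 0 \<and> N y < c}" "open {y. y \<noteq> 0 \<and> c < N y}" by simp_all
qed

text \<open>Since N1 < N2, no point lies on both level sets. Near N1 = 1 only the first inequality
  matters, near N2 = 1 only the second, elsewhere neither; so half-space and interior charts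
  suffice.\<close>

lemma shell_codim0_submanifold:
  fixes N1 N2 :: "real^'n::finite \<Rightarrow> real"
  assumes N1: "gauge_fun N1" and N2: "gauge_fun N2" and less: "\<And>y. y \<noteq> 0 \<Longrightarrow> N1 y < N2 y"
  shows "codim0_submanifold {y. y \<noteq> 0 \<and> N1 y \<le> 1 \<and> 1 \<le> N2 y}" (is "codim0_submanifold ?S")
  unfolding codim0_submanifold_def
proof
  fix q assume q: "q \<in> ?S"
  define goal where "goal W \<Phi> \<longleftrightarrow> q \<in> W \<and> open W \<and> open (\<Phi> ` W) \<and> inj_on \<Phi> W \<and>
     smooth_on W \<Phi> \<and> smooth_on (\<Phi> ` W) (inv_into W \<Phi>) \<and>
     (\<Phi> ` (?S \<inter> W) = \<Phi> ` W \<or> (\<exists>m::'n. \<Phi> ` (?S \<inter> W) = \<Phi> ` W \<inter> {z::real^'n. 0 \<le> z $ m}))"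
    for W and \<Phi> :: "real^'n \<Rightarrow> real^'n"
  have flat: "\<exists>W \<Phi>. goal W \<Phi>"
    if N: "gauge_fun N" and \<epsilon>: "\<epsilon> * \<epsilon> = 1" and G: "open G" "q \<in> G" "0 \<notin> G"
      and iff: "\<And>y. y \<in> G \<Longrightarrow> y \<in> ?S \<longleftrightarrow> 0 \<le> \<epsilon> * (N y - 1)" for N \<epsilon> G
  proof -
    obtain W m and \<Phi> :: "real^'n \<Rightarrow> real^'n" where W: "q \<in> W" "W \<subseteq> G" "open W" "open (\<Phi> ` W)" "inj_on \<Phi> W"
     "smooth_on W \<Phi>" "smooth_on (\<Phi> ` W) (inv_into W \<Phi>)" and m: "\<forall>y\<in>W. \<Phi> y $ m = \<epsilon> * (N y - 1)"
      using flatten_level_set[OF N \<epsilon> G] by (elim exE conjE)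
    have "y \<in> ?S \<longleftrightarrow> 0 \<le> \<Phi> y $ m" if "y \<in> W" for y
      using iff[of y] W(2) m that by auto
    then have "\<Phi> ` (?S \<inter> W) = \<Phi> ` W \<inter> {z. 0 \<le> z $ m}" by blast
    then show ?thesis
      unfolding goal_def using W by blast
  qed
  have q0: "q \<noteq> 0" using q by simp
  consider "N1 q = 1" | "N2 q = 1" | "N1 q < 1" "1 < N2 q"
    using q less_eq_real_def by auto
  then show "\<exists>W \<Phi>. q \<in> W \<and> open W \<and> open (\<Phi> ` W) \<and> inj_on \<Phi> W \<and>
     smooth_on W \<Phi> \<and> smooth_on (\<Phi> ` W) (inv_into W \<Phi>) \<and>
     (\<Phi> ` (?S \<inter> W) = \<Phi> ` W \<or> (\<exists>m::'n. \<Phi> ` (?S \<inter> W) = \<Phi> ` W \<inter> {z::real^'n. 0 \<le> z $ m}))"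
    unfolding goal_def[symmetric]
  proof cases
    case 1
    \<comment> \<open>Here N2 > 1 near \<open>q\<close>, so locally the shell is N1 \<le> 1, whence
      the sign -1.\<close>
    show "\<exists>W \<Phi>. goal W \<Phi>"
      by (rule flat[OF N1, of "- 1" "{y. y \<noteq> 0 \<and> 1 < N2 y}"])
        (use open_gauge_less[OF N2] q0 less[OF q0] 1 in auto)
  next
    case 2
    show "\<exists>W \<Phi>. goal W \<Phi>"
      by (rule flat[OF N2, of 1 "{y. y \<noteq> 0 \<and> N1 y < 1}"])
        (use open_gauge_less[OF N1] q0 less[OF q0] 2 in auto)
  next
    case 3
    let ?W = "{y. y \<noteq> 0 \<and> N1 y < 1} \<inter> {y. y \<noteq> 0 \<and> 1 < N2 y}"
    have oW: "open ?W" by (intro open_Int open_gauge_less N1 N2)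
    have "smooth_on ?W (\<lambda>y. y)" unfolding smooth_on_def using C_on_ident[OF oW] by blast
    moreover have inv: "inv_into ?W (\<lambda>y. y) y = y" if "y \<in> ?W" for y
      using inv_into_f_f[of "\<lambda>y. y" ?W y] that by simp
    have "smooth_on ?W (inv_into ?W (\<lambda>y. y))"
      unfolding smooth_on_def
      using C_on_cong[where f = "inv_into ?W (\<lambda>y. y)", OF oW inv] C_on_ident[OF oW] by blast
    moreover have "?S \<inter> ?W = ?W" by auto
    ultimately have "goal ?W (\<lambda>y. y)"
      unfolding goal_def using oW q0 3 by simp
    then show "\<exists>W \<Phi>. goal W \<Phi>" by blast
  qed
qed

text \<open>N1 \<le> 1 bounds the shell and 1 \<le> N2 keeps it away from the origin, where gauges
  may fail to be continuous. It is therefore closed in a compact ring on which both are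
  continuous.\<close>

lemma shell_compact:
  fixes N1 N2 :: "real^'n::finite \<Rightarrow> real"
  assumes N1: "gauge_fun N1" and N2: "gauge_fun N2"
  shows "compact {y. y \<noteq> 0 \<and> N1 y \<le> 1 \<and> 1 \<le> N2 y}" (is "compact ?S")
proof -
  obtain c where c: "0 < c" "\<And>y. y \<noteq> 0 \<Longrightarrow> c * norm y \<le> N1 y"
    using gauge_fun_bounds[OF N1] by blast
  obtain C where C: "0 < C" "\<And>y. y \<noteq> 0 \<Longrightarrow> N2 y \<le> C * norm y"
    using gauge_fun_bounds[OF N2] by blast
  define K where "K = {y :: real^'n. norm y \<le> 1 / c \<and> 1 / C \<le> norm y}"
  have "closed K" unfolding K_def by (intro closed_Collect_conj closed_Collect_le continuous_intros)
  moreover have "bounded K" by (rule boundedI[of _ "1 / c"]) (simp add: K_def)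
  ultimately have K: "compact K" by (simp add: compact_eq_bounded_closed)
  have K0: "K \<subseteq> - {0}" using C(1) by (auto simp: K_def)
  have cont: "continuous_on K N1" "continuous_on K N2"
    using N1 N2 K0 smooth_on_continuous continuous_on_subset unfolding gauge_fun_def by metis+
  have "?S \<subseteq> K"
  proof
    fix y assume "y \<in> ?S"
    then have "c * norm y \<le> 1" "1 \<le> C * norm y"
      using c(2)[of y] C(2)[of y] by auto
    then show "y \<in> K" using c(1) C(1) by (simp add: K_def field_simps)
  qed
  then have "?S = (K \<inter> N1 -` {..1}) \<inter> (K \<inter> N2 -` {1..})"
    using K0 by auto
  moreover have "closed (K \<inter> N1 -` {..1})" "closed (K \<inter> N2 -` {1..})"
    using \<open>closed K\<close> cont by (auto intro!: continuous_closed_preimage)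
  ultimately show ?thesis
    using \<open>?S \<subseteq> K\<close> K by (metis closed_Int compact_Int_closed inf.absorb_iff2)
qed

text \<open>The left side is affine in \<open>t\<close> and increases from \<open>a\<close> to
  \<open>b\<close>, so it meets the value 1 exactly when 1 lies between them; the witness solves the
  linear equation.\<close>

lemma interpolation_shell:
  assumes "(a::real) < b"
  shows "(\<exists>t\<in>{0..1}. (1 - t) * a + t * b = 1) \<longleftrightarrow> a \<le> 1 \<and> 1 \<le> b"
proof
  assume "\<exists>t\<in>{0..1}. (1 - t) * a + t * b = 1"
  then obtain t where t: "0 \<le> t" "t \<le> 1" and eq: "(1 - t) * a + t * b = 1" by auto
  have "t * a \<le> t * b" "(1 - t) * a \<le> (1 - t) * b" using t assms by (auto intro!: mult_left_mono)
  then show "a \<le> 1 \<and> 1 \<le> b" using eq by (simp add: algebra_simps)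
next
  assume "a \<le> 1 \<and> 1 \<le> b"
  then show "\<exists>t\<in>{0..1}. (1 - t) * a + t * b = 1"
  proof (intro bexI)
    let ?t = "(1 - a) / (b - a)"
    have "(1 - ?t) * a + ?t * b = a + ?t * (b - a)" by (simp only: algebra_simps)
    then show "(1 - ?t) * a + ?t * b = 1" using assms by simp
    show "?t \<in> {0..1}" using \<open>a \<le> 1 \<and> 1 \<le> b\<close> assms by (simp add: divide_simps)
  qed
qed

section \<open>The invariant shell\<close>

context finsler_manifold
begin

lemma isometry_nonzero:
  assumes "linear_isometry x x P" "x \<in> points \<A>" "v \<in> tangent_space \<A> x" "v \<noteq> (\<lambda>\<kappa>. 0)"
  shows "P v \<noteq> (\<lambda>\<kappa>. 0)"
proof
  assume "P v = (\<lambda>\<kappa>. 0)"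
  then have "F x v = 0"
    using assms(1,3) F_zero[OF assms(2)] unfolding linear_isometry_def by metis
  then show False using F_eq_0[OF assms(2,3)] assms(4) by blast
qed

lemma gauge_F:
  assumes \<kappa>: "\<kappa> \<in> charts_at \<A> x"
  shows "gauge_fun (\<lambda>y. F x (tvec_of \<A> \<kappa> x y))"
proof -
  interpret local_finsler "Lrep \<kappa>" "snd \<kappa> ` fst \<kappa>"
    by (rule local_finsler[OF charts_atD(1)[OF \<kappa>]])
  have p: "snd \<kappa> x \<in> snd \<kappa> ` fst \<kappa>" using charts_atD(2)[OF \<kappa>] by blast
  show ?thesis
    unfolding Lrep_at[OF \<kappa>, symmetric] gauge_fun_def
    using smooth_fiber[OF p] L_pos[OF p] hom_L[OF p] by blast
qed

lemma gauge_metric: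
  assumes \<kappa>: "\<kappa> \<in> charts_at \<A> x" and c: "0 < c"
  shows "gauge_fun (\<lambda>y. sqrt (averaged_metric c x (tvec_of \<A> \<kappa> x y) (tvec_of \<A> \<kappa> x y)))"
proof -
  obtain R where R: "weight (bumpF x \<kappa>) R" using weight_bumpF[OF \<kappa>] by blast
  let ?Q = "dirichlet (bumpF x \<kappa>)"
  have eq: "averaged_metric c x (tvec_of \<A> \<kappa> x y) (tvec_of \<A> \<kappa> x y) = c * ?Q y y" for y
    by (simp add: averaged_metric_eq[OF \<kappa> tvec_of_tangent[OF \<kappa>] tvec_of_tangent[OF \<kappa>]] tvec_of_self[OF \<kappa>])
  have pos: "0 < c * ?Q y y" if "y \<noteq> 0" for y
    using c dirichlet_pos[OF R that] by simp
  have "C_on k (- {0}) (\<lambda>y. sqrt (c * ?Q y y))" for k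
    by (intro C_on_sqrt_comp C_on_mult C_on_const C_on_bilinear[OF _ bounded_bilinear_dirichlet[OF R]] C_on_ident pos) auto
  then have "smooth_on (- {0}) (\<lambda>y. sqrt (c * ?Q y y))"
    by (simp add: smooth_on_def)
  moreover have "sqrt (c * ?Q (s *\<^sub>R y) (s *\<^sub>R y)) = s * sqrt (c * ?Q y y)" if "0 < s" for s y
  proof -
    have "c * ?Q (s *\<^sub>R y) (s *\<^sub>R y) = s\<^sup>2 * (c * ?Q y y)"
      using bounded_bilinear.scaleR_left[OF bounded_bilinear_dirichlet[OF R]]
        bounded_bilinear.scaleR_right[OF bounded_bilinear_dirichlet[OF R]] by (simp add: power2_eq_square)
    then have "sqrt (c * ?Q (s *\<^sub>R y) (s *\<^sub>R y)) = sqrt (s\<^sup>2) * sqrt (c * ?Q y y)"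
      by (simp only: real_sqrt_mult)
    then show ?thesis using that by (simp only: real_sqrt_abs abs_of_pos)
  qed
  ultimately show ?thesis
    unfolding gauge_fun_def eq using pos by simp
qed

lemma F_less_metric:
  assumes x: "x \<in> points \<A>"
  shows "\<exists>c>0. \<forall>v\<in>tangent_space \<A> x. v \<noteq> (\<lambda>\<kappa>. 0) \<longrightarrow> F x v < sqrt (averaged_metric c x v v)"
proof -
  obtain \<kappa> where \<kappa>: "\<kappa> \<in> charts_at \<A> x" using x points_charts_at by blast
  obtain C where C: "0 < C" "\<And>y. y \<noteq> 0 \<Longrightarrow> F x (tvec_of \<A> \<kappa> x y) \<le> C * norm y"
    using gauge_fun_bounds[OF gauge_F[OF \<kappa>]] by blast
  obtain R where R: "weight (bumpF x \<kappa>) R" using weight_bumpF[OF \<kappa>] by blast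
  obtain q where q: "0 < q" "\<And>y. q * (norm y)\<^sup>2 \<le> dirichlet (bumpF x \<kappa>) y y"
    using dirichlet_coercive[OF R] by blast
  \<comment> \<open>With F \<le> C |y| and the form at least q |y|^2, the scaled form is at least
    (C^2 + 1) |y|^2; the extra 1 makes the comparison with F^2 strict.\<close>
  define c where "c = (C\<^sup>2 + 1) / q"
  have c: "0 < c" using q(1) by (simp add: c_def add_nonneg_pos)
  have "F x v < sqrt (averaged_metric c x v v)" if v: "v \<in> tangent_space \<A> x" "v \<noteq> (\<lambda>\<kappa>. 0)" for v
  proof (rule real_less_rsqrt)
    have y: "v \<kappa> \<noteq> 0" using tangent_eqI[OF v(1) zero_tangent \<kappa>] v(2) by auto
    have "F x v \<le> C * norm (v \<kappa>)"
      using C(2)[OF y] by (simp add: tvec_of_component[OF v(1) \<kappa>])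
    then have "(F x v)\<^sup>2 \<le> (C * norm (v \<kappa>))\<^sup>2"
      using F_nonneg[OF x v(1)] by (intro power_mono)
    also have "\<dots> < (C\<^sup>2 + 1) * (norm (v \<kappa>))\<^sup>2"
      using y by (simp add: power_mult_distrib distrib_right)
    also have "\<dots> = c * (q * (norm (v \<kappa>))\<^sup>2)"
      using q(1) by (simp add: c_def)
    also have "\<dots> \<le> c * dirichlet (bumpF x \<kappa>) (v \<kappa>) (v \<kappa>)"
      using c q(2) by (intro mult_left_mono) auto
    also have "\<dots> = averaged_metric c x v v"
      by (simp add: averaged_metric_eq[OF \<kappa> v(1) v(1)])
    finally show "(F x v)\<^sup>2 < averaged_metric c x v v" .
  qed
  then show ?thesis using c by blast
qed

text \<open>Once the parameter t is eliminated, membership in the union is expressed by F and the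
  metric alone. Holonomy transformations are linear isometries of F, hence preserve the metric too,
  and map the shell into itself.\<close>

theorem locally_berwald_invariant_shell:
  assumes lb: "locally_berwald" and x: "x \<in> points \<A>"
  shows "\<exists>h. riemannian_metric \<A> h \<and> compact_codim0_submanifold \<A> x (indicatrix_union \<A> F h x) \<and>
    holonomy_invariant \<A> F x (indicatrix_union \<A> F h x)"
proof -
  obtain c where c: "0 < c"
    and less: "\<And>v. v \<in> tangent_space \<A> x \<Longrightarrow> v \<noteq> (\<lambda>\<kappa>. 0) \<Longrightarrow> F x v < sqrt (averaged_metric c x v v)"
    using F_less_metric[OF x] by blast
  let ?h = "averaged_metric c" and ?T = "tangent_space \<A> x"
  obtain \<kappa> where \<kappa>: "\<kappa> \<in> charts_at \<A> x" using x points_charts_at by blast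
  have h0: "?h x (\<lambda>\<kappa>. 0) (\<lambda>\<kappa>. 0) = 0"
  proof -
    obtain R where R: "weight (bumpF x \<kappa>) R" using weight_bumpF[OF \<kappa>] by blast
    show ?thesis
      using bounded_bilinear.zero_left[OF bounded_bilinear_dirichlet[OF R]]
      by (simp add: averaged_metric_eq[OF \<kappa> zero_tangent zero_tangent])
  qed
  have S: "indicatrix_union \<A> F ?h x = {v \<in> ?T. v \<noteq> (\<lambda>\<kappa>. 0) \<and> F x v \<le> 1 \<and> 1 \<le> sqrt (?h x v v)}"
  proof -
    have "(\<exists>t\<in>{0..1}. interpolation F ?h t x v = 1) \<longleftrightarrow> v \<noteq> (\<lambda>\<kappa>. 0) \<and> F x v \<le> 1 \<and> 1 \<le> sqrt (?h x v v)"
      if v: "v \<in> ?T" for v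
    proof (cases "v = (\<lambda>\<kappa>. 0)")
      \<comment> \<open>Every interpolated function is 0 at the zero vector, so this vector lies in
        none of the indicatrices.\<close>
      case True
      then show ?thesis using F_zero[OF x] h0 by (simp add: interpolation_def)
    next
      case False
      then show ?thesis
        using interpolation_shell[OF less[OF v False]] by (simp add: interpolation_def)
    qed
    then show ?thesis unfolding indicatrix_union_def indicatrix_def by blast
  qed
  let ?N1 = "\<lambda>y. F x (tvec_of \<A> \<kappa> x y)"
    and ?N2 = "\<lambda>y. sqrt (?h x (tvec_of \<A> \<kappa> x y) (tvec_of \<A> \<kappa> x y))"
  have nz: "tvec_of \<A> \<kappa> x y \<noteq> (\<lambda>\<kappa>. 0) \<longleftrightarrow> y \<noteq> 0" for y
  proof -
    have "tvec_of \<A> \<kappa> x y = (\<lambda>\<kappa>. 0) \<longleftrightarrow> y = 0"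
      using tangent_eqI[OF tvec_of_tangent[OF \<kappa>] zero_tangent \<kappa>] tvec_of_self[OF \<kappa>] by metis
    then show ?thesis by simp
  qed
  have img: "(\<lambda>v. v \<kappa>) ` indicatrix_union \<A> F ?h x = {y. y \<noteq> 0 \<and> ?N1 y \<le> 1 \<and> 1 \<le> ?N2 y}" (is "?lhs = ?rhs")
  proof
    show "?lhs \<subseteq> ?rhs"
    proof
      fix y assume "y \<in> ?lhs"
      then obtain v where v: "v \<in> ?T" "v \<noteq> (\<lambda>\<kappa>. 0)" "F x v \<le> 1" "1 \<le> sqrt (?h x v v)" and y: "y = v \<kappa>"
        unfolding S by blast
      have "tvec_of \<A> \<kappa> x y = v" unfolding y by (rule tvec_of_component[OF v(1) \<kappa>])
      then show "y \<in> ?rhs" using v nz[of y] by simp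
    qed
    show "?rhs \<subseteq> ?lhs"
    proof
      fix y assume "y \<in> ?rhs"
      then have "tvec_of \<A> \<kappa> x y \<in> indicatrix_union \<A> F ?h x"
        unfolding S using tvec_of_tangent[OF \<kappa>] nz[of y] by simp
      then have "tvec_of \<A> \<kappa> x y \<kappa> \<in> ?lhs" by (rule imageI)
      then show "y \<in> ?lhs" by (simp only: tvec_of_self[OF \<kappa>])
    qed
  qed
  have N: "?N1 y < ?N2 y" if "y \<noteq> 0" for y
    using less[OF tvec_of_tangent[OF \<kappa>]] nz that by blast
  have "compact ((\<lambda>v. v \<kappa>) ` indicatrix_union \<A> F ?h x)"
    unfolding img by (rule shell_compact[OF gauge_F[OF \<kappa>] gauge_metric[OF \<kappa> c]])
  moreover have "codim0_submanifold ((\<lambda>v. v \<kappa>) ` indicatrix_union \<A> F ?h x)"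
    unfolding img by (rule shell_codim0_submanifold[OF gauge_F[OF \<kappa>] gauge_metric[OF \<kappa> c] N])
  moreover have "indicatrix_union \<A> F ?h x \<subseteq> ?T" using S by blast
  ultimately have "compact_codim0_submanifold \<A> x (indicatrix_union \<A> F ?h x)"
    unfolding compact_codim0_submanifold_def using \<kappa> by blast
  moreover have "holonomy_invariant \<A> F x (indicatrix_union \<A> F ?h x)"
    unfolding holonomy_invariant_def
  proof (intro ballI subsetI)
    fix P w assume "P \<in> holonomy_group \<A> F x" "w \<in> P ` indicatrix_union \<A> F ?h x"
    then obtain v where P: "linear_isometry x x P" and w: "w = P v"
      and v: "v \<in> ?T" "v \<noteq> (\<lambda>\<kappa>. 0)" "F x v \<le> 1" "1 \<le> sqrt (?h x v v)"
      using piecewise_transport_isometry[OF lb] unfolding holonomy_group_def S by blast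
    have "P v \<in> ?T" "F x (P v) = F x v"
      using P v(1) unfolding linear_isometry_def by blast+
    then show "w \<in> indicatrix_union \<A> F ?h x"
      unfolding S w using v isometry_nonzero[OF P x v(1,2)] isometry_averaged_metric[OF P x v(1) v(1), of c] by simp
  qed
  ultimately show ?thesis
    using riemannian_averaged_metric[OF c] by blast
qed

section \<open>Berwald and locally Minkowski spaces\<close>

lemma averaged_berwald_iff:
  assumes "\<kappa> \<in> \<A>"
  shows "local_finsler.averaged_berwald (Lrep \<kappa>) (snd \<kappa> ` fst \<kappa>) \<longleftrightarrow>
    (\<forall>p\<in>snd \<kappa> ` fst \<kappa>. \<forall>y y'. y \<noteq> 0 \<longrightarrow> y' \<noteq> 0 \<longrightarrow>
      (\<forall>i j k. chern_coeff (Lrep \<kappa>) i j k (p, y) = chern_coeff (Lrep \<kappa>) i j k (p, y')))"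
  by (rule local_finsler.averaged_berwald_def[OF local_finsler[OF assms]])

lemma berwald_locally_berwald: "berwald_space \<A> F \<Longrightarrow> locally_berwald"
  unfolding locally_berwald_def
proof
  fix x assume b: "berwald_space \<A> F" and "x \<in> points \<A>"
  then obtain \<kappa> where \<kappa>: "\<kappa> \<in> charts_at \<A> x" using points_charts_at by blast
  have "local_finsler.averaged_berwald (Lrep \<kappa>) (snd \<kappa> ` fst \<kappa>)"
    unfolding averaged_berwald_iff[OF charts_atD(1)[OF \<kappa>]]
    using b charts_atD(1)[OF \<kappa>] unfolding berwald_space_def by blast
  with \<kappa> show "\<exists>\<kappa>\<in>charts_at \<A> x. local_finsler.averaged_berwald (Lrep \<kappa>) (snd \<kappa> ` fst \<kappa>)"
    by blast
qed

lemma locally_minkowski_locally_berwald: "locally_minkowski_space \<A> F \<Longrightarrow> locally_berwald"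
  unfolding locally_berwald_def
proof
  fix x assume "locally_minkowski_space \<A> F" and "x \<in> points \<A>"
  then obtain \<kappa> where \<kappa>: "\<kappa> \<in> charts_at \<A> x"
    and m: "\<And>p p' y. p \<in> snd \<kappa> ` fst \<kappa> \<Longrightarrow> p' \<in> snd \<kappa> ` fst \<kappa> \<Longrightarrow> Lrep \<kappa> (p, y) = Lrep \<kappa> (p', y)"
    unfolding locally_minkowski_space_def by meson
  interpret local_finsler "Lrep \<kappa>" "snd \<kappa> ` fst \<kappa>"
    by (rule local_finsler[OF charts_atD(1)[OF \<kappa>]])
  have "chern_coeff (Lrep \<kappa>) i j k (p, y) = 0" if "p \<in> snd \<kappa> ` fst \<kappa>" "y \<noteq> 0" for i j k p y
    by (rule chern_coeff_minkowski[OF m]) (use that in \<open>auto simp: slit_def\<close>)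
  then have "averaged_berwald"
    unfolding averaged_berwald_def by simp
  with \<kappa> show "\<exists>\<kappa>\<in>charts_at \<A> x. local_finsler.averaged_berwald (Lrep \<kappa>) (snd \<kappa> ` fst \<kappa>)"
    by blast
qed

end

theorem theorem4p2:
  fixes \<A> :: "('m::{t2_space, second_countable_topology}, 'n::finite) chart set"
    and F :: "'m \<Rightarrow> ('m, 'n) tvec \<Rightarrow> real"
  assumes "smooth_manifold \<A>"
    and "points \<A> \<noteq> {}"
    and "landsberg_space \<A> F"
    and "\<forall>x\<in>points \<A>. \<forall>h. riemannian_metric \<A> h \<longrightarrow>
           compact_codim0_submanifold \<A> x (indicatrix_union \<A> F h x) \<longrightarrow>
           \<not> holonomy_invariant \<A> F x (indicatrix_union \<A> F h x)"
  shows "pure_landsberg_space \<A> F"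
proof -
  interpret finsler_manifold \<A> F
    using assms(1,3) by unfold_locales (auto simp: landsberg_space_def)
  \<comment> \<open>One point is enough: the metric constructed for it contradicts the hypothesis at
    that point.\<close>
  obtain x where "x \<in> points \<A>" using assms(2) by blast
  then have "\<not> locally_berwald"
    using locally_berwald_invariant_shell assms(4) by blast
  then show ?thesis
    unfolding pure_landsberg_space_def
    using assms(3) berwald_locally_berwald locally_minkowski_locally_berwald by blast
qed

end
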